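(* Assume A1 and A3. Then for every $\theta=(\theta_i)_{i\ge1}$ satisfying A2, $$\lim_{n\to\infty}\ \sup_{\tau\in[0,\infty],\,|\eta|\le a_n}a_n^4\ \mathbb{E}\Big|\widehat{\mathrm{ARE}}^{D}_n(\eta,\tau)-L_n(\theta,\hat q(\eta,\tau))\Big|=0,\qquad a_n=\log\log n.$$
   Context: Setting. $(\theta_i)_{i\ge1}$ are real numbers and $(\nu_{p,i}),(\nu_{f,i}),(b_i),(h_i)$ are known sequences of positive numbers. $N(\mu,\nu)$ is the normal law with mean $\mu$ and variance $\nu$; $\phi,\Phi$ are the standard normal density and CDF. For each $n$ (large enough that $\log\log n>0$), $X=(X_1,\dots,X_n)$ has independent coordinates $X_i\sim N(\theta_i,\nu_{p,i})$. Put $\tilde b_i=b_i/(b_i+h_i)$ and $G(w,\beta)=\phi(w)+w\Phi(w)-\beta w$. The loss of a prediction $q\in\mathbb{R}^n$ is $L_n(\theta,q)=\frac1n\sum_{i=1}^n l_i(\theta_i,q_i)$ with $l_i(\theta_i,q_i)=\sqrt{\nu_{f,i}}\,(b_i+h_i)\,G\big((q_i-\theta_i)/\sqrt{\nu_{f,i}},\tilde b_i\big)$, which equals $\mathbb{E}_{Y\sim N(\theta_i,\nu_{f,i})}[b_i(Y-q_i)^++h_i(q_i-Y)^+]$. Predictors. For $\eta\in\mathbb{R}$, $\tau\in[0,\infty]$: $\alpha_i(\tau)=\tau/(\tau+\nu_{p,i})$ ($\alpha_i(\infty)=1$), $\hat q_i(\eta,\tau)=\alpha_i(\tau)X_i+(1-\alpha_i(\tau))\eta+\sqrt{\nu_{f,i}+\alpha_i(\tau)\nu_{p,i}}\;\Phi^{-1}(\tilde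 b_i)$, $\hat q(\eta,\tau)=(\hat q_1(\eta,\tau),\dots,\hat q_n(\eta,\tau))$. Assumptions. A1: $0<\inf_i\tilde b_i\le\sup_i\tilde b_i<1$ and $\sup_i(b_i+h_i)<\infty$. A2: $\limsup_{n\to\infty}\frac1n\sum_{i=1}^n|\theta_i|<\infty$. A3: $\sup_i\nu_{p,i}/\nu_{f,i}<1/(4e)$, $\sup_i\nu_{f,i}<\infty$, $\inf_i\nu_{p,i}>0$. Risk estimate. Let $$c_i(\tau)=\sqrt{\frac{\nu_{f,i}+\alpha_i(\tau)\nu_{p,i}}{\nu_{f,i}+\alpha_i(\tau)^2\nu_{p,i}}}\;\Phi^{-1}(\tilde b_i),\qquad d_i(\tau)=-\frac{1-\alpha_i(\tau)}{\sqrt{\nu_{f,i}+\alpha_i(\tau)^2\nu_{p,i}}},\qquad s_i(\tau)=\sqrt{2\nu_{p,i}}\,|d_i(\tau)|.$$ Fix for each $i$ any number $\gamma(i)$ with $0<\gamma(i)<1/\sqrt{4e}-\sqrt{\nu_{p,i}/\nu_{f,i}}$, and set $\lambda_n(i)=\gamma(i)\sqrt{2\log n}$ and $K_n(i)=1+\big\lceil e^2\big(\gamma(i)+\sqrt{2\nu_{p,i}/\nu_{f,i}}\big)^2(2\log n)\big\rceil$. With $H_k$ the probabilists' Hermite polynomials and $G'$ the derivative of $G$ in its first argument, put $$S_{i,\tau}(u)=G(0,\tilde b_i)+G'(0,\tilde b_i)\,u+\phi(0)\sum_{k=0}^{K_n(i)-2}\frac{(-1)^kH_k(0)}{(k+2)!}\,s_i(\tau)^{k+2}H_{k+2}\big(u/s_i(\tau)\big)$$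 (when $s_i(\tau)=0$, $s^{m}H_m(u/s)$ is read as its limit $u^m$), and $\tilde S_{i,\tau}(u)=\mathrm{sign}(S_{i,\tau}(u))\min\{|S_{i,\tau}(u)|,n\}$. For $x,z\in\mathbb{R}$ let $U=c_i(\tau)+d_i(\tau)(x+\sqrt{\nu_{p,i}}z)$, $V=c_i(\tau)+d_i(\tau)(x-\sqrt{\nu_{p,i}}z)$, and define $\hat T_i(x,z,\tau)=-\tilde b_iU$ if $V<-\lambda_n(i)$; $=\tilde S_{i,\tau}(U)$ if $|V|\le\lambda_n(i)$; $=(1-\tilde b_i)U$ if $V>\lambda_n(i)$. Let $\hat T_i(x,\tau)=\mathbb{E}_{Z\sim N(0,1)}[\hat T_i(x,Z,\tau)]$ and $$\widehat{\mathrm{ARE}}^{D}_n(\eta,\tau)=\frac1n\sum_{i=1}^n(b_i+h_i)\sqrt{\nu_{f,i}+\nu_{p,i}\alpha_i(\tau)^2}\;\hat T_i(X_i-\eta,\tau).$$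
   Formalization: The numbers γ(i) are additionally assumed bounded away from zero (inf_i γ(i) > 0); without this the claim fails, e.g. for b=h=ν_f=1, ν_p=1/100, θ=0, γ(i)=2^{-i}/10 at η=τ=0. *)

theory Defs
  imports "HOL-Probability.Probability"
begin

text \<open>
  The normal law with mean \<open>\<mu>\<close> and variance \<open>\<nu>\<close> has the density
  \<open>normal_density \<mu> (sqrt \<nu>)\<close>: the library function is parametrised by the
  standard deviation. Coordinates are numbered from 1. The per-coordinate quantities take
  the scalars \<open>\<nu>p = \<nu>\<^sub>p\<^sub>,\<^sub>i\<close>, \<open>\<nu>f = \<nu>\<^sub>f\<^sub>,\<^sub>i\<close>, \<open>\<gamma> = \<gamma>(i)\<close> and
  \<open>\<beta> = b\<^sub>i / (b\<^sub>i + h\<^sub>i)\<close> as arguments.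
\<close>

definition Phi :: "real \<Rightarrow> real" where
  "Phi = cdf std_normal_distribution"

text \<open>
  \<open>Phi\<close> is a strictly increasing bijection from the reals onto the open unit interval, so
  \<open>inv Phi p\<close> is the normal quantile for every \<open>p\<close> with \<open>0 < p < 1\<close>; it is only used there.
\<close>

definition Phi_inv :: "real \<Rightarrow> real" where
  "Phi_inv = inv Phi"

definition G :: "real \<Rightarrow> real \<Rightarrow> real" where
  "G w \<beta> = std_normal_density w + w * Phi w - \<beta> * w"

definition btilde :: "(nat \<Rightarrow> real) \<Rightarrow> (nat \<Rightarrow> real) \<Rightarrow> nat \<Rightarrow> real" where
  "btilde b h i = b i / (b i + h i)"

definition coord_loss :: "real \<Rightarrow> real \<Rightarrow> real \<Rightarrow> real \<Rightarrow> real \<Rightarrow> real" where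
  "coord_loss \<nu>f b h \<theta> q = sqrt \<nu>f * (b + h) * G ((q - \<theta>) / sqrt \<nu>f) (b / (b + h))"

definition avg_loss ::
  "(nat \<Rightarrow> real) \<Rightarrow> (nat \<Rightarrow> real) \<Rightarrow> (nat \<Rightarrow> real) \<Rightarrow> nat \<Rightarrow> (nat \<Rightarrow> real) \<Rightarrow> (nat \<Rightarrow> real) \<Rightarrow> real"
  where
  "avg_loss \<nu>f b h n \<theta> q =
     (1 / real n) * (\<Sum>i=1..n. coord_loss (\<nu>f i) (b i) (h i) (\<theta> i) (q i))"

text \<open>The type \<open>ennreal\<close> serves as the parameter set \<open>[0, \<infinity>]\<close> of \<open>\<tau>\<close>.\<close>

definition alpha :: "real \<Rightarrow> ennreal \<Rightarrow> real" where
  "alpha \<nu>p \<tau> = (if \<tau> = \<infinity> then 1 else enn2real \<tau> / (enn2real \<tau> + \<nu>p))"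

definition predictor ::
  "(nat \<Rightarrow> real) \<Rightarrow> (nat \<Rightarrow> real) \<Rightarrow> (nat \<Rightarrow> real) \<Rightarrow> (nat \<Rightarrow> real) \<Rightarrow>
   (nat \<Rightarrow> real) \<Rightarrow> real \<Rightarrow> ennreal \<Rightarrow> nat \<Rightarrow> real" where
  "predictor \<nu>p \<nu>f b h x \<eta> \<tau> i =
     alpha (\<nu>p i) \<tau> * x i + (1 - alpha (\<nu>p i) \<tau>) * \<eta>
       + sqrt (\<nu>f i + alpha (\<nu>p i) \<tau> * \<nu>p i) * Phi_inv (btilde b h i)"

definition c_coef :: "real \<Rightarrow> real \<Rightarrow> real \<Rightarrow> ennreal \<Rightarrow> real" where
  "c_coef \<nu>p \<nu>f \<beta> \<tau> =
     sqrt ((\<nu>f + alpha \<nu>p \<tau> * \<nu>p) / (\<nu>f + (alpha \<nu>p \<tau>)\<^sup>2 * \<nu>p)) * Phi_inv \<beta>"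

definition d_coef :: "real \<Rightarrow> real \<Rightarrow> ennreal \<Rightarrow> real" where
  "d_coef \<nu>p \<nu>f \<tau> = - ((1 - alpha \<nu>p \<tau>) / sqrt (\<nu>f + (alpha \<nu>p \<tau>)\<^sup>2 * \<nu>p))"

definition s_coef :: "real \<Rightarrow> real \<Rightarrow> ennreal \<Rightarrow> real" where
  "s_coef \<nu>p \<nu>f \<tau> = sqrt (2 * \<nu>p) * \<bar>d_coef \<nu>p \<nu>f \<tau>\<bar>"

definition threshold :: "nat \<Rightarrow> real \<Rightarrow> real" where
  "threshold n \<gamma> = \<gamma> * sqrt (2 * ln (real n))"

definition trunc_order :: "nat \<Rightarrow> real \<Rightarrow> real \<Rightarrow> real \<Rightarrow> nat" where
  "trunc_order n \<nu>p \<nu>f \<gamma> =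
     1 + nat \<lceil>(exp 1)\<^sup>2 * (\<gamma> + sqrt (2 * \<nu>p / \<nu>f))\<^sup>2 * (2 * ln (real n))\<rceil>"

text \<open>Probabilists' Hermite polynomials, by their three-term recurrence.\<close>

fun hermite :: "nat \<Rightarrow> real \<Rightarrow> real" where
  "hermite 0 x = 1"
| "hermite (Suc 0) x = x"
| "hermite (Suc (Suc k)) x = x * hermite (Suc k) x - real (Suc k) * hermite k x"

text \<open>The value \<open>s\<^sup>m H\<^sub>m(u / s)\<close>, read at \<open>s = 0\<close> as its limit \<open>u\<^sup>m\<close>.\<close>

definition scaled_hermite :: "nat \<Rightarrow> real \<Rightarrow> real \<Rightarrow> real" where
  "scaled_hermite m s u = (if s = 0 then u ^ m else s ^ m * hermite m (u / s))"

text \<open>The summation range \<open>k < K - 1\<close> is \<open>k = 0, \<dots>, K - 2\<close>; note \<open>trunc_order\<close> is at least 1.\<close>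

definition S_series :: "nat \<Rightarrow> real \<Rightarrow> real \<Rightarrow> real \<Rightarrow> real \<Rightarrow> ennreal \<Rightarrow> real \<Rightarrow> real" where
  "S_series n \<nu>p \<nu>f \<beta> \<gamma> \<tau> u =
     G 0 \<beta> + deriv (\<lambda>w. G w \<beta>) 0 * u
       + std_normal_density 0 *
         (\<Sum>k<trunc_order n \<nu>p \<nu>f \<gamma> - 1.
            (- 1) ^ k * hermite k 0 / fact (k + 2) *
              scaled_hermite (k + 2) (s_coef \<nu>p \<nu>f \<tau>) u)"

definition S_trunc :: "nat \<Rightarrow> real \<Rightarrow> real \<Rightarrow> real \<Rightarrow> real \<Rightarrow> ennreal \<Rightarrow> real \<Rightarrow> real" where
  "S_trunc n \<nu>p \<nu>f \<beta> \<gamma> \<tau> u =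
     sgn (S_series n \<nu>p \<nu>f \<beta> \<gamma> \<tau> u) * min \<bar>S_series n \<nu>p \<nu>f \<beta> \<gamma> \<tau> u\<bar> (real n)"

definition T_rand ::
  "nat \<Rightarrow> real \<Rightarrow> real \<Rightarrow> real \<Rightarrow> real \<Rightarrow> real \<Rightarrow> real \<Rightarrow> ennreal \<Rightarrow> real" where
  "T_rand n \<nu>p \<nu>f \<beta> \<gamma> x z \<tau> =
     (let U = c_coef \<nu>p \<nu>f \<beta> \<tau> + d_coef \<nu>p \<nu>f \<tau> * (x + sqrt \<nu>p * z);
          V = c_coef \<nu>p \<nu>f \<beta> \<tau> + d_coef \<nu>p \<nu>f \<tau> * (x - sqrt \<nu>p * z)
      in if V < - threshold n \<gamma> then - \<beta> * U
         else if V \<le> threshold n \<gamma> then S_trunc n \<nu>p \<nu>f \<beta> \<gamma> \<tau> U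
         else (1 - \<beta>) * U)"

definition T_hat ::
  "nat \<Rightarrow> real \<Rightarrow> real \<Rightarrow> real \<Rightarrow> real \<Rightarrow> real \<Rightarrow> ennreal \<Rightarrow> real" where
  "T_hat n \<nu>p \<nu>f \<beta> \<gamma> x \<tau> =
     (LINT z|std_normal_distribution. T_rand n \<nu>p \<nu>f \<beta> \<gamma> x z \<tau>)"

definition ARE_D ::
  "(nat \<Rightarrow> real) \<Rightarrow> (nat \<Rightarrow> real) \<Rightarrow> (nat \<Rightarrow> real) \<Rightarrow> (nat \<Rightarrow> real) \<Rightarrow> (nat \<Rightarrow> real) \<Rightarrow>
   nat \<Rightarrow> (nat \<Rightarrow> real) \<Rightarrow> real \<Rightarrow> ennreal \<Rightarrow> real" where
  "ARE_D \<nu>p \<nu>f b h \<gamma> n x \<eta> \<tau> =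
     (1 / real n) *
     (\<Sum>i=1..n. (b i + h i) * sqrt (\<nu>f i + \<nu>p i * (alpha (\<nu>p i) \<tau>)\<^sup>2) *
        T_hat n (\<nu>p i) (\<nu>f i) (btilde b h i) (\<gamma> i) (x i - \<eta>) \<tau>)"

definition a_seq :: "nat \<Rightarrow> real" where
  "a_seq n = ln (ln (real n))"

end

theory Submission
  imports Defs "HOL-Computational_Algebra.Polynomial" "HOL-Real_Asymp.Real_Asymp"
begin

text \<open>
  The estimate splits over coordinates, and the coordinates are independent, so it suffices to bound the
  mean of the error of each coordinate by a power of \<open>1/n\<close> (up to logarithms) and its variance by
  \<open>n\<^sup>q\<close> with \<open>q < 1\<close>, uniformly in \<open>\<theta>\<close>, \<open>\<eta>\<close>, \<open>\<tau>\<close>. By rotation invariance of the Gaussian law, \<open>U\<close> and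
  \<open>V\<close> are independent normal variables with mean \<open>\<omega> = c + d (\<theta> - \<eta>)\<close> and variance \<open>s\<^sup>2\<close>, and the
  expected loss is the convolution \<open>sqrt (\<nu>f + \<nu>p \<alpha>\<^sup>2) (b + h) G \<omega>\<close>. The scaled Hermite polynomials satisfy
  \<open>E P\<^sub>m(U) = \<omega>\<^sup>m\<close> and \<open>E P\<^sub>m(U)\<^sup>2 \<le> m! exp (\<omega>\<^sup>2 / (1 - s\<^sup>2))\<close>. Let \<open>p = \<gamma> + sqrt (2 \<nu>p / \<nu>f)\<close>; A3 and
  the bound on \<open>\<gamma>\<close> give \<open>p\<^sup>2 \<le> 1 / (2 e)\<close>. For \<open>\<omega>\<^sup>2 \<le> 3 p\<^sup>2 ln n\<close> the truncated series has a negligible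
  Taylor remainder and second moment at most \<open>n\<close> to the power \<open>3/4\<close> (up to logarithms); for larger \<open>\<omega>\<close> the
  probability that \<open>V\<close> falls below the threshold in absolute value is at most \<open>n\<close> to the power \<open>-3/2\<close>,
  which beats the clipping level \<open>n\<close>. The two outer regions are controlled by Gaussian tails.
\<close>

section \<open>The standard normal law\<close>

text \<open>The factor 3 in the cut \<open>3 * (\<gamma> + r)\<^sup>2 * ell\<close> balances two
  demands. With 2 instead, the distance from \<omega> to the central band would only be guaranteed
  to exceed \<open>r * sqrt (2 * ell)\<close>, giving a tail bound 1/n that ties with the clipping
  level n; with 3 the tail exponent is 3/2. In the other direction the bound exp(\<omega>^2 / (1 -
  \<sigma>^2)) must stay below a power of n less than 1, because averaging n terms and clipping at n
  both divide it by n. As (\<gamma> + r)^2 and \<sigma>^2 are at most 1/5, the exponent is (3/5) /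
  (4/5) = 3/4.

  The mean \<omega> ranges over the whole line, so moments about zero have no uniform bound. Second
  moments are therefore taken about moving centres: the piecewise linear asymptote of
  \<open>G\<close> for the estimator, the value at zero noise for the loss. Neither is the true
  mean, which is harmless because the variance is the smallest second moment.

  The supremum stands outside the expectation, so one fixed pair (\<eta>, \<tau>) suffices if the
  constants do not depend on it.\<close>

abbreviation N01 :: "real measure" where
  "N01 \<equiv> std_normal_distribution"

interpretation N01: prob_space N01
  by (rule prob_space_normal_density) simp

interpretation N01_pair: pair_prob_space N01 N01 ..

text \<open>Completing the square turns the weighted density into a multiple of the normal density
  with mean \<open>t\<close>, which settles integrability and value together.\<close>

lemma integrable_N01_exp: "integrable N01 (\<lambda>x. exp (t * x))"
  and integral_N01_exp: "(LINT x|N01. exp (t * x)) = exp (t\<^sup>2 / 2)"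
proof -
  have eq: "std_normal_density x * exp (t * x) = exp (t\<^sup>2 / 2) * normal_density t 1 x" for x
    by (simp add: normal_density_def exp_add[symmetric] power2_eq_square field_simps)
  have "integrable lborel (\<lambda>x. std_normal_density x * exp (t * x))"
    unfolding eq by simp
  then show "integrable N01 (\<lambda>x. exp (t * x))"
    by (subst integrable_density) auto
  show "(LINT x|N01. exp (t * x)) = exp (t\<^sup>2 / 2)"
    by (subst integral_density) (auto simp: eq)
qed

text \<open>Chernoff bound with the optimal exponent \<open>y / s2\<close>. Only an upper bound
  \<open>s2\<close> for the squared scale enters, so the estimate is uniform in \<tau> and covers
  \<sigma> = 0, which occurs at \<tau> = \<infinity>.\<close>

lemma N01_tail:
  assumes "\<sigma>\<^sup>2 \<le> s2" "0 < s2" "0 \<le> y"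
  shows "measure N01 {v. y \<le> \<sigma> * v} \<le> exp (- (y\<^sup>2 / (2 * s2)))"
proof -
  define t where "t = y / s2"
  have t: "0 \<le> t" using assms by (simp add: t_def)
  have "measure N01 {v. y \<le> \<sigma> * v} = (LINT v|N01. indicator {v. y \<le> \<sigma> * v} v)"
    by simp
  also have "\<dots> \<le> (LINT v|N01. exp (- t * y) * exp ((t * \<sigma>) * v))"
  proof (rule integral_mono)
    show "integrable N01 (indicat_real {v. y \<le> \<sigma> * v})"
      by (rule integrable_real_indicator) (auto simp: N01.emeasure_eq_measure)
    show "integrable N01 (\<lambda>v. exp (- t * y) * exp ((t * \<sigma>) * v))"
      by (intro integrable_mult_right integrable_N01_exp)
    fix v
    have "1 \<le> exp (t * (\<sigma> * v - y))" if "y \<le> \<sigma> * v"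
      using that t by simp
    then show "indicator {v. y \<le> \<sigma> * v} v \<le> exp (- t * y) * exp ((t * \<sigma>) * v)"
      by (auto simp: indicator_def exp_add[symmetric] algebra_simps)
  qed
  also have "\<dots> = exp (- t * y) * exp ((t * \<sigma>)\<^sup>2 / 2)"
    by (simp add: integral_N01_exp)
  also have "\<dots> = exp (t\<^sup>2 * \<sigma>\<^sup>2 / 2 - t * y)"
    by (simp add: exp_add[symmetric] power_mult_distrib)
  also have "\<dots> \<le> exp (- (y\<^sup>2 / (2 * s2)))"
  proof -
    have "t\<^sup>2 * \<sigma>\<^sup>2 \<le> t\<^sup>2 * s2"
      using assms by (intro mult_left_mono) auto
    also have "t\<^sup>2 * s2 = t * y"
      using assms by (simp add: t_def power2_eq_square)
    finally have "t\<^sup>2 * \<sigma>\<^sup>2 / 2 - t * y \<le> - (t * y / 2)" by simp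
    also have "t * y / 2 = y\<^sup>2 / (2 * s2)"
      by (simp add: t_def power2_eq_square)
    finally show ?thesis by simp
  qed
  finally show ?thesis .
qed

text \<open>The matrix with rows (p, q) and (q, -p) is an orthogonal involution. Instead of a planar
  change of variables the coordinates are replaced one at a time, \<open>z\<close> for fixed
  \<open>w\<close> and then \<open>w\<close> for fixed new \<open>y\<close>, with Fubini for
  nonnegative functions in between. The Jacobian factors 1/|q| and |q| cancel, and the product
  density depends only on the sum of squares.\<close>

lemma nn_integral_N01_rotation:
  fixes f :: "real \<times> real \<Rightarrow> ennreal"
  assumes f [measurable]: "f \<in> borel_measurable (borel \<Otimes>\<^sub>M borel)"
    and pq: "p\<^sup>2 + q\<^sup>2 = 1" "q \<noteq> 0"
  shows "(\<integral>\<^sup>+w. \<integral>\<^sup>+z. f (p * w + q * z, q * w - p * z) \<partial>N01 \<partial>N01) = (\<integral>\<^sup>+w. \<integral>\<^sup>+z. f (w, z) \<partial>N01 \<partial>N01)"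
proof -
  let ?d = "\<lambda>x. ennreal (std_normal_density x)"
  have 1: "(\<integral>\<^sup>+w. \<integral>\<^sup>+z. g w z \<partial>N01 \<partial>N01) = (\<integral>\<^sup>+w. \<integral>\<^sup>+z. ?d w * ?d z * g w z \<partial>lborel \<partial>lborel)"
    if [measurable]: "case_prod g \<in> borel_measurable (borel \<Otimes>\<^sub>M borel)" for g :: "real \<Rightarrow> real \<Rightarrow> ennreal"
    by (simp add: nn_integral_density nn_integral_cmult[symmetric] mult.assoc)
  have "(\<integral>\<^sup>+w. \<integral>\<^sup>+z. f (p * w + q * z, q * w - p * z) \<partial>N01 \<partial>N01)
      = (\<integral>\<^sup>+w. \<integral>\<^sup>+z. ?d w * ?d z * f (p * w + q * z, q * w - p * z) \<partial>lborel \<partial>lborel)"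
    by (rule 1) measurable
  also have "\<dots> = (\<integral>\<^sup>+w. \<integral>\<^sup>+y. ennreal (1 / \<bar>q\<bar>) * (?d w * ?d ((y - p * w) / q) *
       f (y, q * w - p * ((y - p * w) / q))) \<partial>lborel \<partial>lborel)"
  proof (rule nn_integral_cong)
    fix w :: real
    have "(\<integral>\<^sup>+z. ?d w * ?d z * f (p * w + q * z, q * w - p * z) \<partial>lborel)
       = ennreal \<bar>1 / q\<bar> * (\<integral>\<^sup>+y. ?d w * ?d (- p * w / q + 1 / q * y) *
           f (p * w + q * (- p * w / q + 1 / q * y), q * w - p * (- p * w / q + 1 / q * y)) \<partial>lborel)"
      using pq by (intro nn_integral_real_affine) auto
    also have "\<dots> = (\<integral>\<^sup>+y. ennreal \<bar>1 / q\<bar> * (?d w * ?d (- p * w / q + 1 / q * y) *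
           f (p * w + q * (- p * w / q + 1 / q * y), q * w - p * (- p * w / q + 1 / q * y))) \<partial>lborel)"
      by (rule nn_integral_cmult[symmetric]) measurable
    also have "\<dots> = (\<integral>\<^sup>+y. ennreal (1 / \<bar>q\<bar>) * (?d w * ?d ((y - p * w) / q) *
       f (y, q * w - p * ((y - p * w) / q))) \<partial>lborel)"
    proof (rule nn_integral_cong)
      fix y
      have a: "- p * w / q + 1 / q * y = (y - p * w) / q" by (simp add: diff_divide_distrib)
      have b: "p * w + q * ((y - p * w) / q) = y" using pq by simp
      show "ennreal \<bar>1 / q\<bar> * (?d w * ?d (- p * w / q + 1 / q * y) *
           f (p * w + q * (- p * w / q + 1 / q * y), q * w - p * (- p * w / q + 1 / q * y)))
         = ennreal (1 / \<bar>q\<bar>) * (?d w * ?d ((y - p * w) / q) * f (y, q * w - p * ((y - p * w) / q)))"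
        unfolding a b by simp
    qed
    finally show "(\<integral>\<^sup>+z. ?d w * ?d z * f (p * w + q * z, q * w - p * z) \<partial>lborel) = \<dots>" .
  qed
  also have "\<dots> = (\<integral>\<^sup>+y. \<integral>\<^sup>+w. ennreal (1 / \<bar>q\<bar>) * (?d w * ?d ((y - p * w) / q) *
       f (y, q * w - p * ((y - p * w) / q))) \<partial>lborel \<partial>lborel)"
    by (rule lborel_pair.Fubini') measurable
  also have "\<dots> = (\<integral>\<^sup>+y. \<integral>\<^sup>+v. ?d y * ?d v * f (y, v) \<partial>lborel \<partial>lborel)"
  proof (rule nn_integral_cong)
    fix y :: real
    have "(\<integral>\<^sup>+w. ennreal (1 / \<bar>q\<bar>) * (?d w * ?d ((y - p * w) / q) *
       f (y, q * w - p * ((y - p * w) / q))) \<partial>lborel)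
      = ennreal \<bar>q\<bar> * (\<integral>\<^sup>+v. ennreal (1 / \<bar>q\<bar>) * (?d (p * y + q * v) * ?d ((y - p * (p * y + q * v)) / q) *
       f (y, q * (p * y + q * v) - p * ((y - p * (p * y + q * v)) / q))) \<partial>lborel)"
      using pq by (intro nn_integral_real_affine) auto
    also have "\<dots> = (\<integral>\<^sup>+v. ennreal \<bar>q\<bar> * (ennreal (1 / \<bar>q\<bar>) * (?d (p * y + q * v) * ?d ((y - p * (p * y + q * v)) / q) *
       f (y, q * (p * y + q * v) - p * ((y - p * (p * y + q * v)) / q)))) \<partial>lborel)"
      by (rule nn_integral_cmult[symmetric]) measurable
    also have "\<dots> = (\<integral>\<^sup>+v. ?d y * ?d v * f (y, v) \<partial>lborel)"
    proof (rule nn_integral_cong)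
      fix v :: real
      have "y - p * (p * y + q * v) = (1 - p\<^sup>2) * y - p * q * v"
        by (simp add: algebra_simps power2_eq_square)
      also have "\<dots> = q * (q * y - p * v)"
      proof -
        have "1 - p\<^sup>2 = q * q" using pq by (simp add: power2_eq_square)
        then show ?thesis by (simp only:) (simp add: algebra_simps)
      qed
      finally have a: "(y - p * (p * y + q * v)) / q = q * y - p * v"
        using pq by simp
      have "q * (p * y + q * v) - p * (q * y - p * v) = (p\<^sup>2 + q\<^sup>2) * v"
        by (simp add: algebra_simps power2_eq_square)
      then have b: "q * (p * y + q * v) - p * (q * y - p * v) = v"
        using pq by simp
      have "(p * y + q * v)\<^sup>2 + (q * y - p * v)\<^sup>2 = (p\<^sup>2 + q\<^sup>2) * (y\<^sup>2 + v\<^sup>2)"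
        by (simp add: algebra_simps power2_eq_square)
      then have "(p * y + q * v)\<^sup>2 + (q * y - p * v)\<^sup>2 = y\<^sup>2 + v\<^sup>2"
        using pq by simp
      then have "- (p * y + q * v)\<^sup>2 / 2 + - (q * y - p * v)\<^sup>2 / 2 = - y\<^sup>2 / 2 + - v\<^sup>2 / 2"
        by (simp add: field_simps)
      then have "exp (- (p * y + q * v)\<^sup>2 / 2) * exp (- (q * y - p * v)\<^sup>2 / 2)
          = exp (- y\<^sup>2 / 2) * exp (- v\<^sup>2 / 2)"
        unfolding exp_add[symmetric] by simp
      then have "std_normal_density (p * y + q * v) * std_normal_density (q * y - p * v)
          = std_normal_density y * std_normal_density v"
        by (simp add: std_normal_density_def)
      then have c: "?d (p * y + q * v) * ?d (q * y - p * v) = ?d y * ?d v"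
        by (simp add: ennreal_mult[symmetric])
      have e: "ennreal \<bar>q\<bar> * ennreal (1 / \<bar>q\<bar>) = 1"
        using pq by (simp add: ennreal_mult[symmetric])
      show "ennreal \<bar>q\<bar> * (ennreal (1 / \<bar>q\<bar>) * (?d (p * y + q * v) * ?d ((y - p * (p * y + q * v)) / q) *
         f (y, q * (p * y + q * v) - p * ((y - p * (p * y + q * v)) / q)))) = ?d y * ?d v * f (y, v)"
        unfolding a b c mult.assoc[symmetric] e by simp
    qed
    finally show "(\<integral>\<^sup>+w. ennreal (1 / \<bar>q\<bar>) * (?d w * ?d ((y - p * w) / q) *
       f (y, q * w - p * ((y - p * w) / q))) \<partial>lborel) = \<dots>" .
  qed
  also have "\<dots> = (\<integral>\<^sup>+w. \<integral>\<^sup>+z. f (w, z) \<partial>N01 \<partial>N01)"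
    by (rule 1[symmetric]) simp
  finally show ?thesis .
qed

lemma distr_N01_rotation:
  assumes pq: "p\<^sup>2 + q\<^sup>2 = 1" "q \<noteq> 0"
  shows "distr (N01 \<Otimes>\<^sub>M N01) (borel \<Otimes>\<^sub>M borel) (\<lambda>(w, z). (p * w + q * z, q * w - p * z)) = N01 \<Otimes>\<^sub>M N01"
proof (rule measure_eqI)
  have sets: "sets (N01 \<Otimes>\<^sub>M N01) = sets (borel \<Otimes>\<^sub>M borel)"
    by (intro sets_pair_measure_cong) auto
  show "sets (distr (N01 \<Otimes>\<^sub>M N01) (borel \<Otimes>\<^sub>M borel) (\<lambda>(w, z). (p * w + q * z, q * w - p * z))) = sets (N01 \<Otimes>\<^sub>M N01)"
    by (simp add: sets)
  fix A assume "A \<in> sets (distr (N01 \<Otimes>\<^sub>M N01) (borel \<Otimes>\<^sub>M borel) (\<lambda>(w, z). (p * w + q * z, q * w - p * z)))"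
  then have A [measurable]: "A \<in> sets (borel \<Otimes>\<^sub>M borel)" by simp
  then have A' [measurable]: "A \<in> sets (N01 \<Otimes>\<^sub>M N01)" by (simp add: sets)
  have "emeasure (distr (N01 \<Otimes>\<^sub>M N01) (borel \<Otimes>\<^sub>M borel) (\<lambda>(w, z). (p * w + q * z, q * w - p * z))) A
    = (\<integral>\<^sup>+x. indicator A x \<partial>distr (N01 \<Otimes>\<^sub>M N01) (borel \<Otimes>\<^sub>M borel) (\<lambda>(w, z). (p * w + q * z, q * w - p * z)))"
    by simp
  also have "\<dots> = (\<integral>\<^sup>+x. indicator A (p * fst x + q * snd x, q * fst x - p * snd x) \<partial>(N01 \<Otimes>\<^sub>M N01))"
    by (subst nn_integral_distr) (auto simp: case_prod_beta)
  also have "\<dots> = (\<integral>\<^sup>+w. \<integral>\<^sup>+z. indicator A (p * w + q * z, q * w - p * z) \<partial>N01 \<partial>N01)"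
    by (subst N01.nn_integral_fst[symmetric]) auto
  also have "\<dots> = (\<integral>\<^sup>+w. \<integral>\<^sup>+z. indicator A (w, z) \<partial>N01 \<partial>N01)"
    by (rule nn_integral_N01_rotation[OF _ pq]) measurable
  also have "\<dots> = emeasure (N01 \<Otimes>\<^sub>M N01) A"
    by (subst N01.nn_integral_fst) auto
  finally show "emeasure (distr (N01 \<Otimes>\<^sub>M N01) (borel \<Otimes>\<^sub>M borel) (\<lambda>(w, z). (p * w + q * z, q * w - p * z))) A = emeasure (N01 \<Otimes>\<^sub>M N01) A" .
qed

lemma
  fixes f :: "real \<times> real \<Rightarrow> real"
  assumes pq: "p\<^sup>2 + q\<^sup>2 = 1" "q \<noteq> 0"
    and f [measurable]: "f \<in> borel_measurable (borel \<Otimes>\<^sub>M borel)"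
  shows integral_N01_rotation: "(LINT x|(N01 \<Otimes>\<^sub>M N01). f (p * fst x + q * snd x, q * fst x - p * snd x)) = integral\<^sup>L (N01 \<Otimes>\<^sub>M N01) f"
    and integrable_N01_rotation: "integrable (N01 \<Otimes>\<^sub>M N01) (\<lambda>x. f (p * fst x + q * snd x, q * fst x - p * snd x)) \<longleftrightarrow> integrable (N01 \<Otimes>\<^sub>M N01) f"
proof -
  have "integral\<^sup>L (N01 \<Otimes>\<^sub>M N01) f = integral\<^sup>L (distr (N01 \<Otimes>\<^sub>M N01) (borel \<Otimes>\<^sub>M borel) (\<lambda>(w, z). (p * w + q * z, q * w - p * z))) f"
    by (simp add: distr_N01_rotation[OF pq])
  also have "\<dots> = (LINT x|(N01 \<Otimes>\<^sub>M N01). f (p * fst x + q * snd x, q * fst x - p * snd x))"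
    by (subst integral_distr) (auto simp: case_prod_beta)
  finally show "(LINT x|(N01 \<Otimes>\<^sub>M N01). f (p * fst x + q * snd x, q * fst x - p * snd x)) = integral\<^sup>L (N01 \<Otimes>\<^sub>M N01) f" by simp
  have "integrable (N01 \<Otimes>\<^sub>M N01) f = integrable (distr (N01 \<Otimes>\<^sub>M N01) (borel \<Otimes>\<^sub>M borel) (\<lambda>(w, z). (p * w + q * z, q * w - p * z))) f"
    by (simp add: distr_N01_rotation[OF pq])
  also have "\<dots> = integrable (N01 \<Otimes>\<^sub>M N01) (\<lambda>x. f (p * fst x + q * snd x, q * fst x - p * snd x))"
    by (subst integrable_distr_eq) (auto simp: case_prod_beta)
  finally show "integrable (N01 \<Otimes>\<^sub>M N01) (\<lambda>x. f (p * fst x + q * snd x, q * fst x - p * snd x)) \<longleftrightarrow> integrable (N01 \<Otimes>\<^sub>M N01) f" by simp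
qed

lemma measure_N01_UNIV [simp]: "measure N01 UNIV = 1"
  using N01.prob_space by simp

section \<open>Gaussian integration by parts for polynomials\<close>

lemma pderiv_sum: "pderiv (sum f A) = (\<Sum>i\<in>A. pderiv (f i))"
  by (induction A rule: infinite_finite_induct) (simp_all add: pderiv_add)

lemma integrable_N01_poly [simp]: "integrable N01 (\<lambda>x. poly p x)"
  unfolding poly_altdef
  by (intro Bochner_Integration.integrable_sum integrable_mult_right integrable_std_normal_distribution_moment)

lemma integrable_N01_poly_affine [simp]: "integrable N01 (\<lambda>z. poly p (\<omega> + \<sigma> * z))"
  using integrable_N01_poly[of "pcompose p [:\<omega>, \<sigma>:]"] by (simp add: poly_pcompose mult.commute)

text \<open>Integration by parts for a monomial, read off from the closed form of the even moments;
  for even \<open>k\<close> both sides vanish. At \<open>k = 0\<close> the truncated difference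
  \<open>k - 1\<close> is multiplied by zero.\<close>

lemma N01_moment_Suc: "(LINT x|N01. x ^ Suc k) = real k * (LINT x|N01. x ^ (k - 1))"
proof (cases "even k")
  case True
  then show ?thesis
    using integral_std_normal_distribution_moment_odd[of "Suc k"]
      integral_std_normal_distribution_moment_odd[of "k - 1"]
    by (cases "k = 0") (simp_all del: power_Suc)
next
  case False
  then obtain j where k: "k = 2 * j + 1" by (rule oddE)
  have "(LINT x|N01. x ^ Suc k) = fact (2 * Suc j) / (2 ^ Suc j * fact (Suc j))"
    using std_normal_distribution_even_moments(1)[of "Suc j"] by (simp add: k)
  also have "\<dots> = real k * (fact (2 * j) / (2 ^ j * fact j))"
    by (simp add: k divide_simps)
  also have "\<dots> = real k * (LINT x|N01. x ^ (k - 1))"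
    using std_normal_distribution_even_moments(1)[of j] by (simp add: k)
  finally show ?thesis .
qed

text \<open>Linearity reduces Stein's identity to the moment recursion, so no boundary terms have to
  be controlled.\<close>

lemma N01_stein_poly: "(LINT x|N01. x * poly p x) = (LINT x|N01. poly (pderiv p) x)"
proof -
  have "(LINT x|N01. x * poly p x) = (LINT x|N01. (\<Sum>i\<le>degree p. coeff p i * x ^ Suc i))"
    by (simp add: poly_altdef sum_distrib_left mult_ac)
  also have "\<dots> = (\<Sum>i\<le>degree p. coeff p i * (LINT x|N01. x ^ Suc i))"
    by (subst Bochner_Integration.integral_sum)
       (auto intro!: integrable_mult_right integrable_std_normal_distribution_moment simp del: power_Suc)
  also have "\<dots> = (\<Sum>i\<le>degree p. coeff p i * (real i * (LINT x|N01. x ^ (i - 1))))"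
    unfolding N01_moment_Suc ..
  also have "\<dots> = (LINT x|N01. (\<Sum>i\<le>degree p. coeff p i * (real i * x ^ (i - 1))))"
    by (subst Bochner_Integration.integral_sum)
       (auto intro!: integrable_mult_right integrable_std_normal_distribution_moment)
  also have "\<dots> = (LINT x|N01. poly (pderiv p) x)"
  proof -
    have "pderiv p = pderiv (\<Sum>i\<le>degree p. monom (coeff p i) i)"
      by (simp add: poly_as_sum_of_monoms)
    also have "\<dots> = (\<Sum>i\<le>degree p. monom (of_nat i * coeff p i) (i - 1))"
      by (simp add: pderiv_sum pderiv_monom)
    finally have "poly (pderiv p) x = (\<Sum>i\<le>degree p. coeff p i * (real i * x ^ (i - 1)))" for x
      by (simp add: poly_sum poly_monom mult_ac)
    then show ?thesis by simp
  qed
  finally show ?thesis .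
qed

lemma N01_stein_poly_affine:
  "(LINT z|N01. (\<omega> + \<sigma> * z) * poly p (\<omega> + \<sigma> * z)) =
     \<omega> * (LINT z|N01. poly p (\<omega> + \<sigma> * z)) + \<sigma>\<^sup>2 * (LINT z|N01. poly (pderiv p) (\<omega> + \<sigma> * z))"
proof -
  let ?q = "pcompose p [:\<omega>, \<sigma>:]"
  have q: "poly ?q z = poly p (\<omega> + \<sigma> * z)" for z by (simp add: poly_pcompose mult.commute)
  have dq: "poly (pderiv ?q) z = \<sigma> * poly (pderiv p) (\<omega> + \<sigma> * z)" for z
    by (simp add: pderiv_pcompose poly_pcompose pderiv_pCons mult.commute)
  have int: "integrable N01 (\<lambda>z. z * poly p (\<omega> + \<sigma> * z))"
    using integrable_N01_poly[of "[:0, 1:] * ?q"] by (simp add: q)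
  have "(LINT z|N01. (\<omega> + \<sigma> * z) * poly p (\<omega> + \<sigma> * z))
      = (LINT z|N01. \<omega> * poly p (\<omega> + \<sigma> * z) + \<sigma> * (z * poly p (\<omega> + \<sigma> * z)))"
    by (simp add: algebra_simps)
  also have "\<dots> = \<omega> * (LINT z|N01. poly p (\<omega> + \<sigma> * z)) + \<sigma> * (LINT z|N01. z * poly p (\<omega> + \<sigma> * z))"
    using int by simp
  also have "(LINT z|N01. z * poly p (\<omega> + \<sigma> * z)) = \<sigma> * (LINT z|N01. poly (pderiv p) (\<omega> + \<sigma> * z))"
    using N01_stein_poly[of ?q] by (simp add: q dq)
  finally show ?thesis by (simp add: power2_eq_square)
qed

section \<open>Hermite polynomials under a normal law\<close>

text \<open>Hermite polynomials of variance \<open>v\<close>. Using the variance as parameter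
  removes the division by the scale, so that \<open>v = 0\<close> yields the monomials without a
  separate convention.\<close>

fun hpoly :: "real \<Rightarrow> nat \<Rightarrow> real poly" where
  "hpoly v 0 = 1"
| "hpoly v (Suc 0) = [:0, 1:]"
| "hpoly v (Suc (Suc k)) = pCons 0 (hpoly v (Suc k)) - smult (real (Suc k) * v) (hpoly v k)"

lemma pderiv_hpoly: "pderiv (hpoly v (Suc k)) = smult (real (Suc k)) (hpoly v k)"
proof (induction v k rule: hpoly.induct)
  case (3 v k)
  have "pderiv (hpoly v (Suc (Suc (Suc k)))) = hpoly v (Suc (Suc k)) +
      pCons 0 (pderiv (hpoly v (Suc (Suc k)))) - smult (real (Suc (Suc k)) * v) (pderiv (hpoly v (Suc k)))"
    by (subst hpoly.simps(3)) (simp only: pderiv_diff pderiv_pCons pderiv_smult)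
  also have "\<dots> = hpoly v (Suc (Suc k)) +
      smult (real (Suc (Suc k))) (pCons 0 (hpoly v (Suc k)) - smult (real (Suc k) * v) (hpoly v k))"
    by (simp only: 3) (simp add: smult_diff_right mult_ac)
  also have "\<dots> = hpoly v (Suc (Suc k)) + smult (real (Suc (Suc k))) (hpoly v (Suc (Suc k)))"
    by (simp only: hpoly.simps(3))
  also have "\<dots> = smult (real (Suc (Suc (Suc k)))) (hpoly v (Suc (Suc k)))"
    by (simp only: of_nat_Suc[of "Suc (Suc k)"] smult_add_left smult_1_left)
  finally show ?case .
qed (simp_all add: pderiv_pCons one_pCons)

text \<open>The raising operator \<open>u - v * d/du\<close>. In this form the correction term is
  exactly the one that Stein's identity produces.\<close>

lemma hpoly_Suc: "hpoly v (Suc m) = pCons 0 (hpoly v m) - smult v (pderiv (hpoly v m))"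
  by (cases m) (simp_all add: pderiv_hpoly one_pCons pderiv_pCons mult.commute)

lemma scaled_hermite_eq_poly: "scaled_hermite m s u = poly (hpoly (s\<^sup>2) m) u"
proof (cases "s = 0")
  case True
  have "poly (hpoly 0 m) u = u ^ m"
    by (induction "0::real" m rule: hpoly.induct) auto
  then show ?thesis using True by (simp add: scaled_hermite_def)
next
  case False
  have "s ^ m * hermite m (u / s) = poly (hpoly (s\<^sup>2) m) u"
  proof (induction m rule: induct_nat_012)
    case (ge2 n)
    have "s ^ Suc (Suc n) * hermite (Suc (Suc n)) (u / s)
       = u * (s ^ Suc n * hermite (Suc n) (u / s)) - real (Suc n) * s\<^sup>2 * (s ^ n * hermite n (u / s))"
      using False by (simp add: algebra_simps power2_eq_square)
    also have "\<dots> = poly (hpoly (s\<^sup>2) (Suc (Suc n))) u"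
      unfolding ge2 by simp
    finally show ?case .
  qed (use False in auto)
  then show ?thesis using False by (simp add: scaled_hermite_def)
qed

text \<open>Stein's identity applied to the factor \<open>u\<close> gives \<sigma>^2 times the
  derivative of the whole product; the subtracted term of \<open>hpoly_Suc\<close> cancels the part
  falling on the Hermite factor. What remains lowers its degree and moves a derivative onto
  \<open>q\<close>.\<close>

lemma integral_hpoly_Suc:
  "(LINT z|N01. poly (hpoly (\<sigma>\<^sup>2) (Suc m) * q) (\<omega> + \<sigma> * z)) =
     \<omega> * (LINT z|N01. poly (hpoly (\<sigma>\<^sup>2) m * q) (\<omega> + \<sigma> * z)) +
     \<sigma>\<^sup>2 * (LINT z|N01. poly (hpoly (\<sigma>\<^sup>2) m * pderiv q) (\<omega> + \<sigma> * z))"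
proof -
  let ?P = "hpoly (\<sigma>\<^sup>2) m"
  have "(LINT z|N01. poly (hpoly (\<sigma>\<^sup>2) (Suc m) * q) (\<omega> + \<sigma> * z)) =
    (LINT z|N01. (\<omega> + \<sigma> * z) * poly (?P * q) (\<omega> + \<sigma> * z) - \<sigma>\<^sup>2 * poly (pderiv ?P * q) (\<omega> + \<sigma> * z))"
    unfolding hpoly_Suc by (simp add: algebra_simps)
  also have "\<dots> = (LINT z|N01. (\<omega> + \<sigma> * z) * poly (?P * q) (\<omega> + \<sigma> * z))
       - \<sigma>\<^sup>2 * (LINT z|N01. poly (pderiv ?P * q) (\<omega> + \<sigma> * z))"
    using integrable_N01_poly_affine[of "[:0,1:] * (?P * q)" \<omega> \<sigma>]
    by (subst Bochner_Integration.integral_diff) (simp_all del: poly_mult)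
  also have "(LINT z|N01. (\<omega> + \<sigma> * z) * poly (?P * q) (\<omega> + \<sigma> * z))
     = \<omega> * (LINT z|N01. poly (?P * q) (\<omega> + \<sigma> * z)) + \<sigma>\<^sup>2 * (LINT z|N01. poly (pderiv (?P * q)) (\<omega> + \<sigma> * z))"
    by (rule N01_stein_poly_affine)
  also have "(LINT z|N01. poly (pderiv (?P * q)) (\<omega> + \<sigma> * z))
    = (LINT z|N01. poly (?P * pderiv q) (\<omega> + \<sigma> * z)) + (LINT z|N01. poly (pderiv ?P * q) (\<omega> + \<sigma> * z))"
  proof -
    have *: "pderiv (?P * q) = ?P * pderiv q + pderiv ?P * q"
      by (simp add: pderiv_mult mult.commute)
    show ?thesis
      unfolding * poly_add
      by (rule Bochner_Integration.integral_add) (rule integrable_N01_poly_affine)+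
  qed
  finally show ?thesis by (simp add: algebra_simps)
qed

lemma integral_hpoly: "(LINT z|N01. poly (hpoly (\<sigma>\<^sup>2) m) (\<omega> + \<sigma> * z)) = \<omega> ^ m"
proof (induction m)
  case (Suc m)
  then show ?case using integral_hpoly_Suc[of \<sigma> m 1 \<omega>] by simp
qed simp

text \<open>Pascal's rule with an arbitrary weight \<open>f\<close>, arranged to match the two terms
  of \<open>integral_hpoly_Suc\<close>: the second term advances the weight by one, as
  differentiation does.\<close>

lemma sum_binomial_Suc:
  fixes x y :: real
  shows "(\<Sum>j\<le>Suc m. real (Suc m choose j) * x ^ j * y ^ (Suc m - j) * f j) =
    y * (\<Sum>j\<le>m. real (m choose j) * x ^ j * y ^ (m - j) * f j) +
    x * (\<Sum>j\<le>m. real (m choose j) * x ^ j * y ^ (m - j) * f (Suc j))"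
proof -
  have "(\<Sum>j\<le>Suc m. real (Suc m choose j) * x ^ j * y ^ (Suc m - j) * f j) =
    y ^ Suc m * f 0 + (\<Sum>j\<le>m. real (Suc m choose Suc j) * x ^ Suc j * y ^ (m - j) * f (Suc j))"
    by (subst sum.atMost_Suc_shift) simp
  also have "(\<Sum>j\<le>m. real (Suc m choose Suc j) * x ^ Suc j * y ^ (m - j) * f (Suc j)) =
     x * (\<Sum>j\<le>m. real (m choose j) * x ^ j * y ^ (m - j) * f (Suc j)) +
     (\<Sum>j\<le>m. real (m choose Suc j) * x ^ Suc j * y ^ (m - j) * f (Suc j))"
    by (simp add: sum_distrib_left sum.distrib[symmetric] algebra_simps)
  also have "y ^ Suc m * f 0 + (\<dots>) = x * (\<Sum>j\<le>m. real (m choose j) * x ^ j * y ^ (m - j) * f (Suc j)) +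
      (\<Sum>j\<le>Suc m. real (m choose j) * x ^ j * y ^ (Suc m - j) * f j)"
  proof -
    have "(\<Sum>j\<le>Suc m. real (m choose j) * x ^ j * y ^ (Suc m - j) * f j) =
      y ^ Suc m * f 0 + (\<Sum>j\<le>m. real (m choose Suc j) * x ^ Suc j * y ^ (m - j) * f (Suc j))"
      by (subst sum.atMost_Suc_shift) simp
    then show ?thesis by simp
  qed
  also have "(\<Sum>j\<le>Suc m. real (m choose j) * x ^ j * y ^ (Suc m - j) * f j)
     = (\<Sum>j\<le>m. real (m choose j) * x ^ j * y ^ (Suc m - j) * f j)"
    by simp
  also have "\<dots> = y * (\<Sum>j\<le>m. real (m choose j) * x ^ j * y ^ (m - j) * f j)"
    unfolding sum_distrib_left by (rule sum.cong) (auto simp: Suc_diff_le)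
  finally show ?thesis by simp
qed

text \<open>The \<open>j\<close>-th derivative of \<open>y ^ k\<close>. The recursion makes it
  vanish for \<open>j > k\<close> by itself, which spares a case distinction in the induction
  below.\<close>

fun falling_power :: "real \<Rightarrow> nat \<Rightarrow> nat \<Rightarrow> real" where
  "falling_power y 0 k = y ^ k"
| "falling_power y (Suc j) k = real k * falling_power y j (k - 1)"

lemma falling_power_eq: "j \<le> k \<Longrightarrow> falling_power y j k = fact k / fact (k - j) * y ^ (k - j)"
proof (induction j arbitrary: k)
  case (Suc j)
  then obtain k' where k: "k = Suc k'" by (cases k) auto
  show ?case using Suc by (simp add: k)
qed simp

text \<open>Each degree removed from the first factor either contributes \<omega> or differentiates
  the second factor at the price \<sigma>^2; \<open>j\<close> counts the derivatives. The degree
  \<open>k\<close> is kept arbitrary because a derivative lowers it.\<close>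

lemma integral_hpoly_mult:
  "(LINT z|N01. poly (hpoly (\<sigma>\<^sup>2) m * hpoly (\<sigma>\<^sup>2) k) (\<omega> + \<sigma> * z)) =
     (\<Sum>j\<le>m. real (m choose j) * (\<sigma>\<^sup>2) ^ j * \<omega> ^ (m - j) * falling_power \<omega> j k)"
proof (induction m arbitrary: k)
  case 0
  then show ?case by (simp add: integral_hpoly)
next
  case (Suc m)
  have d: "(LINT z|N01. poly (hpoly (\<sigma>\<^sup>2) m * pderiv (hpoly (\<sigma>\<^sup>2) k)) (\<omega> + \<sigma> * z))
    = (\<Sum>j\<le>m. real (m choose j) * (\<sigma>\<^sup>2) ^ j * \<omega> ^ (m - j) * falling_power \<omega> (Suc j) k)"
  proof (cases k)
    case 0
    then show ?thesis by simp
  next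
    case (Suc k')
    have "(LINT z|N01. poly (hpoly (\<sigma>\<^sup>2) m * pderiv (hpoly (\<sigma>\<^sup>2) k)) (\<omega> + \<sigma> * z))
      = real k * (LINT z|N01. poly (hpoly (\<sigma>\<^sup>2) m * hpoly (\<sigma>\<^sup>2) k') (\<omega> + \<sigma> * z))"
      unfolding Suc pderiv_hpoly by (simp del: poly_mult of_nat_Suc)
    also have "\<dots> = (\<Sum>j\<le>m. real (m choose j) * (\<sigma>\<^sup>2) ^ j * \<omega> ^ (m - j) * falling_power \<omega> (Suc j) k)"
      unfolding Suc.IH by (simp add: Suc sum_distrib_left mult_ac del: of_nat_Suc)
    finally show ?thesis .
  qed
  show ?case
    unfolding integral_hpoly_Suc d Suc.IH sum_binomial_Suc ..
qed

lemma power_div_fact_le_exp: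
  fixes x :: real
  assumes "0 \<le> x"
  shows "x ^ n / fact n \<le> exp x"
proof -
  have "x ^ n / fact n \<le> (\<Sum>k. x ^ k /\<^sub>R fact k)"
    using sum_le_suminf[OF summable_exp_generic[of x], of "{n}"] assms
    by (simp add: divide_inverse mult.commute)
  then show ?thesis by (simp add: exp_def)
qed

text \<open>In the sum for \<open>k = m\<close> the factor
  \<open>\<omega> ^ (2 * (m - j)) / fact (m - j)\<close> is at most
  \<open>x ^ (m - j) * exp (\<omega>\<^sup>2 / x)\<close> for every positive \<open>x\<close>. The
  choice \<open>x = 1 - \<sigma>\<^sup>2\<close> makes the remaining binomial sum equal to
  1.\<close>

lemma integral_hpoly_power2_le:
  assumes "\<sigma>\<^sup>2 < 1"
  shows "(LINT z|N01. (poly (hpoly (\<sigma>\<^sup>2) m) (\<omega> + \<sigma> * z))\<^sup>2) \<le> fact m * exp (\<omega>\<^sup>2 / (1 - \<sigma>\<^sup>2))"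
proof -
  define x where "x = 1 - \<sigma>\<^sup>2"
  have x: "0 < x" using assms by (simp add: x_def)
  have "(LINT z|N01. (poly (hpoly (\<sigma>\<^sup>2) m) (\<omega> + \<sigma> * z))\<^sup>2) =
     (\<Sum>j\<le>m. real (m choose j) * (\<sigma>\<^sup>2) ^ j * \<omega> ^ (m - j) * falling_power \<omega> j m)"
    using integral_hpoly_mult[of \<sigma> m m \<omega>] by (simp add: power2_eq_square)
  also have "\<dots> \<le> (\<Sum>j\<le>m. fact m * exp (\<omega>\<^sup>2 / x) * (real (m choose j) * (\<sigma>\<^sup>2) ^ j * x ^ (m - j)))"
  proof (rule sum_mono)
    fix j assume "j \<in> {..m}"
    then have j: "j \<le> m" by simp
    let ?p = "m - j"
    have "(\<omega>\<^sup>2 / x) ^ ?p / fact ?p \<le> exp (\<omega>\<^sup>2 / x)"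
      using x by (intro power_div_fact_le_exp) simp
    then have "x ^ ?p * ((\<omega>\<^sup>2 / x) ^ ?p / fact ?p) \<le> x ^ ?p * exp (\<omega>\<^sup>2 / x)"
      using x by (intro mult_left_mono) auto
    moreover have "x ^ ?p * ((\<omega>\<^sup>2 / x) ^ ?p / fact ?p) = \<omega> ^ ?p * \<omega> ^ ?p / fact ?p"
      using x by (simp add: power_divide power2_eq_square power_mult_distrib)
    ultimately have *: "\<omega> ^ ?p * \<omega> ^ ?p / fact ?p \<le> x ^ ?p * exp (\<omega>\<^sup>2 / x)" by simp
    have "real (m choose j) * (\<sigma>\<^sup>2) ^ j * \<omega> ^ ?p * falling_power \<omega> j m
       = (fact m * (real (m choose j) * (\<sigma>\<^sup>2) ^ j)) * (\<omega> ^ ?p * \<omega> ^ ?p / fact ?p)"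
      by (simp add: falling_power_eq[OF j])
    also have "\<dots> \<le> (fact m * (real (m choose j) * (\<sigma>\<^sup>2) ^ j)) * (x ^ ?p * exp (\<omega>\<^sup>2 / x))"
      by (rule mult_left_mono[OF *]) simp
    finally show "real (m choose j) * (\<sigma>\<^sup>2) ^ j * \<omega> ^ ?p * falling_power \<omega> j m
       \<le> fact m * exp (\<omega>\<^sup>2 / x) * (real (m choose j) * (\<sigma>\<^sup>2) ^ j * x ^ ?p)"
      by (simp add: mult_ac)
  qed
  also have "\<dots> = fact m * exp (\<omega>\<^sup>2 / x) * (\<sigma>\<^sup>2 + x) ^ m"
    unfolding binomial_ring sum_distrib_left ..
  finally show ?thesis by (simp add: x_def)
qed

section \<open>Normal density and distribution function\<close>

lemma Phi_ge_0: "0 \<le> Phi x" and Phi_le_1: "Phi x \<le> 1"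
  by (simp_all add: Phi_def cdf_def)

lemma std_normal_density_le_exp: "std_normal_density x \<le> exp (- x\<^sup>2 / 2)"
proof -
  have "1 \<le> sqrt (2 * pi)" using pi_gt3 by simp
  then have "1 / sqrt (2 * pi) \<le> 1" by simp
  then have "1 / sqrt (2 * pi) * exp (- x\<^sup>2 / 2) \<le> 1 * exp (- x\<^sup>2 / 2)"
    by (rule mult_right_mono) simp
  then show ?thesis by (simp add: std_normal_density_def)
qed

lemma std_normal_density_le_1: "std_normal_density x \<le> 1"
  by (rule order_trans[OF std_normal_density_le_exp]) simp

lemma std_normal_density_has_derivative:
  "(std_normal_density has_real_derivative - x * std_normal_density x) (at x)"
proof -
  define c where "c = 1 / sqrt (2 * pi)"
  have "std_normal_density = (\<lambda>x. c * exp (- x\<^sup>2 / 2))"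
    by (rule ext) (simp add: std_normal_density_def c_def)
  moreover have "((\<lambda>x. c * exp (- x\<^sup>2 / 2)) has_real_derivative - x * (c * exp (- x\<^sup>2 / 2))) (at x)"
    by (auto intro!: derivative_eq_intros)
  ultimately show ?thesis by simp
qed

text \<open>Splitting the distribution function at \<open>x - 1\<close> leaves an integral over a
  compact interval with \<open>x\<close> in its interior, where the fundamental theorem of calculus
  applies.\<close>

lemma Phi_has_derivative: "(Phi has_real_derivative std_normal_density x) (at x)"
proof -
  interpret real_distribution N01 by (rule real_dist_normal_dist)
  have cont: "continuous_on A std_normal_density" for A
    by (intro continuous_at_imp_continuous_on ballI DERIV_isCont[OF std_normal_density_has_derivative])
  have eq: "Phi (x - 1) + integral {x - 1..u} std_normal_density = Phi u" if "u \<in> {x - 1<..<x + 1}" for u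
  proof -
    have "Phi u - Phi (x - 1) = measure N01 {x - 1<..u}"
      unfolding Phi_def using that by (intro cdf_diff_eq) auto
    also have "\<dots> = (LINT z|N01. indicator {x - 1<..u} z)" by simp
    also have "\<dots> = (LINT z|lborel. std_normal_density z * indicator {x - 1<..u} z)"
      by (subst integral_density) auto
    also have "\<dots> = (LINT z:{x - 1..u}|lborel. std_normal_density z)"
      unfolding set_lebesgue_integral_def
      by (rule integral_cong_AE) (use AE_lborel_singleton[of "x - 1"] in \<open>auto elim!: eventually_mono split: split_indicator\<close>)
    also have "\<dots> = integral {x - 1..u} std_normal_density"
      by (rule set_borel_integral_eq_integral) (rule borel_integrable_atLeastAtMost'[OF cont])
    finally show ?thesis by simp
  qed
  have "((\<lambda>u. integral {x - 1..u} std_normal_density) has_real_derivative std_normal_density x) (at x within {x - 1..x + 1})"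
    by (rule integral_has_real_derivative[OF cont]) auto
  then have "((\<lambda>u. integral {x - 1..u} std_normal_density) has_real_derivative std_normal_density x) (at x)"
    by (subst (asm) at_within_interior) auto
  then have "((\<lambda>u. Phi (x - 1) + integral {x - 1..u} std_normal_density) has_real_derivative std_normal_density x) (at x)"
    by (auto intro!: derivative_eq_intros)
  then show ?thesis
    by (rule has_field_derivative_transform_within_open[where S = "{x - 1<..<x + 1}"]) (use eq in auto)
qed

section \<open>The loss function and its Taylor expansion\<close>

text \<open>The part of \<open>G\<close> that does not depend on \<beta>. It is the expected excess
  of \<open>w\<close> over a standard normal variable, with asymptotes 0 on the left and
  \<open>w\<close> on the right; these are what the two outer branches of the estimator rely
  on.\<close>

definition psi :: "real \<Rightarrow> real" where
  "psi w = std_normal_density w + w * Phi w"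

lemma G_eq_psi: "G w \<beta> = psi w - \<beta> * w"
  by (simp add: G_def psi_def)

lemma psi_has_derivative: "(psi has_real_derivative Phi w) (at w)"
  unfolding psi_def[abs_def]
  by (auto intro!: derivative_eq_intros std_normal_density_has_derivative Phi_has_derivative)

lemma G_has_derivative: "((\<lambda>w. G w \<beta>) has_real_derivative Phi w - \<beta>) (at w)"
  unfolding G_eq_psi by (auto intro!: derivative_eq_intros psi_has_derivative)

text \<open>The integrand has the antiderivative \<open>w * Phi z + std_normal_density z\<close>,
  whose value at \<open>w\<close> is \<open>psi w\<close> and whose limit at minus infinity is 0.
  The integrand is nonnegative left of \<open>w\<close>, so the improper fundamental theorem also
  delivers integrability.\<close>

lemma
  shows integrable_N01_max: "integrable N01 (\<lambda>z. max 0 (w - z))"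
    and integral_N01_max: "(LINT z|N01. max 0 (w - z)) = psi w"
proof -
  interpret real_distribution N01 by (rule real_dist_normal_dist)
  let ?F = "\<lambda>z. w * Phi z + std_normal_density z"
  let ?f = "\<lambda>z. (w - z) * std_normal_density z"
  have lim: "(?F \<longlongrightarrow> w * 0 + 0) at_bot"
  proof (intro tendsto_intros)
    show "(Phi \<longlongrightarrow> 0) at_bot" unfolding Phi_def by (rule cdf_lim_at_bot)
    show "(std_normal_density \<longlongrightarrow> 0) at_bot" unfolding std_normal_density_def by real_asymp
  qed
  have "continuous (at w) ?F"
    by (intro continuous_intros DERIV_isCont[OF Phi_has_derivative] DERIV_isCont[OF std_normal_density_has_derivative])
  then have lim2: "(?F \<longlongrightarrow> ?F w) (at_left w)"
    by (simp add: continuous_at filterlim_at_split)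
  have deriv: "(?F has_real_derivative ?f x) (at x)" for x
    by (auto intro!: derivative_eq_intros std_normal_density_has_derivative Phi_has_derivative simp: algebra_simps)
  have cont: "isCont ?f x" for x
    by (intro continuous_intros DERIV_isCont[OF std_normal_density_has_derivative])
  have nonneg: "AE x in lborel. -\<infinity> < ereal x \<longrightarrow> ereal x < ereal w \<longrightarrow> 0 \<le> ?f x" by auto
  have A: "((?F \<circ> real_of_ereal) \<longlongrightarrow> 0) (at_right (-\<infinity>))" 
    using lim by (simp add: ereal_tendsto_simps)
  have B: "((?F \<circ> real_of_ereal) \<longlongrightarrow> ?F w) (at_left (ereal w))" 
    using lim2 by (simp add: ereal_tendsto_simps)
  have "-\<infinity> < ereal w" by simp
  note FTC = interval_integral_FTC_nonneg[OF this deriv cont nonneg A B]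
  have eq: "indicator (einterval (-\<infinity>) (ereal w)) z *\<^sub>R ?f z = std_normal_density z * max 0 (w - z)" for z
    by (auto simp: einterval_def indicator_def max_def)
  have "integrable lborel (\<lambda>z. std_normal_density z * max 0 (w - z))"
    using FTC(1) unfolding set_integrable_def eq .
  then show "integrable N01 (\<lambda>z. max 0 (w - z))"
    by (subst integrable_density) auto
  have "(LINT z|N01. max 0 (w - z)) = (LINT z|lborel. std_normal_density z * max 0 (w - z))"
    by (subst integral_density) auto
  also have "\<dots> = psi w"
    using FTC(2) unfolding interval_lebesgue_integral_def set_lebesgue_integral_def eq
    by (simp add: psi_def)
  finally show "(LINT z|N01. max 0 (w - z)) = psi w" .
qed

text \<open>Inherited from the integral representation, because \<open>max 0 (a - z)\<close> is
  1-Lipschitz in \<open>a\<close> for every \<open>z\<close>.\<close>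

lemma psi_lipschitz: "\<bar>psi a - psi b\<bar> \<le> \<bar>a - b\<bar>"
proof -
  have "\<bar>psi a - psi b\<bar> = \<bar>LINT z|N01. max 0 (a - z) - max 0 (b - z)\<bar>"
    by (simp add: integral_N01_max[symmetric] integrable_N01_max)
  also have "\<dots> \<le> (LINT z|N01. \<bar>max 0 (a - z) - max 0 (b - z)\<bar>)"
    by (rule integral_abs_bound)
  also have "\<dots> \<le> (LINT z|N01. \<bar>a - b\<bar>)"
    by (rule integral_mono) (auto simp: integrable_N01_max)
  finally show ?thesis by simp
qed

lemma abs_psi_le: "\<bar>psi w\<bar> \<le> 1 + \<bar>w\<bar>"
proof -
  have "\<bar>psi w\<bar> \<le> std_normal_density w + \<bar>w\<bar> * Phi w"
    unfolding psi_def using Phi_ge_0[of w] by (auto simp: abs_mult intro!: order_trans[OF abs_triangle_ineq])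
  also have "\<dots> \<le> 1 + \<bar>w\<bar> * 1"
    by (intro add_mono mult_left_mono std_normal_density_le_1 Phi_le_1) auto
  finally show ?thesis by simp
qed

lemma abs_psi_minus_le: "\<bar>psi w - w\<bar> \<le> 1 + \<bar>w\<bar>"
proof -
  have "psi w - w = std_normal_density w - w * (1 - Phi w)"
    by (simp add: psi_def algebra_simps)
  then have "\<bar>psi w - w\<bar> \<le> \<bar>std_normal_density w\<bar> + \<bar>w * (1 - Phi w)\<bar>"
    by (simp only: abs_triangle_ineq4)
  also have "\<dots> = std_normal_density w + \<bar>w\<bar> * (1 - Phi w)"
    using Phi_le_1[of w] by (simp add: abs_mult)
  also have "\<dots> \<le> 1 + \<bar>w\<bar> * 1"
    by (intro add_mono mult_left_mono std_normal_density_le_1) (use Phi_ge_0[of w] in auto)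
  finally show ?thesis by simp
qed

text \<open>Left of zero \<open>Phi w\<close> is itself a Gaussian tail, so both terms of
  \<open>psi\<close> decay. The companion below measures the distance to the other asymptote, with
  the upper tail in its place.\<close>

lemma abs_psi_le_exp:
  assumes "w \<le> 0"
  shows "\<bar>psi w\<bar> \<le> (1 + \<bar>w\<bar>) * exp (- w\<^sup>2 / 2)"
proof -
  have "Phi w \<le> exp (- (- w)\<^sup>2 / (2 * 1))"
    using N01_tail[of "-1" 1 "- w"] assms by (simp add: Phi_def cdf_def atMost_def)
  then have P: "Phi w \<le> exp (- w\<^sup>2 / 2)" by simp
  have "\<bar>psi w\<bar> \<le> std_normal_density w + \<bar>w\<bar> * Phi w"
    unfolding psi_def using Phi_ge_0[of w] by (auto simp: abs_mult intro!: order_trans[OF abs_triangle_ineq])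
  also have "\<dots> \<le> exp (- w\<^sup>2 / 2) + \<bar>w\<bar> * exp (- w\<^sup>2 / 2)"
    by (intro add_mono mult_left_mono std_normal_density_le_exp P) auto
  finally show ?thesis by (simp add: algebra_simps)
qed

lemma abs_psi_minus_le_exp:
  assumes "0 \<le> w"
  shows "\<bar>psi w - w\<bar> \<le> (1 + \<bar>w\<bar>) * exp (- w\<^sup>2 / 2)"
proof -
  have "1 - Phi w = measure N01 (space N01 - {..w})"
    unfolding Phi_def cdf_def by (subst N01.prob_compl) auto
  also have "\<dots> \<le> measure N01 {v. w \<le> 1 * v}"
    by (rule N01.finite_measure_mono) auto
  also have "\<dots> \<le> exp (- w\<^sup>2 / 2)"
    using N01_tail[of 1 1 w] assms by simp
  finally have P: "1 - Phi w \<le> exp (- w\<^sup>2 / 2)" .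
  have "psi w - w = std_normal_density w - w * (1 - Phi w)"
    by (simp add: psi_def algebra_simps)
  then have "\<bar>psi w - w\<bar> \<le> \<bar>std_normal_density w\<bar> + \<bar>w * (1 - Phi w)\<bar>"
    by (simp only: abs_triangle_ineq4)
  also have "\<dots> = std_normal_density w + \<bar>w\<bar> * (1 - Phi w)"
    using Phi_le_1[of w] by (simp add: abs_mult)
  also have "\<dots> \<le> exp (- w\<^sup>2 / 2) + \<bar>w\<bar> * exp (- w\<^sup>2 / 2)"
    by (intro add_mono mult_left_mono std_normal_density_le_exp P) auto
  finally show ?thesis by (simp add: algebra_simps)
qed

lemma abs_G_le:
  assumes "0 \<le> \<beta>" "\<beta> \<le> 1"
  shows "\<bar>G w \<beta>\<bar> \<le> 1 + \<bar>w\<bar>"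
proof -
  have "\<bar>Phi w - \<beta>\<bar> \<le> 1" using assms Phi_ge_0[of w] Phi_le_1[of w] by auto
  then have "\<bar>w * (Phi w - \<beta>)\<bar> \<le> \<bar>w\<bar>" by (simp add: abs_mult mult_left_le)
  moreover have "G w \<beta> = std_normal_density w + w * (Phi w - \<beta>)"
    by (simp add: G_def algebra_simps)
  moreover have "\<bar>std_normal_density w\<bar> \<le> 1" using std_normal_density_le_1 by simp
  ultimately show ?thesis by linarith
qed

section \<open>Hermite values at zero and the Taylor remainder of G\<close>

lemma hermite_0_even: "hermite (2 * j) 0 = (- 1) ^ j * fact (2 * j) / (2 ^ j * fact j)"
proof (induction j)
  case (Suc j)
  have "hermite (2 * Suc j) 0 = - real (2 * j + 1) * hermite (2 * j) 0"
    by (simp add: algebra_simps)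
  also have "\<dots> = (- 1) ^ Suc j * fact (2 * Suc j) / (2 ^ Suc j * fact (Suc j))"
    unfolding Suc by (simp add: divide_simps) (simp add: algebra_simps)
  finally show ?case .
qed simp

lemma hermite_0_odd: "hermite (2 * j + 1) 0 = 0"
  by (induction j) simp_all

lemma hermite_0_power2_le: "(hermite k 0)\<^sup>2 \<le> fact k"
proof (induction k rule: induct_nat_012)
  case (ge2 n)
  have "(hermite (Suc (Suc n)) 0)\<^sup>2 = (real (Suc n))\<^sup>2 * (hermite n 0)\<^sup>2"
    by (simp add: power_mult_distrib)
  also have "\<dots> \<le> (real (Suc n))\<^sup>2 * fact n"
    by (intro mult_left_mono ge2) auto
  also have "\<dots> = real (Suc n) * fact (Suc n)" by (simp add: power2_eq_square)
  also have "\<dots> \<le> real (Suc (Suc n)) * fact (Suc n)" by (intro mult_right_mono) auto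
  finally show ?case by simp
qed auto

text \<open>Odd Hermite values at zero vanish, and the even ones rebuild the exponential series of
  exp(-t^2/2). The number of even indices below \<open>N\<close> is
  \<open>Suc N div 2\<close>.\<close>

lemma hermite_0_sum:
  "(\<Sum>k<N. (- 1) ^ k * hermite k 0 / fact k * t ^ k) = (\<Sum>j<Suc N div 2. (- (t\<^sup>2 / 2)) ^ j / fact j)"
proof (induction N)
  case (Suc N)
  show ?case
  proof (cases "even N")
    case True
    then obtain j where j: "N = 2 * j" by (rule evenE)
    have "(- 1) ^ N * hermite N 0 / fact N * t ^ N = (- (t\<^sup>2 / 2)) ^ j / fact j"
      unfolding j hermite_0_even
      by (simp add: power_mult power_minus[of "t\<^sup>2 / 2"] power_divide)
    then show ?thesis using Suc by (simp add: j)
  next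
    case False
    then obtain j where j: "N = 2 * j + 1" by (rule oddE)
    show ?thesis using Suc hermite_0_odd[of j] by (simp add: j)
  qed
qed simp

text \<open>Maclaurin coefficients of \<open>G\<close> in its first argument. The Hermite index lags
  by two because the second derivative of \<open>G\<close> is the normal density.\<close>

definition taylor_coeff :: "real \<Rightarrow> nat \<Rightarrow> real" where
  "taylor_coeff \<beta> m =
     (if m = 0 then G 0 \<beta> else if m = 1 then Phi 0 - \<beta>
      else std_normal_density 0 * ((- 1) ^ (m - 2) * hermite (m - 2) 0 / fact m))"

lemma sum_taylor_coeff:
  "(\<Sum>m<Suc (Suc N). taylor_coeff \<beta> m * f m) = G 0 \<beta> * f 0 + (Phi 0 - \<beta>) * f 1 +
     std_normal_density 0 * (\<Sum>k<N. (- 1) ^ k * hermite k 0 / fact (k + 2) * f (k + 2))"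
proof -
  have "(\<Sum>m<Suc (Suc N). taylor_coeff \<beta> m * f m) = taylor_coeff \<beta> 0 * f 0 + taylor_coeff \<beta> 1 * f 1 +
     (\<Sum>k<N. taylor_coeff \<beta> (k + 2) * f (k + 2))"
    by (simp only: sum.lessThan_Suc_shift) simp
  also have "(\<Sum>k<N. taylor_coeff \<beta> (k + 2) * f (k + 2))
     = std_normal_density 0 * (\<Sum>k<N. (- 1) ^ k * hermite k 0 / fact (k + 2) * f (k + 2))"
    unfolding sum_distrib_left by (rule sum.cong) (auto simp: taylor_coeff_def)
  finally show ?thesis by (simp add: taylor_coeff_def)
qed

text \<open>Prepared to cancel the factorial in \<open>integral_hpoly_power2_le\<close>, so that all
  terms of the series share one second moment bound.\<close>

lemma taylor_coeff_le:
  assumes "0 \<le> \<beta>" "\<beta> \<le> 1"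
  shows "(taylor_coeff \<beta> m)\<^sup>2 * fact m \<le> 1"
proof -
  consider "m = 0" | "m = 1" | k where "m = Suc (Suc k)" by (metis One_nat_def nat.exhaust)
  then show ?thesis
  proof cases
    case 1
    then show ?thesis
      by (simp add: taylor_coeff_def G_def std_normal_density_le_1 power_le_one del: normal_density_def)
  next
    case 2
    have "\<bar>Phi 0 - \<beta>\<bar> \<le> 1" using assms Phi_ge_0[of 0] Phi_le_1[of 0] by auto
    then show ?thesis using 2 by (simp add: taylor_coeff_def abs_square_le_1)
  next
    case 3
    have "(taylor_coeff \<beta> m)\<^sup>2 * fact m = (std_normal_density 0)\<^sup>2 * ((hermite k 0)\<^sup>2 / fact m)"
      by (simp add: 3 taylor_coeff_def power_mult_distrib power_divide power2_eq_square divide_simps power_mult[symmetric] mult.commute)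
    also have "\<dots> \<le> 1 * ((hermite k 0)\<^sup>2 / fact m)"
      by (intro mult_right_mono power_le_one std_normal_density_le_1) auto
    also have "\<dots> \<le> 1"
    proof -
      have "(hermite k 0)\<^sup>2 \<le> fact m"
        by (rule order_trans[OF hermite_0_power2_le]) (simp add: 3 fact_mono del: fact_Suc)
      then show ?thesis by (simp add: divide_le_eq_1 del: fact_Suc)
    qed
    finally show ?thesis .
  qed
qed

lemma exp_minus_taylor_bound:
  fixes y :: real
  assumes "0 \<le> y"
  shows "\<bar>exp (- y) - (\<Sum>j<J. (- y) ^ j / fact j)\<bar> \<le> exp y * y ^ J / fact J"
proof -
  obtain t where t: "\<bar>t\<bar> \<le> \<bar>- y\<bar>"
    "exp (- y) = (\<Sum>j<J. (- y) ^ j / fact j) + exp t / fact J * (- y) ^ J"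
    using Maclaurin_exp_le[of "- y" J] by blast
  have "\<bar>exp (- y) - (\<Sum>j<J. (- y) ^ j / fact j)\<bar> = exp t / fact J * y ^ J"
    using t(2) assms by (simp add: abs_mult power_abs)
  also have "\<dots> \<le> exp y / fact J * y ^ J"
    using t(1) assms by (intro mult_right_mono divide_right_mono) auto
  finally show ?thesis by simp
qed

text \<open>Two derivatives turn the remainder \<open>D0\<close> into \<open>D2\<close>, the
  remainder of the exponential series scaled by the density at zero. Since \<open>D0\<close> and
  \<open>D1\<close> vanish at zero, a second-order Maclaurin step carries the bound for
  \<open>D2\<close> back to \<open>G\<close>.\<close>

lemma taylor_G_bound:
  "\<bar>(\<Sum>m<Suc (Suc N). taylor_coeff \<beta> m * w ^ m) - G w \<beta>\<bar>
     \<le> w\<^sup>2 * (exp (w\<^sup>2 / 2) * (w\<^sup>2 / 2) ^ (Suc N div 2) / fact (Suc N div 2))"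
proof -
  define D0 where "D0 t = G t \<beta> - (G 0 \<beta> + (Phi 0 - \<beta>) * t + std_normal_density 0 *
     (\<Sum>k<N. (- 1) ^ k * hermite k 0 / fact (k + 2) * t ^ (k + 2)))" for t
  define D1 where "D1 t = Phi t - \<beta> - ((Phi 0 - \<beta>) + std_normal_density 0 *
     (\<Sum>k<N. (- 1) ^ k * hermite k 0 / fact (k + 2) * (real (k + 2) * t ^ (k + 1))))" for t
  define D2 where "D2 t = std_normal_density t - std_normal_density 0 *
     (\<Sum>k<N. (- 1) ^ k * hermite k 0 / fact k * t ^ k)" for t
  have pow: "((\<lambda>t. t ^ (k + 2)) has_real_derivative real (k + 2) * t ^ (k + 1)) (at t)" for k and t :: real
    using DERIV_pow[of "k + 2" t] by simp
  have "((\<lambda>t. \<Sum>k<N. (- 1) ^ k * hermite k 0 / fact (k + 2) * t ^ (k + 2)) has_real_derivative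
     (\<Sum>k<N. (- 1) ^ k * hermite k 0 / fact (k + 2) * (real (k + 2) * t ^ (k + 1)))) (at t)" for t
    by (intro DERIV_sum DERIV_cmult pow)
  note sum0 = DERIV_cmult[OF this]
  have d0: "(D0 has_real_derivative D1 t) (at t)" for t
    unfolding D0_def[abs_def] D1_def
    by (rule derivative_eq_intros G_has_derivative sum0 refl)+ simp
  have pow1: "((\<lambda>t. real (k + 2) * t ^ (k + 1)) has_real_derivative real (k + 2) * (real (k + 1) * t ^ k)) (at t)"
    for k and t :: real
    using DERIV_cmult[OF DERIV_pow[of "k + 1" t], of "real (k + 2)"] by simp
  have "((\<lambda>t. \<Sum>k<N. (- 1) ^ k * hermite k 0 / fact (k + 2) * (real (k + 2) * t ^ (k + 1))) has_real_derivative
     (\<Sum>k<N. (- 1) ^ k * hermite k 0 / fact (k + 2) * (real (k + 2) * (real (k + 1) * t ^ k)))) (at t)" for t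
    by (intro DERIV_sum DERIV_cmult pow1)
  moreover have "(\<Sum>k<N. (- 1) ^ k * hermite k 0 / fact (k + 2) * (real (k + 2) * (real (k + 1) * t ^ k)))
     = (\<Sum>k<N. (- 1) ^ k * hermite k 0 / fact k * t ^ k)" for t
  proof (rule sum.cong[OF refl])
    fix k
    have "(fact (k + 2) :: real) = real (k + 2) * (real (k + 1) * fact k)" by simp
    then show "(- 1) ^ k * hermite k 0 / fact (k + 2) * (real (k + 2) * (real (k + 1) * t ^ k))
      = (- 1) ^ k * hermite k 0 / fact k * t ^ k" by (simp only:) (simp add: divide_simps)
  qed
  ultimately have "((\<lambda>t. \<Sum>k<N. (- 1) ^ k * hermite k 0 / fact (k + 2) * (real (k + 2) * t ^ (k + 1))) has_real_derivative
     (\<Sum>k<N. (- 1) ^ k * hermite k 0 / fact k * t ^ k)) (at t)" for t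
    by simp
  note sum1 = DERIV_cmult[OF this]
  have d1: "(D1 has_real_derivative D2 t) (at t)" for t
    unfolding D1_def[abs_def] D2_def
    by (rule derivative_eq_intros Phi_has_derivative sum1 refl)+ simp
  let ?D = "\<lambda>m::nat. if m = 0 then D0 else if m = 1 then D1 else D2"
  have D: "\<forall>m t. m < 2 \<and> \<bar>t\<bar> \<le> \<bar>w\<bar> \<longrightarrow> (?D m has_real_derivative ?D (Suc m) t) (at t)"
    using d0 d1 by (auto simp: less_2_cases_iff)
  have "?D 0 = D0" by simp
  from Maclaurin_bi_le[OF this D] obtain t where t: "\<bar>t\<bar> \<le> \<bar>w\<bar>"
    "D0 w = (\<Sum>m<2. ?D m 0 / fact m * w ^ m) + ?D 2 t / fact 2 * w ^ 2"
    by (elim exE conjE)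
  have "D0 0 = 0" "D1 0 = 0" by (simp_all add: D0_def D1_def)
  then have D0: "D0 w = D2 t / 2 * w\<^sup>2" using t(2) by (simp add: numeral_2_eq_2)
  let ?J = "Suc N div 2"
  have "D2 t = std_normal_density 0 * (exp (- (t\<^sup>2 / 2)) - (\<Sum>j<?J. (- (t\<^sup>2 / 2)) ^ j / fact j))"
    unfolding D2_def hermite_0_sum by (simp add: std_normal_density_def algebra_simps)
  then have "\<bar>D2 t\<bar> = std_normal_density 0 * \<bar>exp (- (t\<^sup>2 / 2)) - (\<Sum>j<?J. (- (t\<^sup>2 / 2)) ^ j / fact j)\<bar>"
    by (simp add: abs_mult)
  also have "\<dots> \<le> 1 * (exp (t\<^sup>2 / 2) * (t\<^sup>2 / 2) ^ ?J / fact ?J)"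
    by (intro mult_mono std_normal_density_le_1 exp_minus_taylor_bound) auto
  also have "\<dots> \<le> 1 * (exp (w\<^sup>2 / 2) * (w\<^sup>2 / 2) ^ ?J / fact ?J)"
  proof -
    have "t\<^sup>2 / 2 \<le> w\<^sup>2 / 2" using t(1) by (simp add: abs_le_square_iff)
    then show ?thesis
      by (intro mult_left_mono divide_right_mono mult_mono power_mono[of "t\<^sup>2 / 2"]) auto
  qed
  finally have D2: "\<bar>D2 t\<bar> \<le> exp (w\<^sup>2 / 2) * (w\<^sup>2 / 2) ^ ?J / fact ?J" by simp
  have "(\<Sum>m<Suc (Suc N). taylor_coeff \<beta> m * w ^ m) - G w \<beta> = - D0 w"
    unfolding sum_taylor_coeff D0_def by simp
  then have "\<bar>(\<Sum>m<Suc (Suc N). taylor_coeff \<beta> m * w ^ m) - G w \<beta>\<bar> = w\<^sup>2 * (\<bar>D2 t\<bar> / 2)"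
    by (simp add: D0 abs_mult)
  also have "\<dots> \<le> w\<^sup>2 * (exp (w\<^sup>2 / 2) * (w\<^sup>2 / 2) ^ ?J / fact ?J)"
  proof (rule mult_left_mono)
    have "\<bar>D2 t\<bar> / 2 \<le> \<bar>D2 t\<bar>" by simp
    then show "\<bar>D2 t\<bar> / 2 \<le> exp (w\<^sup>2 / 2) * (w\<^sup>2 / 2) ^ ?J / fact ?J" using D2 by (rule order_trans)
  qed simp
  finally show ?thesis .
qed

lemma S_series_eq:
  "S_series n \<nu>p \<nu>f \<beta> \<gamma> \<tau> u =
     (\<Sum>m<Suc (trunc_order n \<nu>p \<nu>f \<gamma>). taylor_coeff \<beta> m * poly (hpoly ((s_coef \<nu>p \<nu>f \<tau>)\<^sup>2) m) u)"
proof -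
  \<comment> \<open>The order is a successor, so the range of \<open>N\<close> Hermite terms
    together with the constant and linear ones gives the degrees 0 up to
    \<open>trunc_order\<close>.\<close>
  obtain N where N: "trunc_order n \<nu>p \<nu>f \<gamma> = Suc N" by (simp add: trunc_order_def)
  have "deriv (\<lambda>w. G w \<beta>) 0 = Phi 0 - \<beta>" by (rule DERIV_imp_deriv[OF G_has_derivative])
  then show ?thesis
    unfolding S_series_def N sum_taylor_coeff scaled_hermite_eq_poly by simp
qed

section \<open>Product integrals and tail estimates under the normal law\<close>

lemma
  fixes f g :: "real \<Rightarrow> real"
  assumes f: "integrable N01 f" and g: "integrable N01 g"
  shows integrable_N01_pair_mult: "integrable (N01 \<Otimes>\<^sub>M N01) (\<lambda>x. f (fst x) * g (snd x))"
    and integral_N01_pair_mult: "(LINT x|(N01 \<Otimes>\<^sub>M N01). f (fst x) * g (snd x)) = (LINT z|N01. f z) * (LINT z|N01. g z)"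
proof -
  have [measurable]: "f \<in> borel_measurable N01" "g \<in> borel_measurable N01"
    using f g by auto
  show *: "integrable (N01 \<Otimes>\<^sub>M N01) (\<lambda>x. f (fst x) * g (snd x))"
  proof (rule N01_pair.Fubini_integrable)
    show "integrable N01 (\<lambda>x. LINT y|N01. norm (f (fst (x, y)) * g (snd (x, y))))"
      using f by (simp add: abs_mult)
    show "AE x in N01. integrable N01 (\<lambda>y. f (fst (x, y)) * g (snd (x, y)))"
      using g by simp
  qed measurable
  show "(LINT x|(N01 \<Otimes>\<^sub>M N01). f (fst x) * g (snd x)) = (LINT z|N01. f z) * (LINT z|N01. g z)"
    using N01_pair.integral_fst'[OF *] by simp
qed

lemma integrable_N01_fst: "integrable N01 f \<Longrightarrow> integrable (N01 \<Otimes>\<^sub>M N01) (\<lambda>x. f (fst x) :: real)"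
  and integral_N01_fst: "integrable N01 f \<Longrightarrow> (LINT x|(N01 \<Otimes>\<^sub>M N01). f (fst x) :: real) = (LINT z|N01. f z)"
  and integrable_N01_snd: "integrable N01 f \<Longrightarrow> integrable (N01 \<Otimes>\<^sub>M N01) (\<lambda>x. f (snd x) :: real)"
  and integral_N01_snd: "integrable N01 f \<Longrightarrow> (LINT x|(N01 \<Otimes>\<^sub>M N01). f (snd x) :: real) = (LINT z|N01. f z)"
  using integrable_N01_pair_mult[of f "\<lambda>_. 1"] integrable_N01_pair_mult[of "\<lambda>_. 1" f]
    integral_N01_pair_mult[of f "\<lambda>_. 1"] integral_N01_pair_mult[of "\<lambda>_. 1" f]
  by auto

lemma integrable_N01_id: "integrable N01 (\<lambda>z. z)"
  using integrable_std_normal_distribution_moment[of 1] by simp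

lemma integral_N01_id: "(LINT z|N01. z) = 0"
  using integral_std_normal_distribution_moment_odd[of 1] by simp

lemma integral_N01_square: "(LINT z|N01. z\<^sup>2) = 1"
  using std_normal_distribution_even_moments(1)[of 1] by simp

lemma exp_1_ge: "5 / 2 \<le> exp (1::real)"
  using exp_lower_Taylor_quadratic[of 1] by simp

lemma one_plus_abs_mult_exp_le:
  fixes x :: real
  shows "(1 + \<bar>x\<bar>) * exp (- x\<^sup>2 / 2) \<le> 2 * exp (- x\<^sup>2 / 4)"
proof -
  have "1 + \<bar>x\<bar> \<le> 2 * (1 + x\<^sup>2 / 4)"
  proof -
    have "0 \<le> (\<bar>x\<bar> - 1)\<^sup>2" by simp
    then show ?thesis by (simp add: power2_eq_square algebra_simps abs_mult_self_eq)
  qed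
  also have "\<dots> \<le> 2 * exp (x\<^sup>2 / 4)"
    by (intro mult_left_mono exp_ge_add_one_self) simp
  finally have "(1 + \<bar>x\<bar>) * exp (- x\<^sup>2 / 2) \<le> 2 * exp (x\<^sup>2 / 4) * exp (- x\<^sup>2 / 2)"
    by (rule mult_right_mono) simp
  also have "\<dots> = 2 * exp (- x\<^sup>2 / 4)"
    by (simp add: exp_add[symmetric])
  finally show ?thesis .
qed

text \<open>Covers a wrong outer branch: \<open>t\<close> is the error of the asymptote, the
  probability is that of choosing it. If \<omega> lies below \<open>- t0 / 2\<close>, the error
  itself is exponentially small. Otherwise \<open>t0 + \<omega>\<close> is at least both
  \<open>t0 / 2\<close> and \<open>\<bar>\<omega>\<bar>\<close>, so the probability is small enough
  to absorb the linear growth of \<open>t\<close> as well.\<close>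

lemma N01_tail_mult_le:
  assumes "0 \<le> t" "t \<le> 1 + \<bar>\<omega>\<bar>" "\<omega> \<le> 0 \<Longrightarrow> t \<le> (1 + \<bar>\<omega>\<bar>) * exp (- \<omega>\<^sup>2 / 2)"
    and "0 \<le> t0" "\<sigma>\<^sup>2 \<le> 1 / 2"
  shows "measure N01 {v. \<omega> + \<sigma> * v < - t0} * t \<le> 2 * exp (- t0\<^sup>2 / 16)"
proof (cases "\<omega> \<le> - t0 / 2")
  case True
  then have "\<omega> \<le> 0" using assms by linarith
  have "measure N01 {v. \<omega> + \<sigma> * v < - t0} * t \<le> 1 * t"
    using assms by (intro mult_right_mono) auto
  also have "\<dots> \<le> (1 + \<bar>\<omega>\<bar>) * exp (- \<omega>\<^sup>2 / 2)"
    using assms(3)[OF \<open>\<omega> \<le> 0\<close>] by simp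
  also have "\<dots> \<le> 2 * exp (- \<omega>\<^sup>2 / 4)" by (rule one_plus_abs_mult_exp_le)
  also have "\<dots> \<le> 2 * exp (- t0\<^sup>2 / 16)"
  proof -
    have "(t0 / 2)\<^sup>2 \<le> (- \<omega>)\<^sup>2" using True assms by (intro power_mono) auto
    then show ?thesis by (simp add: power_divide)
  qed
  finally show ?thesis .
next
  case False
  then have *: "0 \<le> t0 + \<omega>" "t0 / 2 \<le> t0 + \<omega>" "\<bar>\<omega>\<bar> \<le> t0 + \<omega>" using assms by auto
  have "measure N01 {v. \<omega> + \<sigma> * v < - t0} \<le> measure N01 {v. t0 + \<omega> \<le> (- \<sigma>) * v}"
    by (rule N01.finite_measure_mono) auto
  also have "\<dots> \<le> exp (- ((t0 + \<omega>)\<^sup>2 / (2 * (1 / 2))))"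
    using assms * by (intro N01_tail) auto
  also have "\<dots> \<le> exp (- \<omega>\<^sup>2 / 2) * exp (- t0\<^sup>2 / 8)"
  proof -
    have "(t0 / 2)\<^sup>2 \<le> (t0 + \<omega>)\<^sup>2" using * assms by (intro power_mono) auto
    moreover have "\<bar>\<omega>\<bar>\<^sup>2 \<le> (t0 + \<omega>)\<^sup>2" using * assms by (intro power_mono) auto
    ultimately show ?thesis by (simp add: exp_add[symmetric] power_divide)
  qed
  finally have "measure N01 {v. \<omega> + \<sigma> * v < - t0} * t \<le> (exp (- \<omega>\<^sup>2 / 2) * exp (- t0\<^sup>2 / 8)) * (1 + \<bar>\<omega>\<bar>)"
    using assms by (intro mult_mono) auto
  also have "\<dots> = exp (- t0\<^sup>2 / 8) * ((1 + \<bar>\<omega>\<bar>) * exp (- \<omega>\<^sup>2 / 2))" by simp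
  also have "\<dots> \<le> exp (- t0\<^sup>2 / 16) * (2 * exp (- \<omega>\<^sup>2 / 4))"
    by (intro mult_mono one_plus_abs_mult_exp_le) auto
  also have "\<dots> \<le> exp (- t0\<^sup>2 / 16) * (2 * 1)" by (intro mult_left_mono) auto
  finally show ?thesis by simp
qed

section \<open>Truncated series at a single coordinate\<close>

text \<open>One coordinate after standardisation: \<omega> and \<sigma> are mean and signed scale of
  \<open>U\<close> and \<open>V\<close>. The scale may be zero or negative, while \<open>r\<close>
  bounds its size independently of \<tau>.\<close>

locale gaussian_coordinate =
  fixes n :: nat and \<gamma> r \<beta> \<sigma> \<omega> :: real
  assumes n: "3 \<le> n"
    and gamma_pos: "0 < \<gamma>"
    and r_pos: "0 < r"
    and gamma_r: "(\<gamma> + r)\<^sup>2 \<le> 1 / (2 * exp 1)"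
    and beta: "0 \<le> \<beta>" "\<beta> \<le> 1"
    and sigma: "\<bar>\<sigma>\<bar> \<le> r"
begin

definition "ell = ln (real n)"
definition "thr = \<gamma> * sqrt (2 * ell)"
definition "ord = nat \<lceil>(exp 1)\<^sup>2 * (\<gamma> + r)\<^sup>2 * (2 * ell)\<rceil>"
definition "S u = (\<Sum>m<Suc (Suc ord). taylor_coeff \<beta> m * poly (hpoly (\<sigma>\<^sup>2) m) u)"
definition "St u = sgn (S u) * min \<bar>S u\<bar> (real n)"
definition "F u v =
  (if \<omega> + \<sigma> * v < - thr then - \<beta> * (\<omega> + \<sigma> * u)
   else if \<omega> + \<sigma> * v \<le> thr then St (\<omega> + \<sigma> * u)
   else (1 - \<beta>) * (\<omega> + \<sigma> * u))"
text \<open>The piecewise linear asymptote of \<open>G\<close> at \<omega>: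
  \<open>- \<beta> * \<omega>\<close> for negative \<omega> and
  \<open>(1 - \<beta>) * \<omega>\<close> otherwise.\<close>

definition "centre = - \<beta> * \<omega> + max 0 \<omega>"

lemma ell_ge_1: "1 \<le> ell"
proof -
  have "exp 1 \<le> real n" using exp_le n by (simp add: order_trans[OF exp_le])
  then have "ln (exp 1) \<le> ln (real n)" using n by (subst ln_le_cancel_iff) auto
  then show ?thesis by (simp add: ell_def)
qed

lemma exp_ell: "exp ell = real n"
  using n by (simp add: ell_def)

lemma gamma_r_le: "(\<gamma> + r)\<^sup>2 \<le> 1 / 5"
proof -
  have "1 / (2 * exp 1) \<le> 1 / (5::real)" using exp_1_ge by (simp add: divide_simps)
  then show ?thesis by (rule order_trans[OF gamma_r])
qed

lemma r2_le: "r\<^sup>2 \<le> 1 / 5"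
proof -
  have "r\<^sup>2 \<le> (\<gamma> + r)\<^sup>2" using r_pos gamma_pos by (intro power_mono) auto
  then show ?thesis using gamma_r_le by linarith
qed

lemma gamma2_le: "\<gamma>\<^sup>2 \<le> (\<gamma> + r)\<^sup>2"
  using power_mono[of \<gamma> "\<gamma> + r" 2] r_pos gamma_pos by simp

lemma sigma2_le_r2: "\<sigma>\<^sup>2 \<le> r\<^sup>2"
  using sigma r_pos by (simp add: abs_le_square_iff[symmetric])

lemma sigma2_le: "\<sigma>\<^sup>2 \<le> 1 / 5"
  using sigma2_le_r2 r2_le by simp

lemma thr_nonneg: "0 \<le> thr"
  using gamma_pos ell_ge_1 by (simp add: thr_def)

lemma thr2: "thr\<^sup>2 = 2 * \<gamma>\<^sup>2 * ell"
  using ell_ge_1 by (simp add: thr_def power_mult_distrib)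

lemma thr2_le: "thr\<^sup>2 \<le> ell"
proof -
  have "2 * \<gamma>\<^sup>2 \<le> 1" using gamma2_le gamma_r_le by simp
  then have "2 * \<gamma>\<^sup>2 * ell \<le> 1 * ell" using ell_ge_1 by (intro mult_right_mono) auto
  then show ?thesis by (simp add: thr2)
qed

lemma thr_le: "thr \<le> ell"
proof (rule power2_le_imp_le)
  have "ell * 1 \<le> ell * ell" using ell_ge_1 by (intro mult_left_mono) auto
  then show "thr\<^sup>2 \<le> ell\<^sup>2" using thr2_le by (simp add: power2_eq_square)
qed (use ell_ge_1 in simp)

lemma ord_ge: "(exp 1)\<^sup>2 * (\<gamma> + r)\<^sup>2 * (2 * ell) \<le> real ord"
  unfolding ord_def by (rule real_nat_ceiling_ge)

lemma ord_le: "real (Suc (Suc ord)) \<le> 3 * (1 + ell)"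
proof -
  have "(exp 1)\<^sup>2 * (\<gamma> + r)\<^sup>2 \<le> (exp 1)\<^sup>2 * (1 / (2 * exp 1))"
    by (intro mult_left_mono gamma_r) simp
  also have "\<dots> = exp 1 / (2::real)" by (simp add: power2_eq_square)
  also have "\<dots> \<le> 3 / 2" using exp_le by simp
  finally have "(exp 1)\<^sup>2 * (\<gamma> + r)\<^sup>2 * (2 * ell) \<le> 3 / 2 * (2 * ell)"
    using ell_ge_1 by (intro mult_right_mono) auto
  moreover have "real ord \<le> (exp 1)\<^sup>2 * (\<gamma> + r)\<^sup>2 * (2 * ell) + 1"
  proof -
    have "real (nat \<lceil>x\<rceil>) \<le> x + 1" if "0 \<le> x" for x :: real
      using that by linarith
    then show ?thesis unfolding ord_def using ell_ge_1 by simp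
  qed
  ultimately show ?thesis by simp
qed

lemma St_bounds: "\<bar>St u\<bar> \<le> real n" "\<bar>St u\<bar> \<le> \<bar>S u\<bar>"
  by (auto simp: St_def abs_mult sgn_if)

text \<open>Clipping only acts where |S| exceeds n, and there |S| is at most S^2/n. This converts
  the bias caused by clipping into a second moment.\<close>

lemma S_minus_St: "\<bar>S u - St u\<bar> \<le> (S u)\<^sup>2 / real n"
proof (cases "\<bar>S u\<bar> \<le> real n")
  case True
  then have "St u = S u" by (simp add: St_def sgn_if)
  then show ?thesis by simp
next
  case False
  then have "\<bar>S u - St u\<bar> \<le> \<bar>S u\<bar>" by (auto simp: St_def sgn_if)
  also have "\<dots> * real n \<le> \<bar>S u\<bar> * \<bar>S u\<bar>" using False by (intro mult_left_mono) auto
  then have "\<bar>S u\<bar> \<le> (S u)\<^sup>2 / real n" using n by (simp add: field_simps power2_eq_square)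
  finally show ?thesis .
qed

lemma S_eq_poly: "S u = poly (\<Sum>m<Suc (Suc ord). smult (taylor_coeff \<beta> m) (hpoly (\<sigma>\<^sup>2) m)) u"
  by (simp add: S_def poly_sum)

lemma S_measurable [measurable]: "S \<in> borel_measurable borel"
  unfolding S_eq_poly[abs_def] by (intro borel_measurable_continuous_onI continuous_intros)

lemma St_measurable [measurable]: "St \<in> borel_measurable borel"
  unfolding St_def[abs_def] by measurable

lemma integrable_S: "integrable N01 (\<lambda>z. S (\<omega> + \<sigma> * z))"
  unfolding S_eq_poly by simp

lemma integrable_S2: "integrable N01 (\<lambda>z. (S (\<omega> + \<sigma> * z))\<^sup>2)"
  unfolding S_eq_poly poly_power[symmetric] by (rule integrable_N01_poly_affine)

lemma integrable_St: "integrable N01 (\<lambda>z. St (\<omega> + \<sigma> * z))"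
  by (rule Bochner_Integration.integrable_bound[OF integrable_S]) (auto simp: St_bounds)

lemma integrable_St2: "integrable N01 (\<lambda>z. (St (\<omega> + \<sigma> * z))\<^sup>2)"
  by (rule Bochner_Integration.integrable_bound[OF integrable_S2])
     (auto simp: St_bounds abs_le_square_iff[symmetric])

lemma integral_S: "(LINT z|N01. S (\<omega> + \<sigma> * z)) = (\<Sum>m<Suc (Suc ord). taylor_coeff \<beta> m * \<omega> ^ m)"
  unfolding S_def by (simp add: Bochner_Integration.integral_sum integral_hpoly del: sum.lessThan_Suc)

text \<open>Cauchy-Schwarz over the terms avoids all mixed Hermite moments. Its price is the square
  of the number of terms, which is only logarithmic in n.\<close>

lemma integral_S2_le:
  "(LINT z|N01. (S (\<omega> + \<sigma> * z))\<^sup>2) \<le> (real (Suc (Suc ord)))\<^sup>2 * exp (\<omega>\<^sup>2 / (1 - \<sigma>\<^sup>2))"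
proof -
  let ?I = "{..<Suc (Suc ord)}" and ?P = "\<lambda>m z. poly (hpoly (\<sigma>\<^sup>2) m) (\<omega> + \<sigma> * z)"
  have int: "integrable N01 (\<lambda>z. (taylor_coeff \<beta> m * ?P m z)\<^sup>2)" for m
    unfolding power_mult_distrib poly_power[symmetric] by (intro integrable_mult_right integrable_N01_poly_affine)
  have "(LINT z|N01. (S (\<omega> + \<sigma> * z))\<^sup>2) \<le> (LINT z|N01. (\<Sum>m\<in>?I. (taylor_coeff \<beta> m * ?P m z)\<^sup>2) * real (card ?I))"
  proof (rule integral_mono[OF integrable_S2])
    show "integrable N01 (\<lambda>z. (\<Sum>m\<in>?I. (taylor_coeff \<beta> m * ?P m z)\<^sup>2) * real (card ?I))"
      by (intro integrable_mult_left Bochner_Integration.integrable_sum int)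
    show "(S (\<omega> + \<sigma> * z))\<^sup>2 \<le> (\<Sum>m\<in>?I. (taylor_coeff \<beta> m * ?P m z)\<^sup>2) * real (card ?I)" for z
      unfolding S_def by (rule sum_squared_le_sum_of_squares) 
  qed
  also have "\<dots> = (\<Sum>m\<in>?I. LINT z|N01. (taylor_coeff \<beta> m * ?P m z)\<^sup>2) * real (card ?I)"
    by (simp only: integral_mult_left_zero Bochner_Integration.integral_sum[OF int])
  also have "\<dots> \<le> (\<Sum>m\<in>?I. exp (\<omega>\<^sup>2 / (1 - \<sigma>\<^sup>2))) * real (card ?I)"
  proof (intro mult_right_mono sum_mono)
    fix m
    have "(LINT z|N01. (taylor_coeff \<beta> m * ?P m z)\<^sup>2) = (taylor_coeff \<beta> m)\<^sup>2 * (LINT z|N01. (?P m z)\<^sup>2)"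
      by (simp add: power_mult_distrib)
    also have "\<dots> \<le> (taylor_coeff \<beta> m)\<^sup>2 * (fact m * exp (\<omega>\<^sup>2 / (1 - \<sigma>\<^sup>2)))"
      using sigma2_le by (intro mult_left_mono integral_hpoly_power2_le) auto
    also have "\<dots> = ((taylor_coeff \<beta> m)\<^sup>2 * fact m) * exp (\<omega>\<^sup>2 / (1 - \<sigma>\<^sup>2))" by simp
    also have "\<dots> \<le> 1 * exp (\<omega>\<^sup>2 / (1 - \<sigma>\<^sup>2))"
      by (intro mult_right_mono taylor_coeff_le beta) simp
    finally show "(LINT z|N01. (taylor_coeff \<beta> m * ?P m z)\<^sup>2) \<le> exp (\<omega>\<^sup>2 / (1 - \<sigma>\<^sup>2))" by simp
  qed simp
  also have "\<dots> = (real (Suc (Suc ord)))\<^sup>2 * exp (\<omega>\<^sup>2 / (1 - \<sigma>\<^sup>2))"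
    by (simp add: power2_eq_square)
  finally show ?thesis .
qed

lemma integral_S2_small:
  assumes "\<omega>\<^sup>2 \<le> 3 * (\<gamma> + r)\<^sup>2 * ell"
  shows "(LINT z|N01. (S (\<omega> + \<sigma> * z))\<^sup>2) \<le> 9 * (1 + ell)\<^sup>2 * exp (3 / 4 * ell)"
proof -
  \<comment> \<open>The exponent 3/4 arises here as 3/5, from the cut, divided by 4/5, the least
    value of \<open>1 - \<sigma>\<^sup>2\<close>.\<close>
  have "\<omega>\<^sup>2 \<le> 3 * (1 / 5) * ell"
    using ell_ge_1 gamma_r_le by (intro order_trans[OF assms] mult_right_mono) auto
  also have "\<dots> \<le> (3 / 4 * ell) * (1 - \<sigma>\<^sup>2)"
    using sigma2_le ell_ge_1 mult_left_mono[of "4 / 5" "1 - \<sigma>\<^sup>2" "3 / 4 * ell"] by simp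
  finally have e: "\<omega>\<^sup>2 / (1 - \<sigma>\<^sup>2) \<le> 3 / 4 * ell"
    using sigma2_le by (simp add: pos_divide_le_eq)
  have "(LINT z|N01. (S (\<omega> + \<sigma> * z))\<^sup>2) \<le> (real (Suc (Suc ord)))\<^sup>2 * exp (\<omega>\<^sup>2 / (1 - \<sigma>\<^sup>2))"
    by (rule integral_S2_le)
  also have "\<dots> \<le> (3 * (1 + ell))\<^sup>2 * exp (3 / 4 * ell)"
    using e ord_le by (intro mult_mono power_mono) auto
  finally show ?thesis by (simp only: power_mult_distrib) simp
qed

text \<open>The expected series is the Taylor polynomial at \<omega>. The factor e^2 in the
  truncation order makes the factorial in the remainder beat both the power and the growing factor
  exp(\<omega>^2/2).\<close>

lemma integral_S_small:
  assumes "\<omega>\<^sup>2 \<le> 3 * (\<gamma> + r)\<^sup>2 * ell"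
  shows "\<bar>(LINT z|N01. S (\<omega> + \<sigma> * z)) - G \<omega> \<beta>\<bar> \<le> ell * exp (- \<gamma>\<^sup>2 * ell)"
proof -
  define q where "q = (\<gamma> + r)\<^sup>2 * ell"
  define y where "y = \<omega>\<^sup>2 / 2"
  let ?J = "Suc ord div 2" and ?e = "exp 1 :: real"
  have q: "0 \<le> q" using ell_ge_1 by (simp add: q_def)
  have y: "0 \<le> y" "y \<le> 3 / 2 * q" using assms by (simp_all add: y_def q_def)
  have J: "?e\<^sup>2 * q \<le> real ?J"
  proof -
    have "?e\<^sup>2 * q \<le> real ord / 2" using ord_ge by (simp add: q_def)
    also have "\<dots> \<le> real ?J" by linarith
    finally show ?thesis .
  qed
  \<comment> \<open>Inserting e to the power \<open>?J\<close> costs exp(e y) but gains exp(-J), and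
    J is at least e^2 times \<open>q\<close>.\<close>
  have "y ^ ?J / fact ?J = ((?e * y) ^ ?J / fact ?J) * exp (- real ?J)"
  proof -
    have "exp (real ?J) = ?e ^ ?J" using exp_of_nat_mult[of ?J "1::real"] by simp
    then have "exp (- real ?J) = 1 / ?e ^ ?J" by (simp add: exp_minus inverse_eq_divide)
    then show ?thesis by (simp add: power_mult_distrib)
  qed
  also have "\<dots> \<le> exp (?e * y) * exp (- real ?J)"
  proof (rule mult_right_mono)
    show "(?e * y) ^ ?J / fact ?J \<le> exp (?e * y)"
      using y by (intro power_div_fact_le_exp) simp
  qed simp
  finally have "exp y * (y ^ ?J / fact ?J) \<le> exp y * (exp (?e * y) * exp (- real ?J))"
    by (rule mult_left_mono) simp
  also have "\<dots> = exp (y + ?e * y - real ?J)" 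
    by (simp only: exp_add[symmetric]) (simp add: algebra_simps)
  also have "\<dots> \<le> exp (- q)"
  proof -
    \<comment> \<open>At the cut y = 3q/2 the exponent is -q times
      \<open>1 + (e - 5/2) * (e + 1)\<close>, so e \<ge> 5/2 is precisely what this margin
      uses.\<close>
    have "y + ?e * y - real ?J \<le> (1 + ?e) * (3 / 2 * q) - ?e\<^sup>2 * q"
      using J mult_left_mono[OF y(2), of "1 + ?e"] by (simp add: algebra_simps)
    also have "\<dots> = - q - (?e - 5 / 2) * (?e + 1) * q"
      by (simp add: algebra_simps power2_eq_square)
    also have "\<dots> \<le> - q" using q exp_1_ge by (simp add: add_nonneg_nonneg)
    finally show ?thesis by simp
  qed
  finally have *: "exp y * y ^ ?J / fact ?J \<le> exp (- q)" by simp
  have "\<bar>(LINT z|N01. S (\<omega> + \<sigma> * z)) - G \<omega> \<beta>\<bar> \<le> \<omega>\<^sup>2 * (exp y * y ^ ?J / fact ?J)"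
    unfolding integral_S y_def by (rule taylor_G_bound)
  also have "\<dots> \<le> \<omega>\<^sup>2 * exp (- q)" by (intro mult_left_mono *) auto
  also have "\<dots> \<le> ell * exp (- \<gamma>\<^sup>2 * ell)"
  proof (rule mult_mono)
    have "\<omega>\<^sup>2 \<le> 3 * (1 / 5) * ell"
      using ell_ge_1 gamma_r_le by (intro order_trans[OF assms] mult_right_mono) auto
    then show "\<omega>\<^sup>2 \<le> ell" using ell_ge_1 by simp
    show "exp (- q) \<le> exp (- \<gamma>\<^sup>2 * ell)"
      unfolding q_def using gamma2_le ell_ge_1 by simp
  qed (use ell_ge_1 in auto)
  finally show ?thesis .
qed

section \<open>The event that V falls in the central band\<close>

definition "mid = measure N01 {v. \<bar>\<omega> + \<sigma> * v\<bar> \<le> thr}"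

text \<open>With \<open>k = sqrt (3 / 2)\<close> the mean exceeds
  \<open>k * (\<gamma> + r) * sqrt (2 * ell)\<close> in absolute value. The band edge takes away at
  most \<open>k * \<gamma> * sqrt (2 * ell)\<close>, so the distance \<open>y\<close> keeps
  \<open>k * r * sqrt (2 * ell)\<close>, and the scale is at most \<open>r\<close>. The second
  estimate is needed because \<open>G\<close> grows linearly in \<omega>.\<close>

lemma mid_large:
  assumes "3 * (\<gamma> + r)\<^sup>2 * ell < \<omega>\<^sup>2"
  shows "mid \<le> exp (- (3 / 2) * ell)" "mid * \<bar>\<omega>\<bar> \<le> mid * ell + exp (- (5 / 4) * ell)"
proof -
  define y where "y = \<bar>\<omega>\<bar> - thr"
  define k where "k = sqrt (3 / 2 :: real)"
  have k: "1 \<le> k" "k\<^sup>2 = 3 / 2" by (simp_all add: k_def)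
  have "k * (\<gamma> + r) * sqrt (2 * ell) \<le> \<bar>\<omega>\<bar>"
  proof (rule power2_le_imp_le)
    show "(k * (\<gamma> + r) * sqrt (2 * ell))\<^sup>2 \<le> \<bar>\<omega>\<bar>\<^sup>2"
      using assms ell_ge_1 by (simp add: power_mult_distrib k mult_ac)
  qed simp
  moreover have "thr \<le> k * thr" using thr_nonneg k mult_right_mono[of 1 k thr] by simp
  ultimately have y: "k * r * sqrt (2 * ell) \<le> y"
    by (simp add: y_def thr_def algebra_simps)
  have y0: "0 \<le> y" using y k r_pos ell_ge_1 by (rule_tac order_trans[OF _ y]) simp
  have "(k * r * sqrt (2 * ell))\<^sup>2 \<le> y\<^sup>2"
    using y k r_pos ell_ge_1 by (intro power_mono) auto
  then have y2: "3 * r\<^sup>2 * ell \<le> y\<^sup>2" using ell_ge_1 by (simp add: power_mult_distrib k mult_ac)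
  have z: "3 / 2 * ell \<le> y\<^sup>2 / (2 * r\<^sup>2)" using y2 r_pos by (simp add: field_simps)
  have "mid \<le> measure N01 {v. y \<le> (- sgn \<omega> * \<sigma>) * v}"
    unfolding mid_def y_def by (rule N01.finite_measure_mono) (auto simp: sgn_if)
  also have "\<dots> \<le> exp (- (y\<^sup>2 / (2 * r\<^sup>2)))"
    using sigma2_le_r2 r_pos y0 by (intro N01_tail) (auto simp: power_mult_distrib sgn_if)
  finally have m: "mid \<le> exp (- (y\<^sup>2 / (2 * r\<^sup>2)))" .
  then show "mid \<le> exp (- (3 / 2) * ell)"
    by (rule order_trans) (use z in simp)
  have "y * mid \<le> y * exp (- (y\<^sup>2 / (2 * r\<^sup>2)))" using m y0 by (rule mult_left_mono)
  \<comment> \<open>One sixth of the Gaussian exponent absorbs the factor \<open>y\<close>; the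
    other five sixths of 3/2 leave 5/4.\<close>
  also have "\<dots> = (y * exp (- (1 / 6) * (y\<^sup>2 / (2 * r\<^sup>2)))) * exp (- (5 / 6) * (y\<^sup>2 / (2 * r\<^sup>2)))"
  proof -
    have split: "exp (- Q) = exp (- (1 / 6) * Q) * exp (- (5 / 6) * Q)" for Q :: real
      by (simp add: exp_add[symmetric])
    show ?thesis by (simp only: split[of "y\<^sup>2 / (2 * r\<^sup>2)"] mult.assoc)
  qed
  also have "\<dots> \<le> 1 * exp (- (5 / 4) * ell)"
  proof (rule mult_mono)
    have "y\<^sup>2 * (6 * (2 * r\<^sup>2)) \<le> y\<^sup>2 * 3" using r2_le by (intro mult_left_mono) auto
    then have "y\<^sup>2 / 3 \<le> 1 / 6 * (y\<^sup>2 / (2 * r\<^sup>2))" using r_pos by (simp add: field_simps)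
    then have "exp (- (1 / 6) * (y\<^sup>2 / (2 * r\<^sup>2))) \<le> exp (- (y\<^sup>2 / 3))" by simp
    then have "y * exp (- (1 / 6) * (y\<^sup>2 / (2 * r\<^sup>2))) \<le> y * exp (- (y\<^sup>2 / 3))"
      using y0 by (rule mult_left_mono)
    also have "y \<le> 1 + y\<^sup>2 / 3"
    proof -
      have "0 \<le> (y - 3 / 2)\<^sup>2" by simp
      then show ?thesis by (simp add: power2_eq_square algebra_simps)
    qed
    then have "y * exp (- (y\<^sup>2 / 3)) \<le> exp (y\<^sup>2 / 3) * exp (- (y\<^sup>2 / 3))"
      by (intro mult_right_mono) (auto intro: order_trans[OF _ exp_ge_add_one_self])
    also have "\<dots> = 1" by (simp add: exp_add[symmetric])
    finally show "y * exp (- (1 / 6) * (y\<^sup>2 / (2 * r\<^sup>2))) \<le> 1" .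
    show "exp (- (5 / 6) * (y\<^sup>2 / (2 * r\<^sup>2))) \<le> exp (- (5 / 4) * ell)" using z by simp
  qed auto
  finally have "mid * y \<le> exp (- (5 / 4) * ell)" by (simp add: mult.commute)
  moreover have "mid * thr \<le> mid * ell" using thr_le by (intro mult_left_mono) (auto simp: mid_def)
  moreover have "mid * \<bar>\<omega>\<bar> = mid * y + mid * thr" by (simp add: y_def algebra_simps)
  ultimately show "mid * \<bar>\<omega>\<bar> \<le> mid * ell + exp (- (5 / 4) * ell)" by linarith
qed

lemma mid_le_1: "mid \<le> 1" and mid_ge_0: "0 \<le> mid"
  by (simp_all add: mid_def)

text \<open>Below the cut the terms are the Taylor remainder and the clipping bias, a second moment
  of order n^(3/4) divided by n up to logarithms. Above the cut only the crude bound n for the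
  clipped series is available, and n^(-3/2) pays for it.\<close>

lemma mid_bias:
  "mid * \<bar>(LINT z|N01. St (\<omega> + \<sigma> * z)) - G \<omega> \<beta>\<bar>
    \<le> ell * exp (- \<gamma>\<^sup>2 * ell) + 9 * (1 + ell)\<^sup>2 * exp (- (1 / 4) * ell) + 3 * exp (- (1 / 4) * ell)"
    (is "mid * ?b \<le> ?A + ?B + ?C")
proof (cases "\<omega>\<^sup>2 \<le> 3 * (\<gamma> + r)\<^sup>2 * ell")
  case True
  have "\<bar>(LINT z|N01. St (\<omega> + \<sigma> * z)) - (LINT z|N01. S (\<omega> + \<sigma> * z))\<bar>
      = \<bar>LINT z|N01. S (\<omega> + \<sigma> * z) - St (\<omega> + \<sigma> * z)\<bar>"
    using integrable_S integrable_St by simp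
  also have "\<dots> \<le> (LINT z|N01. \<bar>S (\<omega> + \<sigma> * z) - St (\<omega> + \<sigma> * z)\<bar>)"
    by (rule integral_abs_bound)
  also have "\<dots> \<le> (LINT z|N01. (S (\<omega> + \<sigma> * z))\<^sup>2 / real n)"
    using integrable_S integrable_St integrable_S2
    by (intro integral_mono) (auto simp: S_minus_St)
  also have "\<dots> = (LINT z|N01. (S (\<omega> + \<sigma> * z))\<^sup>2) / real n" by simp
  also have "\<dots> \<le> 9 * (1 + ell)\<^sup>2 * exp (3 / 4 * ell) / exp ell"
    unfolding exp_ell by (intro divide_right_mono integral_S2_small True) simp
  also have "\<dots> = ?B"
    by (simp add: times_divide_eq_right[symmetric] exp_diff[symmetric] del: times_divide_eq_right)
  finally have b: "?b \<le> ?A + ?B" using integral_S_small[OF True] by linarith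
  have "mid * ?b \<le> 1 * ?b" using mid_le_1 by (intro mult_right_mono) auto
  also have "\<dots> \<le> ?A + ?B" using b by simp
  also have "\<dots> \<le> ?A + ?B + ?C" by simp
  finally show ?thesis .
next
  case False
  then have large: "3 * (\<gamma> + r)\<^sup>2 * ell < \<omega>\<^sup>2" by simp
  have "\<bar>LINT z|N01. St (\<omega> + \<sigma> * z)\<bar> \<le> (LINT z|N01. \<bar>St (\<omega> + \<sigma> * z)\<bar>)"
    by (rule integral_abs_bound)
  also have "\<dots> \<le> (LINT z|N01. exp ell)"
    using integrable_St by (intro integral_mono) (auto simp: St_bounds exp_ell)
  finally have "?b \<le> exp ell + 1 + \<bar>\<omega>\<bar>" using abs_G_le[OF beta, of \<omega>] by simp
  then have "mid * ?b \<le> mid * (exp ell + 1 + \<bar>\<omega>\<bar>)" using mid_ge_0 by (rule mult_left_mono)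
  also have "\<dots> = mid * (exp ell + 1) + mid * \<bar>\<omega>\<bar>" by (simp add: algebra_simps)
  also have "\<dots> \<le> mid * (exp ell + (1 + ell)) + exp (- (5 / 4) * ell)"
    using mid_large(2)[OF large] by (simp add: algebra_simps)
  also have "\<dots> \<le> mid * (exp ell + exp ell) + exp (- (5 / 4) * ell)"
    using mid_ge_0 by (intro add_mono mult_left_mono exp_ge_add_one_self) auto
  also have "\<dots> \<le> exp (- (3 / 2) * ell) * (exp ell + exp ell) + exp (- (5 / 4) * ell)"
    by (intro add_mono mult_right_mono mid_large(1)[OF large]) auto
  also have "\<dots> = 2 * exp (- (1 / 2) * ell) + exp (- (5 / 4) * ell)"
    by (simp add: exp_add[symmetric])
  also have "\<dots> \<le> 2 * exp (- (1 / 4) * ell) + exp (- (1 / 4) * ell)"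
    using ell_ge_1 by (intro add_mono) auto
  finally have "mid * ?b \<le> ?C" by simp
  also have "?C \<le> ?A + ?B + ?C" using ell_ge_1 by simp
  finally show ?thesis .
qed

text \<open>Above the cut the clipping level contributes n^2, which the band probability reduces to
  n^(1/2); the small-mean case is the dominant one.\<close>

lemma mid_second_moment: "mid * (LINT z|N01. (St (\<omega> + \<sigma> * z))\<^sup>2) \<le> 9 * (1 + ell)\<^sup>2 * exp (3 / 4 * ell)"
proof (cases "\<omega>\<^sup>2 \<le> 3 * (\<gamma> + r)\<^sup>2 * ell")
  case True
  have "mid * (LINT z|N01. (St (\<omega> + \<sigma> * z))\<^sup>2) \<le> 1 * (LINT z|N01. (St (\<omega> + \<sigma> * z))\<^sup>2)"
    using mid_le_1 by (intro mult_right_mono) auto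
  also have "\<dots> \<le> (LINT z|N01. (S (\<omega> + \<sigma> * z))\<^sup>2)"
    using integrable_S2 integrable_St2
    by (simp, intro integral_mono) (auto simp: St_bounds abs_le_square_iff[symmetric])
  also have "\<dots> \<le> 9 * (1 + ell)\<^sup>2 * exp (3 / 4 * ell)" by (rule integral_S2_small[OF True])
  finally show ?thesis .
next
  case False
  then have large: "3 * (\<gamma> + r)\<^sup>2 * ell < \<omega>\<^sup>2" by simp
  have "(LINT z|N01. (St (\<omega> + \<sigma> * z))\<^sup>2) \<le> (LINT z|N01. (exp ell)\<^sup>2)"
    using integrable_St2 St_bounds(1) exp_ell
    by (intro integral_mono) (auto simp: abs_le_square_iff[symmetric])
  then have "mid * (LINT z|N01. (St (\<omega> + \<sigma> * z))\<^sup>2) \<le> exp (- (3 / 2) * ell) * (exp ell)\<^sup>2"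
    by (intro mult_mono mid_large(1)[OF large]) auto
  also have "\<dots> = 1 * exp (1 / 2 * ell)"
    by (simp add: exp_add[symmetric] power2_eq_square)
  also have "\<dots> \<le> 9 * (1 + ell)\<^sup>2 * exp (3 / 4 * ell)"
  proof (rule mult_mono)
    have "1 \<le> (1 + ell)\<^sup>2" using ell_ge_1 by (intro one_le_power) auto
    then show "1 \<le> 9 * (1 + ell)\<^sup>2" by simp
  qed (use ell_ge_1 in auto)
  finally show ?thesis .
qed

end

lemma square_add_le: "(a + b)\<^sup>2 \<le> 2 * a\<^sup>2 + 2 * b\<^sup>2" for a b :: real
  using zero_le_power2[of "a - b"] by (simp add: power2_eq_square algebra_simps)

lemma square_add3_le: "(a + b + c)\<^sup>2 \<le> 3 * a\<^sup>2 + 3 * b\<^sup>2 + 3 * c\<^sup>2" for a b c :: real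
  using zero_le_power2[of "a - b"] zero_le_power2[of "b - c"] zero_le_power2[of "a - c"]
  by (simp add: power2_eq_square algebra_simps)

section \<open>Bias and dispersion of the three-branch estimator\<close>

context gaussian_coordinate
begin

text \<open>Each summand is a function of \<open>u\<close> times a function of \<open>v\<close>, so
  independence turns every expectation below into a product of one-dimensional ones.\<close>

lemma F_eq:
  "F u v = (- \<beta> * (\<omega> + \<sigma> * u)) * indicator {v. \<omega> + \<sigma> * v < - thr} v
     + St (\<omega> + \<sigma> * u) * indicator {v. \<bar>\<omega> + \<sigma> * v\<bar> \<le> thr} v
     + ((1 - \<beta>) * (\<omega> + \<sigma> * u)) * indicator {v. thr < \<omega> + \<sigma> * v} v"
  using thr_nonneg by (auto simp: F_def indicator_def abs_le_iff)

lemma F_measurable [measurable]: "(\<lambda>x. F (fst x) (snd x)) \<in> borel_measurable (borel \<Otimes>\<^sub>M borel)"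
  unfolding F_def[abs_def] by measurable

lemma integrable_indicator_N01: "A \<in> sets borel \<Longrightarrow> integrable N01 (indicat_real A)"
  by (rule integrable_real_indicator) (auto simp: N01.emeasure_eq_measure)

lemma integrable_affine: "integrable N01 (\<lambda>u. k * (\<omega> + \<sigma> * u))"
  by (intro integrable_mult_right Bochner_Integration.integrable_add integrable_N01_id) simp

lemma integral_affine: "(LINT u|N01. k * (\<omega> + \<sigma> * u)) = k * \<omega>"
  using integrable_N01_id by (simp add: integral_N01_id)

lemma
  shows integrable_F: "integrable (N01 \<Otimes>\<^sub>M N01) (\<lambda>x. F (fst x) (snd x))"
    and integral_F: "(LINT x|(N01 \<Otimes>\<^sub>M N01). F (fst x) (snd x)) =
       - \<beta> * \<omega> * measure N01 {v. \<omega> + \<sigma> * v < - thr} + (LINT z|N01. St (\<omega> + \<sigma> * z)) * mid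
       + (1 - \<beta>) * \<omega> * measure N01 {v. thr < \<omega> + \<sigma> * v}"
proof -
  let ?A = "{v. \<omega> + \<sigma> * v < - thr}" and ?B = "{v. \<bar>\<omega> + \<sigma> * v\<bar> \<le> thr}"
    and ?C = "{v. thr < \<omega> + \<sigma> * v}"
  have A: "integrable N01 (indicat_real ?A)" and B: "integrable N01 (indicat_real ?B)"
    and C: "integrable N01 (indicat_real ?C)"
    by (rule integrable_indicator_N01; simp)+
  note int = integrable_N01_pair_mult[OF integrable_affine A] integrable_N01_pair_mult[OF integrable_St B]
    integrable_N01_pair_mult[OF integrable_affine C]
  show "integrable (N01 \<Otimes>\<^sub>M N01) (\<lambda>x. F (fst x) (snd x))"
    unfolding F_eq by (intro Bochner_Integration.integrable_add int)
  have "(LINT x|(N01 \<Otimes>\<^sub>M N01). F (fst x) (snd x)) =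
     (LINT x|(N01 \<Otimes>\<^sub>M N01). (- \<beta> * (\<omega> + \<sigma> * fst x)) * indicator ?A (snd x)) +
     (LINT x|(N01 \<Otimes>\<^sub>M N01). St (\<omega> + \<sigma> * fst x) * indicator ?B (snd x)) +
     (LINT x|(N01 \<Otimes>\<^sub>M N01). ((1 - \<beta>) * (\<omega> + \<sigma> * fst x)) * indicator ?C (snd x))"
    unfolding F_eq
    by (simp only: Bochner_Integration.integral_add Bochner_Integration.integrable_add int)
  then show "(LINT x|(N01 \<Otimes>\<^sub>M N01). F (fst x) (snd x)) =
       - \<beta> * \<omega> * measure N01 ?A + (LINT z|N01. St (\<omega> + \<sigma> * z)) * mid
       + (1 - \<beta>) * \<omega> * measure N01 ?C"
    unfolding integral_N01_pair_mult[OF integrable_affine A] integral_N01_pair_mult[OF integrable_St B]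
      integral_N01_pair_mult[OF integrable_affine C] integral_affine
    by (simp add: mid_def)
qed

text \<open>The bias splits according to the branch taken. In the outer branches \<open>G\<close>
  differs from the expected linear value by \<open>psi \<omega>\<close> or
  \<open>psi \<omega> - \<omega>\<close>, which is small unless choosing that branch is
  improbable.\<close>

lemma F_bias:
  assumes c: "c \<le> \<gamma>\<^sup>2 / 8" "c \<le> 1 / 4"
  shows "\<bar>(LINT x|(N01 \<Otimes>\<^sub>M N01). F (fst x) (snd x)) - G \<omega> \<beta>\<bar> \<le> 16 * (1 + ell)\<^sup>2 * exp (- c * ell)"
proof -
  let ?A = "measure N01 {v. \<omega> + \<sigma> * v < - thr}" and ?C = "measure N01 {v. thr < \<omega> + \<sigma> * v}"
  let ?E = "LINT z|N01. St (\<omega> + \<sigma> * z)"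
  have "?A + mid + ?C = measure N01 UNIV"
  proof -
    have "measure N01 ({v. \<omega> + \<sigma> * v < - thr} \<union> {v. \<bar>\<omega> + \<sigma> * v\<bar> \<le> thr}) = ?A + mid"
      unfolding mid_def by (rule N01.finite_measure_Union) auto
    moreover have "measure N01 (({v. \<omega> + \<sigma> * v < - thr} \<union> {v. \<bar>\<omega> + \<sigma> * v\<bar> \<le> thr}) \<union> {v. thr < \<omega> + \<sigma> * v})
       = measure N01 ({v. \<omega> + \<sigma> * v < - thr} \<union> {v. \<bar>\<omega> + \<sigma> * v\<bar> \<le> thr}) + ?C"
      by (rule N01.finite_measure_Union) (use thr_nonneg in auto)
    moreover have "({v. \<omega> + \<sigma> * v < - thr} \<union> {v. \<bar>\<omega> + \<sigma> * v\<bar> \<le> thr}) \<union> {v. thr < \<omega> + \<sigma> * v} = UNIV"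
      by auto
    ultimately show ?thesis by simp
  qed
  \<comment> \<open>Total mass one distributes \<open>G\<close> over the three branches, to be
    compared with them term by term.\<close>
  then have "G \<omega> \<beta> = G \<omega> \<beta> * (?A + mid + ?C)" by simp
  then have "(LINT x|(N01 \<Otimes>\<^sub>M N01). F (fst x) (snd x)) - G \<omega> \<beta> =
    - (?A * psi \<omega>) + mid * (?E - G \<omega> \<beta>) - (?C * (psi \<omega> - \<omega>))"
    unfolding integral_F by (simp add: G_eq_psi algebra_simps)
  then have "\<bar>(LINT x|(N01 \<Otimes>\<^sub>M N01). F (fst x) (snd x)) - G \<omega> \<beta>\<bar> \<le>
    \<bar>?A * psi \<omega>\<bar> + \<bar>mid * (?E - G \<omega> \<beta>)\<bar> + \<bar>?C * (psi \<omega> - \<omega>)\<bar>"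
    by linarith
  also have "\<dots> = ?A * \<bar>psi \<omega>\<bar> + mid * \<bar>?E - G \<omega> \<beta>\<bar> + ?C * \<bar>psi \<omega> - \<omega>\<bar>"
    using mid_ge_0 by (simp add: abs_mult)
  also have "\<dots> \<le> 2 * exp (- thr\<^sup>2 / 16) +
      (ell * exp (- \<gamma>\<^sup>2 * ell) + 9 * (1 + ell)\<^sup>2 * exp (- (1 / 4) * ell) + 3 * exp (- (1 / 4) * ell))
      + 2 * exp (- thr\<^sup>2 / 16)"
  proof (intro add_mono mid_bias)
    show "?A * \<bar>psi \<omega>\<bar> \<le> 2 * exp (- thr\<^sup>2 / 16)"
      using thr_nonneg sigma2_le by (intro N01_tail_mult_le abs_psi_le abs_psi_le_exp) auto
    have "{v. thr < \<omega> + \<sigma> * v} = {v. - \<omega> + (- \<sigma>) * v < - thr}" by auto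
    then show "?C * \<bar>psi \<omega> - \<omega>\<bar> \<le> 2 * exp (- thr\<^sup>2 / 16)"
      using thr_nonneg sigma2_le N01_tail_mult_le[of "\<bar>psi \<omega> - \<omega>\<bar>" "- \<omega>" thr "- \<sigma>"]
        abs_psi_minus_le[of \<omega>] abs_psi_minus_le_exp[of \<omega>] by simp
  qed
  \<comment> \<open>\<open>thr\<^sup>2 / 16\<close> equals
    \<open>\<gamma>\<^sup>2 / 8 * ell\<close>, the origin of the first condition on
    \<open>c\<close>; the second is the exponent 1/4 of the clipping and large-mean terms.\<close>
  also have "\<dots> \<le> 2 * exp (- c * ell) +
      (ell * exp (- c * ell) + 9 * (1 + ell)\<^sup>2 * exp (- c * ell) + 3 * exp (- c * ell))
      + 2 * exp (- c * ell)"
  proof -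
    have "c * ell \<le> \<gamma>\<^sup>2 / 8 * ell" using c ell_ge_1 by (intro mult_right_mono) auto
    then have 1: "exp (- thr\<^sup>2 / 16) \<le> exp (- c * ell)" by (simp add: thr2 mult_ac)
    have "c \<le> \<gamma>\<^sup>2" using c(1) zero_le_power2[of \<gamma>] by linarith
    then have "c * ell \<le> \<gamma>\<^sup>2 * ell" using ell_ge_1 by (intro mult_right_mono) auto
    then have 2: "exp (- \<gamma>\<^sup>2 * ell) \<le> exp (- c * ell)" by simp
    have "c * ell \<le> 1 / 4 * ell" using c ell_ge_1 by (intro mult_right_mono) auto
    then have 3: "exp (- (1 / 4) * ell) \<le> exp (- c * ell)" by simp
    show ?thesis using 1 2 3 ell_ge_1 by (intro add_mono mult_left_mono) auto
  qed
  also have "\<dots> = (7 + ell + 9 * (1 + ell)\<^sup>2) * exp (- c * ell)" by (simp add: algebra_simps)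
  also have "\<dots> \<le> (16 * (1 + ell)\<^sup>2) * exp (- c * ell)"
  proof (rule mult_right_mono)
    show "7 + ell + 9 * (1 + ell)\<^sup>2 \<le> 16 * (1 + ell)\<^sup>2"
      using ell_ge_1 by (simp add: power2_eq_square algebra_simps)
  qed simp
  finally show ?thesis .
qed

text \<open>Subtracting the asymptote removes the dependence on the size of \<omega>. What is left
  of \<omega> in each branch is dominated by the noise \<open>\<sigma> * v\<close> that led there,
  in the central branch together with \<open>thr\<close>.\<close>

lemma F_minus_centre_le:
  "(F u v - centre)\<^sup>2 \<le> 3 * ((St (\<omega> + \<sigma> * u))\<^sup>2 * indicator {v. \<bar>\<omega> + \<sigma> * v\<bar> \<le> thr} v)
     + 3 * thr\<^sup>2 + 3 * \<sigma>\<^sup>2 * v\<^sup>2 + 2 * \<sigma>\<^sup>2 * u\<^sup>2"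
proof -
  consider (A) "\<omega> + \<sigma> * v < - thr" | (B) "\<bar>\<omega> + \<sigma> * v\<bar> \<le> thr" | (C) "thr < \<omega> + \<sigma> * v" by linarith
  then show ?thesis
  proof cases
    case A
    then have "F u v - centre = - \<beta> * (\<sigma> * u) + (- max 0 \<omega>)"
      by (simp add: F_def centre_def algebra_simps)
    then have "(F u v - centre)\<^sup>2 \<le> 2 * (- \<beta> * (\<sigma> * u))\<^sup>2 + 2 * (- max 0 \<omega>)\<^sup>2"
      by (simp only: square_add_le)
    moreover have "(- \<beta> * (\<sigma> * u))\<^sup>2 \<le> (\<sigma> * u)\<^sup>2"
      using beta by (simp add: abs_le_square_iff[symmetric] abs_mult mult_left_le_one_le)
    \<comment> \<open>A positive mean reaches the lower branch only if the noise has outweighed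
      it.\<close>
    moreover have "\<bar>- max 0 \<omega>\<bar> \<le> \<bar>\<sigma> * v\<bar>" using A thr_nonneg by linarith
    then have "(- max 0 \<omega>)\<^sup>2 \<le> (\<sigma> * v)\<^sup>2" by (simp only: abs_le_square_iff)
    moreover note this
    moreover have ind: "indicator {v. \<bar>\<omega> + \<sigma> * v\<bar> \<le> thr} v = (0 :: real)"
      using A thr_nonneg by auto
    moreover have "0 \<le> \<sigma>\<^sup>2 * v\<^sup>2" "0 \<le> thr\<^sup>2" by auto
    ultimately show ?thesis
      unfolding ind power_mult_distrib mult.assoc mult_zero_right by linarith
  next
    case C
    then have "F u v - centre = (1 - \<beta>) * (\<sigma> * u) + (\<omega> - max 0 \<omega>)"
      using thr_nonneg by (simp add: F_def centre_def algebra_simps)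
    then have "(F u v - centre)\<^sup>2 \<le> 2 * ((1 - \<beta>) * (\<sigma> * u))\<^sup>2 + 2 * (\<omega> - max 0 \<omega>)\<^sup>2"
      by (simp only: square_add_le)
    moreover have "((1 - \<beta>) * (\<sigma> * u))\<^sup>2 \<le> (\<sigma> * u)\<^sup>2"
      using beta by (simp add: abs_le_square_iff[symmetric] abs_mult mult_left_le_one_le)
    moreover have "\<bar>\<omega> - max 0 \<omega>\<bar> \<le> \<bar>\<sigma> * v\<bar>" using C thr_nonneg by linarith
    then have "(\<omega> - max 0 \<omega>)\<^sup>2 \<le> (\<sigma> * v)\<^sup>2" by (simp only: abs_le_square_iff)
    moreover note this
    moreover have ind: "indicator {v. \<bar>\<omega> + \<sigma> * v\<bar> \<le> thr} v = (0 :: real)"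
      using C thr_nonneg by auto
    moreover have "0 \<le> \<sigma>\<^sup>2 * v\<^sup>2" "0 \<le> thr\<^sup>2" by auto
    ultimately show ?thesis
      unfolding ind power_mult_distrib mult.assoc mult_zero_right by linarith
  next
    case B
    then have F: "F u v = St (\<omega> + \<sigma> * u)" by (auto simp: F_def)
    have "\<bar>centre\<bar> \<le> \<bar>\<omega>\<bar>"
    proof (cases "0 \<le> \<omega>")
      case True
      then have "centre = (1 - \<beta>) * \<omega>" by (simp add: centre_def algebra_simps)
      then show ?thesis using beta True by (simp add: abs_mult mult_left_le_one_le)
    next
      case False
      then have "centre = - \<beta> * \<omega>" by (simp add: centre_def)
      then show ?thesis using beta by (simp add: abs_mult mult_left_le_one_le)
    qed
    moreover have "\<bar>\<omega>\<bar> \<le> thr + \<bar>\<sigma> * v\<bar>" using B by linarith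
    ultimately have "\<bar>F u v - centre\<bar> \<le> \<bar>St (\<omega> + \<sigma> * u)\<bar> + thr + \<bar>\<sigma> * v\<bar>" unfolding F by linarith
    then have "\<bar>F u v - centre\<bar>\<^sup>2 \<le> (\<bar>St (\<omega> + \<sigma> * u)\<bar> + thr + \<bar>\<sigma> * v\<bar>)\<^sup>2" by (rule power_mono) simp
    also have "\<dots> \<le> 3 * \<bar>St (\<omega> + \<sigma> * u)\<bar>\<^sup>2 + 3 * thr\<^sup>2 + 3 * \<bar>\<sigma> * v\<bar>\<^sup>2" by (rule square_add3_le)
    also have "\<dots> \<le> 3 * (St (\<omega> + \<sigma> * u))\<^sup>2 + 3 * thr\<^sup>2 + 3 * \<sigma>\<^sup>2 * v\<^sup>2 + 2 * \<sigma>\<^sup>2 * u\<^sup>2"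
      by (simp add: power_mult_distrib)
    finally show ?thesis using B by simp
  qed
qed

lemma
  shows integrable_F_centre: "integrable (N01 \<Otimes>\<^sub>M N01) (\<lambda>x. (F (fst x) (snd x) - centre)\<^sup>2)"
    and integral_F_centre: "(LINT x|(N01 \<Otimes>\<^sub>M N01). (F (fst x) (snd x) - centre)\<^sup>2) \<le> 32 * (1 + ell)\<^sup>2 * exp (3 / 4 * ell)"
proof -
  let ?B = "{v. \<bar>\<omega> + \<sigma> * v\<bar> \<le> thr}"
  let ?g = "\<lambda>x. 3 * ((St (\<omega> + \<sigma> * fst x))\<^sup>2 * indicator ?B (snd x))
     + 3 * thr\<^sup>2 + 3 * \<sigma>\<^sup>2 * (snd x)\<^sup>2 + 2 * \<sigma>\<^sup>2 * (fst x)\<^sup>2"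
  have B: "integrable N01 (indicat_real ?B)" by (rule integrable_indicator_N01) simp
  have sq: "integrable N01 (\<lambda>z. z\<^sup>2)" by (rule integrable_std_normal_distribution_moment)
  note int = integrable_N01_pair_mult[OF integrable_St2 B] integrable_N01_fst[OF sq] integrable_N01_snd[OF sq]
  have g: "integrable (N01 \<Otimes>\<^sub>M N01) ?g"
    by (intro Bochner_Integration.integrable_add integrable_mult_right int) simp
  have bound: "(F (fst x) (snd x) - centre)\<^sup>2 \<le> ?g x" for x by (rule F_minus_centre_le)
  show i: "integrable (N01 \<Otimes>\<^sub>M N01) (\<lambda>x. (F (fst x) (snd x) - centre)\<^sup>2)"
  proof (rule Bochner_Integration.integrable_bound[OF g])
    show "(\<lambda>x. (F (fst x) (snd x) - centre)\<^sup>2) \<in> borel_measurable (N01 \<Otimes>\<^sub>M N01)"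
      using integrable_F by simp
    show "AE x in N01 \<Otimes>\<^sub>M N01. norm ((F (fst x) (snd x) - centre)\<^sup>2) \<le> norm (?g x)"
      using order_trans[OF bound abs_ge_self] by simp
  qed
  have "(LINT x|(N01 \<Otimes>\<^sub>M N01). (F (fst x) (snd x) - centre)\<^sup>2) \<le> (LINT x|(N01 \<Otimes>\<^sub>M N01). ?g x)"
    by (rule integral_mono[OF i g bound])
  also have "\<dots> = 3 * (LINT x|(N01 \<Otimes>\<^sub>M N01). (St (\<omega> + \<sigma> * fst x))\<^sup>2 * indicator ?B (snd x)) + 3 * thr\<^sup>2
     + 3 * \<sigma>\<^sup>2 * (LINT x|(N01 \<Otimes>\<^sub>M N01). (snd x)\<^sup>2) + 2 * \<sigma>\<^sup>2 * (LINT x|(N01 \<Otimes>\<^sub>M N01). (fst x)\<^sup>2)"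
    using int by (simp add: N01_pair.prob_space)
  also have "\<dots> = 3 * (mid * (LINT z|N01. (St (\<omega> + \<sigma> * z))\<^sup>2)) + 3 * thr\<^sup>2 + 5 * \<sigma>\<^sup>2"
    using integral_N01_pair_mult[OF integrable_St2 B] integral_N01_fst[OF sq] integral_N01_snd[OF sq]
    by (simp add: integral_N01_square mid_def)
  \<comment> \<open>The central term contributes 27 of the final 32; the remaining 5 absorb
    \<open>3 * ell + 1\<close>.\<close>
  also have "\<dots> \<le> 3 * (9 * (1 + ell)\<^sup>2 * exp (3 / 4 * ell)) + 3 * ell + 5 * (1 / 5)"
    by (intro add_mono mult_left_mono mid_second_moment thr2_le sigma2_le) auto
  also have "\<dots> \<le> 32 * (1 + ell)\<^sup>2 * exp (3 / 4 * ell)"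
  proof -
    have "3 * ell + 1 \<le> 5 * (1 + ell)\<^sup>2 * 1"
      using ell_ge_1 by (simp add: power2_eq_square algebra_simps)
    also have "\<dots> \<le> 5 * (1 + ell)\<^sup>2 * exp (3 / 4 * ell)"
      using ell_ge_1 by (intro mult_left_mono) auto
    finally show ?thesis by simp
  qed
  finally show "(LINT x|(N01 \<Otimes>\<^sub>M N01). (F (fst x) (snd x) - centre)\<^sup>2) \<le> 32 * (1 + ell)\<^sup>2 * exp (3 / 4 * ell)" .
qed

end

lemma (in prob_space)
  fixes X :: "'a \<Rightarrow> real"
  assumes [measurable]: "X \<in> borel_measurable M" and X2: "integrable M (\<lambda>x. (X x)\<^sup>2)"
  shows integrable_of_square: "integrable M X"
    and square_expectation_le: "(expectation X)\<^sup>2 \<le> expectation (\<lambda>x. (X x)\<^sup>2)"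
proof -
  show i: "integrable M X"
  proof (rule Bochner_Integration.integrable_bound)
    show "integrable M (\<lambda>x. 1 + (X x)\<^sup>2)" using X2 by simp
    have "\<bar>t\<bar> \<le> 1 + t\<^sup>2" for t :: real
      using zero_le_power2[of "\<bar>t\<bar> - 1 / 2"] by (simp add: power2_eq_square algebra_simps)
    then show "AE x in M. norm (X x) \<le> norm (1 + (X x)\<^sup>2)"
      by (auto simp: abs_of_nonneg)
  qed measurable
  show "(expectation X)\<^sup>2 \<le> expectation (\<lambda>x. (X x)\<^sup>2)"
    using variance_eq[OF i X2] variance_positive[of X] by simp
qed

lemma alpha_bounds:
  assumes "0 < \<nu>p"
  shows "0 \<le> alpha \<nu>p \<tau>" "alpha \<nu>p \<tau> \<le> 1"
proof -
  have "0 < enn2real \<tau> + \<nu>p" using assms by (intro add_nonneg_pos) auto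
  then show "0 \<le> alpha \<nu>p \<tau>" "alpha \<nu>p \<tau> \<le> 1"
    using assms by (auto simp: alpha_def divide_le_eq_1)
qed

section \<open>Estimation error of a single coordinate\<close>

text \<open>The original parameters of one coordinate. \<theta>, \<eta> and \<tau> are fixed here
  without any restriction, which is what makes the resulting bounds uniform in them.\<close>

locale coordinate_problem =
  fixes n :: nat and \<nu>p \<nu>f b h \<gamma> \<theta> \<eta> :: real and \<tau> :: ennreal
  assumes n3: "3 \<le> n"
    and nu_pos: "0 < \<nu>p" "0 < \<nu>f"
    and bh_pos: "0 < b" "0 < h"
    and gam: "0 < \<gamma>" "\<gamma> < 1 / sqrt (4 * exp 1) - sqrt (\<nu>p / \<nu>f)"
begin

definition "be = b / (b + h)"
definition "al = alpha \<nu>p \<tau>"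
definition "a = sqrt (\<nu>f + \<nu>p * al\<^sup>2)"
definition "om = c_coef \<nu>p \<nu>f be \<tau> + d_coef \<nu>p \<nu>f \<tau> * (\<theta> - \<eta>)"
definition "sg = d_coef \<nu>p \<nu>f \<tau> * sqrt (2 * \<nu>p)"
definition "r = sqrt (2 * \<nu>p / \<nu>f)"

lemma al_bounds: "0 \<le> al" "al \<le> 1"
  using alpha_bounds[OF nu_pos(1)] by (simp_all add: al_def)

lemma a2: "a\<^sup>2 = \<nu>f + \<nu>p * al\<^sup>2"
  using nu_pos by (simp add: a_def)

lemma a_pos: "0 < a"
  unfolding a_def using nu_pos by (simp add: add_pos_nonneg)

lemma d_eq: "d_coef \<nu>p \<nu>f \<tau> = - ((1 - al) / a)"
  by (simp add: d_coef_def al_def a_def mult.commute)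

lemma a_om: "a * om = sqrt (\<nu>f + al * \<nu>p) * Phi_inv be - (1 - al) * (\<theta> - \<eta>)"
proof -
  have "c_coef \<nu>p \<nu>f be \<tau> = sqrt (\<nu>f + al * \<nu>p) / a * Phi_inv be"
    by (simp add: c_coef_def al_def a_def real_sqrt_divide mult.commute)
  then have "a * c_coef \<nu>p \<nu>f be \<tau> = sqrt (\<nu>f + al * \<nu>p) * Phi_inv be" using a_pos by simp
  moreover have "a * (d_coef \<nu>p \<nu>f \<tau> * (\<theta> - \<eta>)) = - ((1 - al) * (\<theta> - \<eta>))"
    using a_pos by (simp add: d_eq)
  ultimately show ?thesis by (simp add: om_def distrib_left)
qed

lemma ratio_le: "\<nu>p \<le> \<nu>f"
proof -
  have "1 \<le> sqrt (4 * exp 1)" using exp_1_ge by simp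
  then have "1 / sqrt (4 * exp 1) \<le> (1::real)" by simp
  then have "sqrt (\<nu>p / \<nu>f) < 1" using gam by linarith
  then have "\<nu>p / \<nu>f < 1" by simp
  then show ?thesis using nu_pos by (simp add: divide_less_eq)
qed

text \<open>Since \<open>r\<close> is sqrt 2 times \<open>sqrt (\<nu>p / \<nu>f)\<close>, enlarging
  \<gamma> by the same factor brings the sum into the form of the hypothesis on \<gamma>; sqrt 2
  then turns 1/(4e) into 1/(2e).\<close>

lemma gamma_r_bound: "(\<gamma> + r)\<^sup>2 \<le> 1 / (2 * exp 1)"
proof -
  let ?s = "sqrt (\<nu>p / \<nu>f)"
  have r: "r = sqrt 2 * ?s" by (simp add: r_def real_sqrt_mult[symmetric])
  have s: "0 \<le> ?s" using nu_pos by simp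
  have "1 * \<gamma> \<le> sqrt 2 * \<gamma>" using gam by (intro mult_right_mono) auto
  then have "\<gamma> + r \<le> sqrt 2 * (\<gamma> + ?s)" unfolding r by (simp add: algebra_simps)
  also have "\<dots> \<le> sqrt 2 * (1 / sqrt (4 * exp 1))" using gam by (intro mult_left_mono) auto
  finally have "(\<gamma> + r)\<^sup>2 \<le> (sqrt 2 * (1 / sqrt (4 * exp 1)))\<^sup>2"
    using gam s r by (intro power_mono) auto
  also have "\<dots> = 1 / (2 * exp 1)" by (simp add: power_mult_distrib power_divide)
  finally show ?thesis .
qed

lemma sg_le: "\<bar>sg\<bar> \<le> r"
proof (rule power2_le_imp_le)
  have "\<bar>sg\<bar>\<^sup>2 = (1 - al)\<^sup>2 / a\<^sup>2 * (2 * \<nu>p)"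
    using nu_pos by (simp add: sg_def d_eq power_mult_distrib power_divide)
  also have "\<dots> \<le> 1 / \<nu>f * (2 * \<nu>p)"
    using al_bounds nu_pos a_pos by (intro mult_right_mono frac_le) (auto simp: a2 abs_square_le_1)
  also have "\<dots> = r\<^sup>2" using nu_pos by (simp add: r_def)
  finally show "\<bar>sg\<bar>\<^sup>2 \<le> r\<^sup>2" .
qed (use nu_pos in \<open>simp add: r_def\<close>)

lemma be_bounds: "0 \<le> be" "be \<le> 1"
  using bh_pos by (auto simp: be_def)

sublocale gc: gaussian_coordinate n \<gamma> r be sg om
proof
  show "0 < r" using nu_pos by (simp add: r_def)
qed (use n3 gam gamma_r_bound sg_le be_bounds in auto)

lemma S_trunc_eq: "S_trunc n \<nu>p \<nu>f be \<gamma> \<tau> u = gc.St u"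
proof -
  have "trunc_order n \<nu>p \<nu>f \<gamma> = Suc gc.ord"
    by (simp only: trunc_order_def gc.ord_def gc.ell_def) (simp add: r_def)
  moreover have "(s_coef \<nu>p \<nu>f \<tau>)\<^sup>2 = sg\<^sup>2"
    by (simp add: s_coef_def sg_def power_mult_distrib mult.commute)
  ultimately have "S_series n \<nu>p \<nu>f be \<gamma> \<tau> = gc.S"
    by (intro ext) (simp add: S_series_eq gc.S_def)
  then show ?thesis by (simp add: S_trunc_def gc.St_def)
qed

definition "rot = 1 / sqrt (2::real)"

lemma rot: "rot\<^sup>2 + rot\<^sup>2 = 1" "rot \<noteq> 0"
  by (simp_all add: rot_def power_divide)

text \<open>With \<open>X = \<theta> + sqrt \<nu>p W\<close>, the arguments \<open>U\<close> and \<open>V\<close> of the randomised estimator are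
  affine functions of the orthonormal combinations of \<open>W\<close> and \<open>Z\<close>, hence independent.\<close>

lemma T_rand_eq:
  "T_rand n \<nu>p \<nu>f be \<gamma> (\<theta> + sqrt \<nu>p * w - \<eta>) z \<tau> = gc.F (rot * w + rot * z) (rot * w - rot * z)"
proof -
  have "sg * rot = d_coef \<nu>p \<nu>f \<tau> * sqrt \<nu>p"
    by (simp add: sg_def rot_def real_sqrt_mult)
  then have *: "sg * (rot * x) = d_coef \<nu>p \<nu>f \<tau> * (sqrt \<nu>p * x)" for x
    by (simp add: mult.assoc[symmetric])
  have U: "c_coef \<nu>p \<nu>f be \<tau> + d_coef \<nu>p \<nu>f \<tau> * (\<theta> + sqrt \<nu>p * w - \<eta> + sqrt \<nu>p * z) = om + sg * (rot * w + rot * z)"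
    unfolding om_def distrib_left[of sg] * by (simp add: algebra_simps)
  have V: "c_coef \<nu>p \<nu>f be \<tau> + d_coef \<nu>p \<nu>f \<tau> * (\<theta> + sqrt \<nu>p * w - \<eta> - sqrt \<nu>p * z) = om + sg * (rot * w - rot * z)"
    unfolding om_def right_diff_distrib[of sg] * by (simp add: algebra_simps)
  have "threshold n \<gamma> = gc.thr" by (simp add: threshold_def gc.thr_def gc.ell_def)
  then show ?thesis unfolding T_rand_def Let_def U V gc.F_def S_trunc_eq by simp
qed

definition "TW w = T_hat n \<nu>p \<nu>f be \<gamma> (\<theta> + sqrt \<nu>p * w - \<eta>) \<tau>"

abbreviation "Frot x \<equiv> gc.F (rot * fst x + rot * snd x) (rot * fst x - rot * snd x)"

lemma TW_eq: "TW w = (LINT z|N01. Frot (w, z))"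
  unfolding TW_def T_hat_def T_rand_eq by simp

lemma Frot_measurable [measurable]: "Frot \<in> borel_measurable (N01 \<Otimes>\<^sub>M N01)"
proof -
  have "(\<lambda>x::real \<times> real. (rot * fst x + rot * snd x, rot * fst x - rot * snd x))
      \<in> borel \<Otimes>\<^sub>M borel \<rightarrow>\<^sub>M borel \<Otimes>\<^sub>M borel" by measurable
  from measurable_compose[OF this gc.F_measurable] show ?thesis by simp
qed

lemma integrable_Frot: "integrable (N01 \<Otimes>\<^sub>M N01) Frot"
  using integrable_N01_rotation[OF rot gc.F_measurable] gc.integrable_F by simp

lemma integrable_TW: "integrable N01 TW"
  unfolding TW_eq[abs_def] using N01_pair.integrable_fst'[OF integrable_Frot] by simp

lemma integral_TW: "(LINT w|N01. TW w) = (LINT x|(N01 \<Otimes>\<^sub>M N01). gc.F (fst x) (snd x))"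
proof -
  have "(LINT w|N01. TW w) = integral\<^sup>L (N01 \<Otimes>\<^sub>M N01) Frot"
    unfolding TW_eq using N01_pair.integral_fst'[OF integrable_Frot] by simp
  also have "\<dots> = (LINT x|(N01 \<Otimes>\<^sub>M N01). gc.F (fst x) (snd x))"
    using integral_N01_rotation[OF rot gc.F_measurable] by simp
  finally show ?thesis .
qed

text \<open>Integrating out the auxiliary variable is a conditional expectation given
  \<open>W\<close>, so by Jensen it cannot increase the second moment. Rotation then identifies the
  larger side with the moment of \<open>F\<close>.\<close>

lemma
  shows integrable_TW_centre: "integrable N01 (\<lambda>w. (TW w - gc.centre)\<^sup>2)"
    and integral_TW_centre: "(LINT w|N01. (TW w - gc.centre)\<^sup>2) \<le> 32 * (1 + gc.ell)\<^sup>2 * exp (3 / 4 * gc.ell)"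
proof -
  let ?g = "\<lambda>x. (gc.F (fst x) (snd x) - gc.centre)\<^sup>2" and ?f = "\<lambda>x. (Frot x - gc.centre)\<^sup>2"
  have gm: "?g \<in> borel_measurable (borel \<Otimes>\<^sub>M borel)" using gc.F_measurable by measurable
  have f: "integrable (N01 \<Otimes>\<^sub>M N01) ?f"
    using integrable_N01_rotation[OF rot gm] gc.integrable_F_centre by simp
  have int_f: "integral\<^sup>L (N01 \<Otimes>\<^sub>M N01) ?f = integral\<^sup>L (N01 \<Otimes>\<^sub>M N01) ?g"
    using integral_N01_rotation[OF rot gm] by simp
  have [measurable]: "TW \<in> borel_measurable N01" using integrable_TW by simp
  \<comment> \<open>Fubini provides integrable sections only for almost every \<open>w\<close>,
    hence the almost everywhere form.\<close>
  have ae: "AE w in N01. (TW w - gc.centre)\<^sup>2 \<le> (LINT z|N01. ?f (w, z))"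
    using N01_pair.AE_integrable_fst'[OF f] N01_pair.AE_integrable_fst'[OF integrable_Frot]
  proof eventually_elim
    case (elim w)
    have "TW w - gc.centre = (LINT z|N01. Frot (w, z) - gc.centre)"
      using elim(2) by (simp add: TW_eq)
    moreover have "(LINT z|N01. Frot (w, z) - gc.centre)\<^sup>2 \<le> (LINT z|N01. ?f (w, z))"
      using elim by (intro N01.square_expectation_le) auto
    ultimately show ?case by simp
  qed
  have g: "integrable N01 (\<lambda>w. LINT z|N01. ?f (w, z))" by (rule N01_pair.integrable_fst'[OF f])
  show i: "integrable N01 (\<lambda>w. (TW w - gc.centre)\<^sup>2)"
    by (rule Bochner_Integration.integrable_bound[OF g]) (use ae in \<open>auto elim!: eventually_mono\<close>)
  have "(LINT w|N01. (TW w - gc.centre)\<^sup>2) \<le> (LINT w|N01. LINT z|N01. ?f (w, z))"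
    by (rule integral_mono_AE[OF i g ae])
  also have "\<dots> = integral\<^sup>L (N01 \<Otimes>\<^sub>M N01) ?g"
    unfolding int_f[symmetric] by (rule N01_pair.integral_fst'[OF f])
  also have "\<dots> \<le> 32 * (1 + gc.ell)\<^sup>2 * exp (3 / 4 * gc.ell)" by (rule gc.integral_F_centre)
  finally show "(LINT w|N01. (TW w - gc.centre)\<^sup>2) \<le> 32 * (1 + gc.ell)\<^sup>2 * exp (3 / 4 * gc.ell)" .
qed

section \<open>The loss of one coordinate as a function of the noise\<close>

definition "LW w = sqrt \<nu>f * G ((a * om + al * sqrt \<nu>p * w) / sqrt \<nu>f) be"

lemma coord_loss_eq:
  "coord_loss \<nu>f b h \<theta> (al * (\<theta> + sqrt \<nu>p * w) + (1 - al) * \<eta> + sqrt (\<nu>f + al * \<nu>p) * Phi_inv be) = (b + h) * LW w"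
proof -
  have "al * (\<theta> + sqrt \<nu>p * w) + (1 - al) * \<eta> + sqrt (\<nu>f + al * \<nu>p) * Phi_inv be - \<theta>
    = a * om + al * sqrt \<nu>p * w"
    by (simp add: a_om algebra_simps)
  then show ?thesis by (simp add: coord_loss_def LW_def be_def)
qed

text \<open>The loss becomes an inner expectation over a fresh normal variable, linear in
  \<open>w\<close> and \<open>z\<close> jointly inside the hinge. This is the form to which a
  rotation of the pair can be applied.\<close>

lemma LW_eq: "LW w = (LINT z|N01. max 0 (a * om - (- al * sqrt \<nu>p * w + sqrt \<nu>f * z))) - be * (a * om + al * sqrt \<nu>p * w)"
proof -
  let ?m = "a * om + al * sqrt \<nu>p * w"
  have s: "0 < sqrt \<nu>f" using nu_pos by simp
  have "sqrt \<nu>f * psi (?m / sqrt \<nu>f) = (LINT z|N01. sqrt \<nu>f * max 0 (?m / sqrt \<nu>f - z))"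
    by (simp add: integral_N01_max)
  also have "\<dots> = (LINT z|N01. max 0 (a * om - (- al * sqrt \<nu>p * w + sqrt \<nu>f * z)))"
  proof (rule Bochner_Integration.integral_cong[OF refl])
    fix z
    have "sqrt \<nu>f * (?m / sqrt \<nu>f - z) = a * om - (- al * sqrt \<nu>p * w + sqrt \<nu>f * z)"
      using s by (simp add: right_diff_distrib)
    then show "sqrt \<nu>f * max 0 (?m / sqrt \<nu>f - z) = max 0 (a * om - (- al * sqrt \<nu>p * w + sqrt \<nu>f * z))"
      using s by (simp add: max_mult_distrib_left)
  qed
  finally have "sqrt \<nu>f * psi (?m / sqrt \<nu>f) = (LINT z|N01. max 0 (a * om - (- al * sqrt \<nu>p * w + sqrt \<nu>f * z)))" .
  moreover have "LW w = sqrt \<nu>f * psi (?m / sqrt \<nu>f) - be * ?m"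
    unfolding LW_def G_eq_psi right_diff_distrib using s by simp
  ultimately show ?thesis by simp
qed

lemma LW_measurable [measurable]: "LW \<in> borel_measurable borel"
proof -
  have "continuous_on UNIV (\<lambda>w. G w be)"
    by (intro continuous_at_imp_continuous_on ballI DERIV_isCont[OF G_has_derivative])
  then have [measurable]: "(\<lambda>w. G w be) \<in> borel_measurable borel" by (rule borel_measurable_continuous_onI)
  show ?thesis unfolding LW_def[abs_def] by measurable
qed

text \<open>\<open>psi\<close> and the term linear in \<open>be\<close> each contribute one unit to
  the factor 2. The bound is free of \<open>om\<close>, so deviations from \<open>LW 0\<close> stay
  controlled however large the loss is.\<close>

lemma LW_lipschitz: "\<bar>LW w - LW 0\<bar> \<le> 2 * sqrt \<nu>p * \<bar>w\<bar>"
proof -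
  have s: "0 < sqrt \<nu>f" using nu_pos by simp
  let ?x = "(a * om + al * sqrt \<nu>p * w) / sqrt \<nu>f" and ?y = "(a * om + al * sqrt \<nu>p * 0) / sqrt \<nu>f"
  have "\<bar>G ?x be - G ?y be\<bar> \<le> \<bar>psi ?x - psi ?y\<bar> + be * \<bar>?x - ?y\<bar>"
  proof -
    have "\<bar>(p1 - be * x1) - (p2 - be * x2)\<bar> \<le> \<bar>p1 - p2\<bar> + be * \<bar>x1 - x2\<bar>" for p1 p2 x1 x2
    proof -
      have "(p1 - be * x1) - (p2 - be * x2) = (p1 - p2) - be * (x1 - x2)" by (simp add: algebra_simps)
      then have "\<bar>(p1 - be * x1) - (p2 - be * x2)\<bar> \<le> \<bar>p1 - p2\<bar> + \<bar>be * (x1 - x2)\<bar>"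
        by (simp only: abs_triangle_ineq4)
      then show ?thesis using be_bounds by (simp add: abs_mult)
    qed
    then show ?thesis unfolding G_eq_psi .
  qed
  also have "\<dots> \<le> \<bar>?x - ?y\<bar> + 1 * \<bar>?x - ?y\<bar>"
    using be_bounds by (intro add_mono mult_right_mono psi_lipschitz) auto
  finally have "\<bar>G ?x be - G ?y be\<bar> \<le> 2 * \<bar>?x - ?y\<bar>" by simp
  then have "sqrt \<nu>f * \<bar>G ?x be - G ?y be\<bar> \<le> sqrt \<nu>f * (2 * \<bar>?x - ?y\<bar>)"
    using s by (intro mult_left_mono) auto
  also have "sqrt \<nu>f * (2 * \<bar>?x - ?y\<bar>) = 2 * (al * (sqrt \<nu>p * \<bar>w\<bar>))"
  proof -
    have "?x - ?y = al * sqrt \<nu>p * w / sqrt \<nu>f" by (simp add: diff_divide_distrib[symmetric])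
    then show ?thesis using s al_bounds nu_pos by (simp add: abs_mult)
  qed
  also have "\<dots> \<le> 2 * (1 * (sqrt \<nu>p * \<bar>w\<bar>))"
    using al_bounds nu_pos by (intro mult_left_mono mult_right_mono) auto
  also have "sqrt \<nu>f * \<bar>G ?x be - G ?y be\<bar> = \<bar>LW w - LW 0\<bar>"
    using s by (simp add: LW_def right_diff_distrib[symmetric] abs_mult)
  finally show ?thesis by simp
qed

lemma
  shows integrable_LW_diff: "integrable N01 (\<lambda>w. (LW w - LW 0)\<^sup>2)"
    and integral_LW_diff: "(LINT w|N01. (LW w - LW 0)\<^sup>2) \<le> 4 * \<nu>p"
proof -
  have bound: "(LW w - LW 0)\<^sup>2 \<le> 4 * \<nu>p * w\<^sup>2" for w
    using power_mono[OF LW_lipschitz[of w], of 2] nu_pos by (simp add: power_mult_distrib)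
  have sq: "integrable N01 (\<lambda>z. 4 * \<nu>p * z\<^sup>2)"
    by (intro integrable_mult_right integrable_std_normal_distribution_moment)
  show i: "integrable N01 (\<lambda>w. (LW w - LW 0)\<^sup>2)"
    by (rule Bochner_Integration.integrable_bound[OF sq]) (use bound nu_pos in auto)
  have "(LINT w|N01. (LW w - LW 0)\<^sup>2) \<le> (LINT w|N01. 4 * \<nu>p * w\<^sup>2)"
    by (rule integral_mono[OF i sq bound])
  then show "(LINT w|N01. (LW w - LW 0)\<^sup>2) \<le> 4 * \<nu>p" by (simp add: integral_N01_square)
qed

lemma integrable_LW: "integrable N01 LW"
proof -
  have "integrable N01 (\<lambda>w. LW w - LW 0)"
    by (rule N01.integrable_of_square[OF _ integrable_LW_diff]) simp
  then have "integrable N01 (\<lambda>w. (LW w - LW 0) + LW 0)" by (rule Bochner_Integration.integrable_add) simp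
  then show ?thesis by simp
qed

text \<open>Averaging over \<open>W\<close> convolves the two normal laws, which turns the variance \<open>\<nu>f\<close> of the loss into
  \<open>\<nu>f + \<nu>p al\<^sup>2\<close>.\<close>

lemma integral_LW: "(LINT w|N01. LW w) = a * G om be"
proof -
  let ?p = "- al * sqrt \<nu>p / a" and ?q = "sqrt \<nu>f / a"
  have pq: "?p\<^sup>2 + ?q\<^sup>2 = 1" "?q \<noteq> 0"
  proof -
    have "?p\<^sup>2 + ?q\<^sup>2 = (\<nu>f + \<nu>p * al\<^sup>2) / a\<^sup>2"
      using nu_pos by (simp add: power_mult_distrib power_divide add_divide_distrib mult.commute)
    then show "?p\<^sup>2 + ?q\<^sup>2 = 1" using a_pos by (simp add: a2[symmetric])
  qed (use nu_pos a_pos in simp)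
  let ?f = "\<lambda>x::real \<times> real. max 0 (a * om - a * fst x)"
  have i0: "integrable N01 (\<lambda>y. max 0 (a * om - a * y))" "(LINT y|N01. max 0 (a * om - a * y)) = a * psi om"
  proof -
    have eq: "max 0 (a * om - a * y) = a * max 0 (om - y)" for y
      using a_pos by (simp add: max_mult_distrib_left right_diff_distrib)
    show "integrable N01 (\<lambda>y. max 0 (a * om - a * y))" "(LINT y|N01. max 0 (a * om - a * y)) = a * psi om"
      unfolding eq by (simp_all add: integrable_N01_max integral_N01_max)
  qed
  have fm: "?f \<in> borel_measurable (borel \<Otimes>\<^sub>M borel)" by measurable
  have f: "integrable (N01 \<Otimes>\<^sub>M N01) ?f" "integral\<^sup>L (N01 \<Otimes>\<^sub>M N01) ?f = a * psi om"
    using integrable_N01_fst[OF i0(1)] integral_N01_fst[OF i0(1)] i0(2) by simp_all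
  let ?g = "\<lambda>x::real \<times> real. max 0 (a * om - (- al * sqrt \<nu>p * fst x + sqrt \<nu>f * snd x))"
  have eq: "?f (?p * fst x + ?q * snd x, ?q * fst x - ?p * snd x) = ?g x" for x
  proof -
    have "a * (?p * fst x + ?q * snd x) = - al * sqrt \<nu>p * fst x + sqrt \<nu>f * snd x"
      using a_pos by (simp add: right_diff_distrib)
    then show ?thesis by (simp only: fst_conv)
  qed
  have g: "integrable (N01 \<Otimes>\<^sub>M N01) ?g" "integral\<^sup>L (N01 \<Otimes>\<^sub>M N01) ?g = a * psi om"
    using integrable_N01_rotation[OF pq fm] integral_N01_rotation[OF pq fm] f unfolding eq by simp_all
  have "integrable N01 (\<lambda>w. LINT z|N01. ?g (w, z))" "(LINT w|N01. LINT z|N01. ?g (w, z)) = a * psi om"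
    using N01_pair.integrable_fst'[OF g(1)] N01_pair.integral_fst'[OF g(1)] g(2) by simp_all
  then show ?thesis
    unfolding LW_eq using integrable_N01_id
    by (simp add: integral_N01_id G_eq_psi algebra_simps)
qed

text \<open>The data value is the only argument and no auxiliary names occur, so the difference of
  the risk estimate and the loss is the mean of these functions of independent variables.\<close>

definition "coordinate_error x = (b + h) * sqrt (\<nu>f + \<nu>p * (alpha \<nu>p \<tau>)\<^sup>2) * T_hat n \<nu>p \<nu>f (b / (b + h)) \<gamma> (x - \<eta>) \<tau>
   - coord_loss \<nu>f b h \<theta> (alpha \<nu>p \<tau> * x + (1 - alpha \<nu>p \<tau>) * \<eta> + sqrt (\<nu>f + alpha \<nu>p \<tau> * \<nu>p) * Phi_inv (b / (b + h)))"

lemma coordinate_error_eq: "coordinate_error (\<theta> + sqrt \<nu>p * w) = (b + h) * (a * TW w - LW w)"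
  using coord_loss_eq[of w]
  by (simp add: coordinate_error_def TW_def a_def al_def be_def algebra_simps)

lemma coordinate_error_measurable: "coordinate_error \<in> borel_measurable borel"
proof -
  have TW: "TW \<in> borel_measurable borel" using borel_measurable_integrable[OF integrable_TW] by simp
  \<comment> \<open>The error is understood only along the parametrisation by standardised noise;
    solving for the noise transfers measurability back to \<open>x\<close>.\<close>
  have "coordinate_error x = (b + h) * (a * TW ((x - \<theta>) / sqrt \<nu>p) - LW ((x - \<theta>) / sqrt \<nu>p))" for x
    using coordinate_error_eq[of "(x - \<theta>) / sqrt \<nu>p"] nu_pos by simp
  then have eq: "coordinate_error = (\<lambda>x. (b + h) * (a * TW ((x - \<theta>) / sqrt \<nu>p) - LW ((x - \<theta>) / sqrt \<nu>p)))"
    by (rule ext)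
  show ?thesis unfolding eq
    by (intro borel_measurable_times borel_measurable_diff measurable_compose[OF _ TW] measurable_compose[OF _ LW_measurable]) simp_all
qed

lemma integrable_error: "integrable N01 (\<lambda>w. coordinate_error (\<theta> + sqrt \<nu>p * w))"
  unfolding coordinate_error_eq using integrable_TW integrable_LW by simp

text \<open>Estimator and loss have the common target \<open>a * G om be\<close>, so only the bias
  of \<open>F\<close> remains, multiplied by weights bounded through
  \<open>\<nu>p \<le> \<nu>f\<close>.\<close>

lemma error_bias:
  assumes "c \<le> \<gamma>\<^sup>2 / 8" "c \<le> 1 / 4" "b + h \<le> B" "\<nu>f \<le> V"
  shows "\<bar>LINT w|N01. coordinate_error (\<theta> + sqrt \<nu>p * w)\<bar> \<le> B * sqrt (2 * V) * (16 * (1 + ln (real n))\<^sup>2 * exp (- c * ln (real n)))"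
proof -
  have aV: "a \<le> sqrt (2 * V)"
  proof -
    have "al\<^sup>2 \<le> 1" using al_bounds by (simp add: abs_square_le_1)
    then have "\<nu>p * al\<^sup>2 \<le> \<nu>p * 1" using nu_pos by (intro mult_left_mono) auto
    then show ?thesis unfolding a_def using ratio_le assms by simp
  qed
  have "(LINT w|N01. coordinate_error (\<theta> + sqrt \<nu>p * w))
    = (b + h) * a * ((LINT x|(N01 \<Otimes>\<^sub>M N01). gc.F (fst x) (snd x)) - G om be)"
    unfolding coordinate_error_eq using integrable_TW integrable_LW
    by (simp add: integral_TW integral_LW algebra_simps)
  then have "\<bar>LINT w|N01. coordinate_error (\<theta> + sqrt \<nu>p * w)\<bar>
    = (b + h) * a * \<bar>(LINT x|(N01 \<Otimes>\<^sub>M N01). gc.F (fst x) (snd x)) - G om be\<bar>"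
    using bh_pos a_pos by (simp add: abs_mult)
  also have "\<dots> \<le> B * sqrt (2 * V) * (16 * (1 + gc.ell)\<^sup>2 * exp (- c * gc.ell))"
  proof (intro mult_mono gc.F_bias assms aV)
    show "0 \<le> B * sqrt (2 * V)" using assms bh_pos nu_pos by simp
  qed (use assms a_pos bh_pos in auto)
  finally show ?thesis by (simp add: gc.ell_def)
qed

lemma error_second_moment:
  assumes "b + h \<le> B" "\<nu>f \<le> V"
  obtains m where "integrable N01 (\<lambda>w. (coordinate_error (\<theta> + sqrt \<nu>p * w) - m)\<^sup>2)"
    "(LINT w|N01. (coordinate_error (\<theta> + sqrt \<nu>p * w) - m)\<^sup>2) \<le> B\<^sup>2 * V * (144 * (1 + ln (real n))\<^sup>2 * exp (3 / 4 * ln (real n)))"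
proof -
  define m where "m = (b + h) * (a * gc.centre - LW 0)"
  let ?R = "(1 + gc.ell)\<^sup>2 * exp (3 / 4 * gc.ell)"
  have a2V: "a\<^sup>2 \<le> 2 * V"
  proof -
    have "al\<^sup>2 \<le> 1" using al_bounds by (simp add: abs_square_le_1)
    then have "\<nu>p * al\<^sup>2 \<le> \<nu>p * 1" using nu_pos by (intro mult_left_mono) auto
    then show ?thesis unfolding a2 using ratio_le assms by simp
  qed
  have V: "0 < V" "\<nu>p \<le> V" using nu_pos ratio_le assms by auto
  have eq: "coordinate_error (\<theta> + sqrt \<nu>p * w) - m = (b + h) * (a * (TW w - gc.centre) + - (LW w - LW 0))" for w
    unfolding coordinate_error_eq m_def by (simp add: algebra_simps)
  have sq: "((b + h) * (a * (TW w - gc.centre) + - (LW w - LW 0)))\<^sup>2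
     \<le> (b + h)\<^sup>2 * (2 * (a\<^sup>2 * (TW w - gc.centre)\<^sup>2) + 2 * (LW w - LW 0)\<^sup>2)" for w
  proof -
    have "(a * (TW w - gc.centre) + - (LW w - LW 0))\<^sup>2 \<le> 2 * (a * (TW w - gc.centre))\<^sup>2 + 2 * (- (LW w - LW 0))\<^sup>2"
      by (rule square_add_le)
    also have "\<dots> = 2 * (a\<^sup>2 * (TW w - gc.centre)\<^sup>2) + 2 * (LW w - LW 0)\<^sup>2"
      unfolding power2_minus power_mult_distrib ..
    finally show ?thesis unfolding power_mult_distrib[of "b + h"] by (rule mult_left_mono) simp
  qed
  have g: "integrable N01 (\<lambda>w. (b + h)\<^sup>2 * (2 * (a\<^sup>2 * (TW w - gc.centre)\<^sup>2) + 2 * (LW w - LW 0)\<^sup>2))"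
    by (intro integrable_mult_right Bochner_Integration.integrable_add integrable_TW_centre integrable_LW_diff)
  have i: "integrable N01 (\<lambda>w. (coordinate_error (\<theta> + sqrt \<nu>p * w) - m)\<^sup>2)"
  proof (rule Bochner_Integration.integrable_bound[OF g])
    show "(\<lambda>w. (coordinate_error (\<theta> + sqrt \<nu>p * w) - m)\<^sup>2) \<in> borel_measurable N01"
      using borel_measurable_integrable[OF integrable_error] by measurable
    show "AE w in N01. norm ((coordinate_error (\<theta> + sqrt \<nu>p * w) - m)\<^sup>2)
       \<le> norm ((b + h)\<^sup>2 * (2 * (a\<^sup>2 * (TW w - gc.centre)\<^sup>2) + 2 * (LW w - LW 0)\<^sup>2))"
      unfolding eq using order_trans[OF sq abs_ge_self] by simp
  qed
  have R: "1 \<le> ?R"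
    using gc.ell_ge_1 mult_mono[of 1 "(1 + gc.ell)\<^sup>2" 1 "exp (3 / 4 * gc.ell)"] by (simp add: one_le_power)
  have "(LINT w|N01. (coordinate_error (\<theta> + sqrt \<nu>p * w) - m)\<^sup>2)
     \<le> (LINT w|N01. (b + h)\<^sup>2 * (2 * (a\<^sup>2 * (TW w - gc.centre)\<^sup>2) + 2 * (LW w - LW 0)\<^sup>2))"
    by (rule integral_mono[OF i g]) (unfold eq, rule sq)
  also have "\<dots> = (b + h)\<^sup>2 * (2 * (a\<^sup>2 * (LINT w|N01. (TW w - gc.centre)\<^sup>2)) + 2 * (LINT w|N01. (LW w - LW 0)\<^sup>2))"
    using integrable_TW_centre integrable_LW_diff by simp
  also have "\<dots> \<le> B\<^sup>2 * (2 * ((2 * V) * (32 * (1 + gc.ell)\<^sup>2 * exp (3 / 4 * gc.ell))) + 2 * (4 * V * ?R))"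
  proof (intro mult_mono add_mono order_refl a2V integral_TW_centre power_mono assms)
    have "(LINT w|N01. (LW w - LW 0)\<^sup>2) \<le> 4 * \<nu>p" by (rule integral_LW_diff)
    also have "\<dots> \<le> 4 * V * 1" using V by simp
    also have "\<dots> \<le> 4 * V * ?R" using V R by (intro mult_left_mono) auto
    finally show "(LINT w|N01. (LW w - LW 0)\<^sup>2) \<le> 4 * V * ?R" .
  qed (use bh_pos V in auto)
  \<comment> \<open>The two terms add up to 128 + 8 = 136; rounding up to 144 = 12^2 gives a clean
    square root later.\<close>
  also have "\<dots> \<le> B\<^sup>2 * V * (144 * (1 + gc.ell)\<^sup>2 * exp (3 / 4 * gc.ell))"
    using V R by (simp add: algebra_simps)
  finally show ?thesis by (intro that[of m] i) (simp add: gc.ell_def)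
qed

end

text \<open>Standardisation moves every moment of a coordinate to the fixed law \<open>N01\<close>,
  where the estimates were made.\<close>

lemma (in prob_space)
  fixes X :: "'a \<Rightarrow> real" and f :: "real \<Rightarrow> real"
  assumes D: "distributed M lborel X (normal_density \<mu> s)" and s: "0 < s"
    and [measurable]: "f \<in> borel_measurable borel"
  shows integrable_normal_iff: "integrable M (\<lambda>x. f (X x)) \<longleftrightarrow> integrable N01 (\<lambda>w. f (\<mu> + s * w))"
    and expectation_normal: "expectation (\<lambda>x. f (X x)) = (LINT w|N01. f (\<mu> + s * w))"
proof -
  let ?W = "\<lambda>x. (X x - \<mu>) / s"
  have W: "distributed M lborel ?W std_normal_density"
    using D normal_standard_normal_convert[OF s] by simp
  then have Wm: "?W \<in> borel_measurable M" using distributed_measurable by fastforce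
  have N: "N01 = distr M lborel ?W" using distributed_distr_eq_density[OF W] by simp
  show "integrable M (\<lambda>x. f (X x)) \<longleftrightarrow> integrable N01 (\<lambda>w. f (\<mu> + s * w))"
    unfolding N using s Wm by (subst integrable_distr_eq) simp_all
  show "expectation (\<lambda>x. f (X x)) = (LINT w|N01. f (\<mu> + s * w))"
    unfolding N using s Wm by (subst integral_distr) simp_all
qed

section \<open>Averaging over independent coordinates\<close>

text \<open>The average is its mean plus a centred average \<open>A\<close>; the former is
  controlled by the biases, the latter by its variance. The centres \<open>m i\<close> are arbitrary
  because the second moment about the mean is never larger.\<close>

lemma (in prob_space) expectation_abs_mean_le:
  fixes Y :: "'i \<Rightarrow> 'a \<Rightarrow> real"
  assumes I: "finite I" "I \<noteq> {}"
    and indep: "indep_vars (\<lambda>_. borel) Y I"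
    and int: "\<And>i. i \<in> I \<Longrightarrow> integrable M (Y i)"
    and int2: "\<And>i. i \<in> I \<Longrightarrow> integrable M (\<lambda>x. (Y i x - m i)\<^sup>2)"
    and Q: "\<And>i. i \<in> I \<Longrightarrow> expectation (\<lambda>x. (Y i x - m i)\<^sup>2) \<le> Q"
    and eps: "\<And>i. i \<in> I \<Longrightarrow> \<bar>expectation (Y i)\<bar> \<le> \<epsilon>"
  shows "expectation (\<lambda>x. \<bar>1 / real (card I) * (\<Sum>i\<in>I. Y i x)\<bar>) \<le> \<epsilon> + sqrt (Q / real (card I))"
proof -
  define Z where "Z i x = Y i x - expectation (Y i)" for i x
  let ?n = "real (card I)"
  have n: "0 < ?n" using I by (simp add: card_gt_0_iff)
  have Zint: "integrable M (Z i)" and Z0: "expectation (Z i) = 0" if "i \<in> I" for i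
    unfolding Z_def[abs_def] using int[OF that] by (simp_all add: prob_space)
  have indepZ: "indep_vars (\<lambda>_. borel) Z I"
    unfolding Z_def[abs_def] by (rule indep_vars_compose2[OF indep]) measurable
  have Z2: "integrable M (\<lambda>x. (Z i x)\<^sup>2)" "expectation (\<lambda>x. (Z i x)\<^sup>2) \<le> Q" if i: "i \<in> I" for i
  proof -
    let ?k = "expectation (Y i) - m i"
    \<comment> \<open>The linear term has mean zero, so passing from \<open>m i\<close> to the true
      mean only subtracts the square of the shift.\<close>
    have eq: "(Z i x)\<^sup>2 = (Y i x - m i)\<^sup>2 - 2 * ?k * Z i x - ?k\<^sup>2" for x
      by (simp add: Z_def power2_eq_square algebra_simps)
    show "integrable M (\<lambda>x. (Z i x)\<^sup>2)"
      unfolding eq using int2[OF i] Zint[OF i] by simp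
    have "expectation (\<lambda>x. (Z i x)\<^sup>2) = expectation (\<lambda>x. (Y i x - m i)\<^sup>2) - ?k\<^sup>2"
      unfolding eq using int2[OF i] Zint[OF i] Z0[OF i] by (simp add: prob_space)
    then show "expectation (\<lambda>x. (Z i x)\<^sup>2) \<le> Q"
      using Q[OF i] zero_le_power2[of ?k] by linarith
  qed
  have ZZ: "integrable M (\<lambda>x. Z i x * Z j x)" "expectation (\<lambda>x. Z i x * Z j x) = (if i = j then expectation (\<lambda>x. (Z i x)\<^sup>2) else 0)"
    if i: "i \<in> I" and j: "j \<in> I" for i j
  proof -
    \<comment> \<open>For distinct indices the product over \<open>{i, j}\<close> factorises by
      independence, and centring makes it zero; only the diagonal survives in the variance.\<close>
    have "integrable M (\<lambda>x. Z i x * Z j x) \<and> expectation (\<lambda>x. Z i x * Z j x) = 0" if "i \<noteq> j"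
    proof -
      have ind: "indep_vars (\<lambda>_. borel) Z {i, j}"
        using i j by (intro indep_vars_subset[OF indepZ]) auto
      have "integrable M (\<lambda>x. \<Prod>k\<in>{i, j}. Z k x)"
        using i j by (intro indep_vars_integrable ind) (auto simp: Zint)
      moreover have "expectation (\<lambda>x. \<Prod>k\<in>{i, j}. Z k x) = (\<Prod>k\<in>{i, j}. expectation (Z k))"
        using i j by (intro indep_vars_lebesgue_integral ind) (auto simp: Zint)
      ultimately show ?thesis using that Z0 i j by simp
    qed
    then show "integrable M (\<lambda>x. Z i x * Z j x)" "expectation (\<lambda>x. Z i x * Z j x) = (if i = j then expectation (\<lambda>x. (Z i x)\<^sup>2) else 0)"
      using Z2[OF i] by (cases "i = j"; simp add: power2_eq_square)+
  qed
  define A where "A x = 1 / ?n * (\<Sum>i\<in>I. Z i x)" for x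
  have A2: "(A x)\<^sup>2 = (1 / ?n)\<^sup>2 * (\<Sum>i\<in>I. \<Sum>j\<in>I. Z i x * Z j x)" for x
    unfolding A_def power_mult_distrib by (simp add: power2_eq_square sum_product)
  have A2int: "integrable M (\<lambda>x. (A x)\<^sup>2)"
    unfolding A2 by (intro integrable_mult_right Bochner_Integration.integrable_sum ZZ)
  have "expectation (\<lambda>x. (A x)\<^sup>2) = (1 / ?n)\<^sup>2 * (\<Sum>i\<in>I. \<Sum>j\<in>I. expectation (\<lambda>x. Z i x * Z j x))"
    unfolding A2 by (simp add: Bochner_Integration.integral_sum Bochner_Integration.integrable_sum ZZ(1))
  also have "(\<Sum>i\<in>I. \<Sum>j\<in>I. expectation (\<lambda>x. Z i x * Z j x)) = (\<Sum>i\<in>I. expectation (\<lambda>x. (Z i x)\<^sup>2))"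
    using I by (simp add: ZZ(2))
  also have "(1 / ?n)\<^sup>2 * \<dots> \<le> (1 / ?n)\<^sup>2 * (\<Sum>i\<in>I. Q)"
    by (intro mult_left_mono sum_mono Z2) auto
  also have "\<dots> = Q / ?n" using n by (simp add: power2_eq_square)
  finally have EA2: "expectation (\<lambda>x. (A x)\<^sup>2) \<le> Q / ?n" .
  have Aint: "integrable M A" unfolding A_def[abs_def]
    by (intro integrable_mult_right Bochner_Integration.integrable_sum Zint)
  have "(expectation (\<lambda>x. \<bar>A x\<bar>))\<^sup>2 \<le> expectation (\<lambda>x. \<bar>A x\<bar>\<^sup>2)"
    using A2int Aint by (intro square_expectation_le) auto
  also have "\<dots> \<le> Q / ?n" using EA2 by simp
  finally have EA: "expectation (\<lambda>x. \<bar>A x\<bar>) \<le> sqrt (Q / ?n)" by (rule real_le_rsqrt)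
  have mean: "1 / ?n * (\<Sum>i\<in>I. Y i x) = A x + 1 / ?n * (\<Sum>i\<in>I. expectation (Y i))" for x
    unfolding A_def Z_def by (simp add: sum_subtractf algebra_simps)
  have "\<bar>1 / ?n * (\<Sum>i\<in>I. expectation (Y i))\<bar> \<le> 1 / ?n * (\<Sum>i\<in>I. \<epsilon>)"
    unfolding abs_mult using n by (intro mult_mono order_trans[OF sum_abs] sum_mono eps) auto
  also have "\<dots> = \<epsilon>" using n by simp
  finally have bias: "\<bar>1 / ?n * (\<Sum>i\<in>I. expectation (Y i))\<bar> \<le> \<epsilon>" .
  have "expectation (\<lambda>x. \<bar>1 / ?n * (\<Sum>i\<in>I. Y i x)\<bar>) \<le> expectation (\<lambda>x. \<bar>A x\<bar> + \<epsilon>)"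
  proof (rule integral_mono)
    show "integrable M (\<lambda>x. \<bar>1 / ?n * (\<Sum>i\<in>I. Y i x)\<bar>)"
      by (intro integrable_abs integrable_mult_right Bochner_Integration.integrable_sum int)
    show "integrable M (\<lambda>x. \<bar>A x\<bar> + \<epsilon>)" using Aint by simp
    show "\<bar>1 / ?n * (\<Sum>i\<in>I. Y i x)\<bar> \<le> \<bar>A x\<bar> + \<epsilon>" for x
      using bias unfolding mean by linarith
  qed
  also have "\<dots> = expectation (\<lambda>x. \<bar>A x\<bar>) + \<epsilon>" using Aint by (simp add: prob_space)
  finally show ?thesis using EA by linarith
qed

lemma SUP_ereal_bounded:
  assumes "(SUP i\<in>I. ereal (f i)) < \<infinity>"
  obtains B where "0 < B" "\<And>i. i \<in> I \<Longrightarrow> f i \<le> B"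
proof -
  obtain k :: nat where k: "(SUP i\<in>I. ereal (f i)) < ereal (real k)"
    using less_PInf_Ex_of_nat[of "SUP i\<in>I. ereal (f i)"] assms by auto
  show thesis
  proof (rule that[of "real k + 1"])
    fix i assume "i \<in> I"
    then have "ereal (f i) \<le> (SUP i\<in>I. ereal (f i))" by (rule SUP_upper)
    also note k
    finally show "f i \<le> real k + 1" by simp
  qed simp
qed

lemma INF_ereal_positive:
  assumes "0 < (INF i\<in>I. ereal (f i))"
  obtains g where "0 < g" "\<And>i. i \<in> I \<Longrightarrow> g \<le> f i"
proof -
  obtain g where g: "0 < ereal g" "ereal g < (INF i\<in>I. ereal (f i))"
    using ereal_dense2[OF assms] by blast
  show thesis
  proof (rule that[of g])
    fix i assume "i \<in> I"
    then have "(INF i\<in>I. ereal (f i)) \<le> ereal (f i)" by (rule INF_lower)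
    with g(2) have "ereal g < ereal (f i)" by (rule less_le_trans)
    then show "g \<le> f i" by simp
  qed (use g in simp)
qed

theorem theorem1p5:
  fixes \<theta> \<nu>p \<nu>f b h \<gamma> :: "nat \<Rightarrow> real"
    and M :: "nat \<Rightarrow> 'a measure"
    and X :: "nat \<Rightarrow> nat \<Rightarrow> 'a \<Rightarrow> real"
  assumes pos: "\<And>i. i \<ge> 1 \<Longrightarrow> \<nu>p i > 0" "\<And>i. i \<ge> 1 \<Longrightarrow> \<nu>f i > 0"
      "\<And>i. i \<ge> 1 \<Longrightarrow> b i > 0" "\<And>i. i \<ge> 1 \<Longrightarrow> h i > 0"
    and prob: "\<And>n. a_seq n > 0 \<Longrightarrow> prob_space (M n)"
    and indep: "\<And>n. a_seq n > 0 \<Longrightarrow>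
      prob_space.indep_vars (M n) (\<lambda>_. borel) (X n) {1..n}"
    and normal: "\<And>n i. a_seq n > 0 \<Longrightarrow> i \<in> {1..n} \<Longrightarrow>
      distributed (M n) lborel (X n i) (normal_density (\<theta> i) (sqrt (\<nu>p i)))"
    and A1: "0 < (INF i\<in>{1..}. ereal (btilde b h i))"
      "(SUP i\<in>{1..}. ereal (btilde b h i)) < 1"
      "(SUP i\<in>{1..}. ereal (b i + h i)) < \<infinity>"
    and A2: "limsup (\<lambda>n. ereal ((1 / real n) * (\<Sum>i=1..n. \<bar>\<theta> i\<bar>))) < \<infinity>"
    and A3: "(SUP i\<in>{1..}. ereal (\<nu>p i / \<nu>f i)) < ereal (1 / (4 * exp 1))"
      "(SUP i\<in>{1..}. ereal (\<nu>f i)) < \<infinity>"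
      "0 < (INF i\<in>{1..}. ereal (\<nu>p i))"
    and gamma: "\<And>i. i \<ge> 1 \<Longrightarrow>
        0 < \<gamma> i \<and> \<gamma> i < 1 / sqrt (4 * exp 1) - sqrt (\<nu>p i / \<nu>f i)"
      "0 < (INF i\<in>{1..}. ereal (\<gamma> i))"
  shows "(\<lambda>n. SUP (\<eta>, \<tau>) \<in> {\<eta>. \<bar>\<eta>\<bar> \<le> a_seq n} \<times> (UNIV :: ennreal set).
            ennreal (a_seq n ^ 4) *
            (\<integral>\<^sup>+ \<omega>. ennreal \<bar>ARE_D \<nu>p \<nu>f b h \<gamma> n (\<lambda>i. X n i \<omega>) \<eta> \<tau>
                - avg_loss \<nu>f b h n \<theta> (predictor \<nu>p \<nu>f b h (\<lambda>i. X n i \<omega>) \<eta> \<tau>)\<bar> \<partial>M n))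
         \<longlonglongrightarrow> 0"
proof -
  obtain B where B: "0 < B" "\<And>i. i \<ge> 1 \<Longrightarrow> b i + h i \<le> B"
    using SUP_ereal_bounded[OF A1(3)] by auto
  obtain V where V: "0 < V" "\<And>i. i \<ge> 1 \<Longrightarrow> \<nu>f i \<le> V"
    using SUP_ereal_bounded[OF A3(2)] by auto
  obtain g where g: "0 < g" "\<And>i. i \<ge> 1 \<Longrightarrow> g \<le> \<gamma> i"
    using INF_ereal_positive[OF gamma(2)] by auto
  \<comment> \<open>One decay exponent for all coordinates: the bias bound requires \<open>c\<close>
    below the squared \<gamma>(i) over 8 for each i, so it is built from a positive lower bound
    \<open>g\<close> of all of them.\<close>
  define c where "c = min (g\<^sup>2 / 8) (1 / 4)"
  have c: "0 < c" using g by (simp add: c_def)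
  define eps where "eps n = B * sqrt (2 * V) * (16 * (1 + ln (real n))\<^sup>2 * exp (- c * ln (real n)))" for n
  define Q where "Q n = B\<^sup>2 * V * (144 * (1 + ln (real n))\<^sup>2 * exp (3 / 4 * ln (real n)))" for n
  define bound where "bound n = a_seq n ^ 4 * (eps n + sqrt (Q n / real n))" for n

  have le: "(SUP (\<eta>, \<tau>) \<in> {\<eta>. \<bar>\<eta>\<bar> \<le> a_seq n} \<times> (UNIV :: ennreal set).
            ennreal (a_seq n ^ 4) *
            (\<integral>\<^sup>+ \<omega>. ennreal \<bar>ARE_D \<nu>p \<nu>f b h \<gamma> n (\<lambda>i. X n i \<omega>) \<eta> \<tau>
                - avg_loss \<nu>f b h n \<theta> (predictor \<nu>p \<nu>f b h (\<lambda>i. X n i \<omega>) \<eta> \<tau>)\<bar> \<partial>M n)) \<le> ennreal (bound n)"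
    if a: "0 < a_seq n" and n: "3 \<le> n" for n
  proof -
    interpret prob_space "M n" by (rule prob[OF a])
    have "ennreal (a_seq n ^ 4) * (\<integral>\<^sup>+ \<omega>. ennreal \<bar>ARE_D \<nu>p \<nu>f b h \<gamma> n (\<lambda>i. X n i \<omega>) \<eta> \<tau>
                - avg_loss \<nu>f b h n \<theta> (predictor \<nu>p \<nu>f b h (\<lambda>i. X n i \<omega>) \<eta> \<tau>)\<bar> \<partial>M n) \<le> ennreal (bound n)" for \<eta> \<tau>
    proof -
      define err where "err i = coordinate_problem.coordinate_error n (\<nu>p i) (\<nu>f i) (b i) (h i) (\<gamma> i) (\<theta> i) \<eta> \<tau>" for i
      have cp: "coordinate_problem n (\<nu>p i) (\<nu>f i) (b i) (h i) (\<gamma> i)" if "i \<in> {1..n}" for i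
        using that pos gamma(1) n by unfold_locales auto
      have meas: "err i \<in> borel_measurable borel" if "i \<in> {1..n}" for i
        unfolding err_def by (rule coordinate_problem.coordinate_error_measurable[OF cp[OF that]])
      have err_int: "integrable N01 (\<lambda>w. err i (\<theta> i + sqrt (\<nu>p i) * w))" if "i \<in> {1..n}" for i
        unfolding err_def by (rule coordinate_problem.integrable_error[OF cp[OF that]])
      have "\<exists>m. integrable N01 (\<lambda>w. (err i (\<theta> i + sqrt (\<nu>p i) * w) - m)\<^sup>2) \<and>
        (LINT w|N01. (err i (\<theta> i + sqrt (\<nu>p i) * w) - m)\<^sup>2) \<le> Q n" if i: "i \<in> {1..n}" for i
        unfolding err_def Q_def
        by (rule coordinate_problem.error_second_moment[OF cp[OF i] B(2) V(2),
              where \<theta> = "\<theta> i" and \<eta> = \<eta> and \<tau> = \<tau>]) (use i in auto)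
      \<comment> \<open>The centre depends on the coordinate, so one is chosen for each
        index.\<close>
      then obtain m where m: "\<And>i. i \<in> {1..n} \<Longrightarrow> integrable N01 (\<lambda>w. (err i (\<theta> i + sqrt (\<nu>p i) * w) - m i)\<^sup>2)"
        "\<And>i. i \<in> {1..n} \<Longrightarrow> (LINT w|N01. (err i (\<theta> i + sqrt (\<nu>p i) * w) - m i)\<^sup>2) \<le> Q n"
        by metis
      have bias: "\<bar>LINT w|N01. err i (\<theta> i + sqrt (\<nu>p i) * w)\<bar> \<le> eps n" if i: "i \<in> {1..n}" for i
      proof -
        have "g\<^sup>2 \<le> (\<gamma> i)\<^sup>2" using g i by (intro power_mono) auto
        then have "c \<le> (\<gamma> i)\<^sup>2 / 8" "c \<le> 1 / 4" by (auto simp: c_def)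
        then show ?thesis
          unfolding err_def eps_def using B V i
          by (intro coordinate_problem.error_bias[OF cp[OF i]]) auto
      qed
      have s: "0 < sqrt (\<nu>p i)" if "i \<in> {1..n}" for i using pos that by simp
      let ?Y = "\<lambda>i \<omega>. err i (X n i \<omega>)"
      have Yint: "integrable (M n) (?Y i)" if i: "i \<in> {1..n}" for i
        using integrable_normal_iff[OF normal[OF a i] s[OF i] meas[OF i]] err_int[OF i] by simp
      have mean: "expectation (\<lambda>\<omega>. \<bar>1 / real (card {1..n}) * (\<Sum>i\<in>{1..n}. ?Y i \<omega>)\<bar>) \<le> eps n + sqrt (Q n / real (card {1..n}))"
      proof (rule expectation_abs_mean_le[where m = m])
        show "indep_vars (\<lambda>_. borel) ?Y {1..n}"
          by (rule indep_vars_compose2[OF indep[OF a]]) (rule meas)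
      next
        fix i assume i: "i \<in> {1..n}"
        have [measurable]: "err i \<in> borel_measurable borel" by (rule meas[OF i])
        have mm: "(\<lambda>x. (err i x - m i)\<^sup>2) \<in> borel_measurable borel" by measurable
        show "integrable (M n) (?Y i)" by (rule Yint[OF i])
        show "integrable (M n) (\<lambda>\<omega>. (?Y i \<omega> - m i)\<^sup>2)"
          using integrable_normal_iff[OF normal[OF a i] s[OF i] mm] m(1)[OF i] by simp
        show "expectation (\<lambda>\<omega>. (?Y i \<omega> - m i)\<^sup>2) \<le> Q n"
          using expectation_normal[OF normal[OF a i] s[OF i] mm] m(2)[OF i] by simp
        show "\<bar>expectation (?Y i)\<bar> \<le> eps n"
          using expectation_normal[OF normal[OF a i] s[OF i] meas[OF i]] bias[OF i] by simp
      qed (use n in auto)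
      have diff: "ARE_D \<nu>p \<nu>f b h \<gamma> n (\<lambda>i. X n i \<omega>) \<eta> \<tau>
                - avg_loss \<nu>f b h n \<theta> (predictor \<nu>p \<nu>f b h (\<lambda>i. X n i \<omega>) \<eta> \<tau>)
             = 1 / real (card {1..n}) * (\<Sum>i\<in>{1..n}. ?Y i \<omega>)" for \<omega>
        unfolding ARE_D_def avg_loss_def right_diff_distrib[symmetric] sum_subtractf[symmetric]
        by (intro arg_cong2[where f = "(*)"] sum.cong)
           (simp_all add: err_def coordinate_problem.coordinate_error_def[OF cp] predictor_def btilde_def)
      have "(\<integral>\<^sup>+ \<omega>. ennreal \<bar>1 / real (card {1..n}) * (\<Sum>i\<in>{1..n}. ?Y i \<omega>)\<bar> \<partial>M n)
        = ennreal (expectation (\<lambda>\<omega>. \<bar>1 / real (card {1..n}) * (\<Sum>i\<in>{1..n}. ?Y i \<omega>)\<bar>))"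
        by (intro nn_integral_eq_integral integrable_abs integrable_mult_right Bochner_Integration.integrable_sum Yint) auto
      also have "\<dots> \<le> ennreal (eps n + sqrt (Q n / real n))"
        using mean by (intro ennreal_leI) simp
      finally have "ennreal (a_seq n ^ 4) * (\<integral>\<^sup>+ \<omega>. ennreal \<bar>1 / real (card {1..n}) * (\<Sum>i\<in>{1..n}. ?Y i \<omega>)\<bar> \<partial>M n)
        \<le> ennreal (a_seq n ^ 4) * ennreal (eps n + sqrt (Q n / real n))"
        by (rule mult_left_mono) simp
      also have "\<dots> = ennreal (bound n)"
        unfolding bound_def using a by (intro ennreal_mult'[symmetric]) simp
      finally show ?thesis unfolding diff .
    qed
    then show ?thesis by (intro SUP_least) auto
  qed

  have "bound \<longlonglongrightarrow> 0"
  proof -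
    \<comment> \<open>The constants are pulled out and the square root is resolved, which leaves two
      explicit functions of ln n. Each is a power of logarithms times a negative power of n, namely
      -c and -1/8, half of 3/4 - 1.\<close>
    have ev: "eventually (\<lambda>n. B * sqrt (2 * V) * 16 * (ln (ln (real n)) ^ 4 * ((1 + ln (real n))\<^sup>2 * exp (- c * ln (real n))))
       + 12 * B * sqrt V * (ln (ln (real n)) ^ 4 * ((1 + ln (real n)) * exp (- ln (real n) / 8))) = bound n) sequentially"
      using eventually_ge_at_top[of 3]
    proof eventually_elim
      case (elim n)
      let ?l = "ln (real n)"
      have l: "0 \<le> ?l" and e: "real n = exp ?l" using elim by auto
      have "Q n / real n = (12 * B * sqrt V * ((1 + ?l) * exp (- ?l / 8)))\<^sup>2"
      proof -
        have "(exp (- ?l / 8))\<^sup>2 = exp (- ?l / 4)" by (simp add: power2_eq_square exp_add[symmetric])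
        moreover have "exp (3 / 4 * ?l) / real n = exp (- ?l / 4)"
          by (subst e) (simp only: exp_diff[symmetric], simp)
        moreover have "Q n / real n = B\<^sup>2 * V * 144 * (1 + ?l)\<^sup>2 * (exp (3 / 4 * ?l) / real n)"
          by (simp add: Q_def)
        ultimately show ?thesis using V by (simp add: power_mult_distrib)
      qed
      then have "sqrt (Q n / real n) = 12 * B * sqrt V * ((1 + ?l) * exp (- ?l / 8))"
        using l B V by simp
      then show ?case by (simp add: bound_def eps_def a_seq_def algebra_simps)
    qed
    have lim1: "(\<lambda>n. ln (ln (real n)) ^ 4 * ((1 + ln (real n))\<^sup>2 * exp (- c * ln (real n)))) \<longlonglongrightarrow> 0"
      using c by real_asymp
    have lim2: "(\<lambda>n. ln (ln (real n)) ^ 4 * ((1 + ln (real n)) * exp (- ln (real n) / 8))) \<longlonglongrightarrow> 0"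
      by real_asymp
    show ?thesis
      using Lim_transform_eventually[OF tendsto_add[OF tendsto_mult_left[OF lim1] tendsto_mult_left[OF lim2]] ev]
      by simp
  qed
  then have lim: "(\<lambda>n. ennreal (bound n)) \<longlonglongrightarrow> 0"
    using tendsto_ennrealI[of bound 0 sequentially] by simp
  have "filterlim a_seq at_top sequentially" unfolding a_seq_def by real_asymp
  then have "eventually (\<lambda>n. 0 < a_seq n) sequentially" by (simp add: filterlim_at_top_dense)
  then have "eventually (\<lambda>n. (SUP (\<eta>, \<tau>) \<in> {\<eta>. \<bar>\<eta>\<bar> \<le> a_seq n} \<times> (UNIV :: ennreal set).
            ennreal (a_seq n ^ 4) *
            (\<integral>\<^sup>+ \<omega>. ennreal \<bar>ARE_D \<nu>p \<nu>f b h \<gamma> n (\<lambda>i. X n i \<omega>) \<eta> \<tau>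
                - avg_loss \<nu>f b h n \<theta> (predictor \<nu>p \<nu>f b h (\<lambda>i. X n i \<omega>) \<eta> \<tau>)\<bar> \<partial>M n)) \<le> ennreal (bound n)) sequentially"
    using eventually_ge_at_top[of 3] by eventually_elim (rule le)
  then show ?thesis
    by (intro tendsto_sandwich[OF _ _ tendsto_const lim]) auto
qed

end
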